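(* Let $b\ge2$ be an integer, let $R,d\in\mathbb N_+$ and let $\varepsilon>0$ be real. Let $(G,\mathbf R)$ be a Borel colouring problem (with $b$ colours) such that $\operatorname{maxdeg}(G)\le d$ and $|N_G(x,3R)|\le(1+\varepsilon)^R$ for all $x\in V(G)$. Let $\Delta:=\operatorname{maxdeg}(\operatorname{Rel}(G))>0$ and assume that $$\max_{x\in V(G)}\frac{b^{\varepsilon d}\,|\mathbf R^c(x)|}{b^{|\operatorname{Var}(x)|}}<\frac1{\mathrm e\Delta}.$$ Then there exists a Borel function $f\in b^{V(G)}$ which satisfies $\mathbf R$.
   Context: $b$ also denotes the set $\{0,\dots,b-1\}$ and $b^X$ is the set of functions $X\to\{0,\dots,b-1\}$; $\operatorname{Pow}(X)$ is the power set. A digraph $G=(V(G),E(G))$ has non-empty vertex set and $E(G)\subset V(G)\times V(G)$ (self-loops allowed). For $x\in V(G)$: $\operatorname{Var}(x)=\{y:(x,y)\in E(G)\}$, $\operatorname{Cl}(x)=\{y:(y,x)\in E(G)\}$, $\deg(x)=|\operatorname{Var}(x)\cup\operatorname{Cl}(x)|$, $\operatorname{maxdeg}(G)=\max_x\deg(x)$. $N_G(x,r)$ is the set of vertices at graph distance (ignoring orientations) at most $r$ from $x$. $\operatorname{Rel}(G)$ is the digraph on $V(G)$ with $(x,y)$ an edge iff $\operatorname{Var}(x)\cap\operatorname{Var}(y)\neq\emptyset$ (loops included and counted in degrees). A local rule on $G$ assigns to every $x\in V(G)$ a set $\mathbf R(x)\subset b^{\operatorname{Var}(x)}$ with $\mathbf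 R(x)=b^{\operatorname{Var}(x)}$ whenever $\operatorname{Var}(x)=\emptyset$; $\mathbf R^c(x)=b^{\operatorname{Var}(x)}\setminus\mathbf R(x)$. A function $f\in b^{V(G)}$ satisfies $\mathbf R$ if $f\restriction\operatorname{Var}(x)\in\mathbf R(x)$ for all $x\in V(G)$. A Borel digraph is a digraph $G$ with finite $\operatorname{maxdeg}(G)$ whose vertex set is a standard Borel space and whose edge set is a Borel subset of $V(G)\times V(G)$. A partition $\pi$ of $V(G)$ is a finite set of pairwise disjoint subsets with union $V(G)$; $S_\pi(x)$ is the part containing $x$; $\pi$ is $r$-sparse if for every $x$ different points of $N_G(x,r)$ belong to different parts; $\pi$ is Borel if all its parts are Borel. Every Borel digraph (of bounded degree) has a Borel $2$-sparse partition. A local rule $\mathbf R$ on a Borel digraph $G$ is Borel if, for a Borel $2$-sparse partition $\pi$ of $V(G)$, the function $\ell_{\mathbf R}:V(G)\to\operatorname{Pow}(b^\pi)$, $\ell_{\mathbf R}(x)=\{\psi\in b^\pi:(\psi\circ S_\pi)\restriction\operatorname{Var}(x)\in\mathbf R(x)\}$, is Borel (with the finite set $\operatorname{Pow}(b^\pi)$ discrete); this does not depend on the choice of $\pi$. A Borel colouring problem is a pair $(G,\mathbf R)$ with $G$ a Borel digraph and $\mathbf R$ a Borel local rule on $G$. *)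

theory Defs
  imports "HOL-Analysis.Analysis"
begin

text \<open>
  A standard Borel space is the Borel \<open>\<sigma>\<close>-algebra of a Polish topology on its carrier; the
  measure carried by the type \<open>'a measure\<close> plays no role.
\<close>

definition standard_borel_space :: "'a measure \<Rightarrow> bool" where
  "standard_borel_space M \<longleftrightarrow>
     (\<exists>X. completely_metrizable_space X \<and> separable_space X \<and> topspace X = space M \<and>
          sets M = sigma_sets (space M) {U. openin X U})"

text \<open>Digraphs may be infinite, and self-loops are allowed.\<close>

definition digraph :: "'a set \<Rightarrow> ('a \<times> 'a) set \<Rightarrow> bool" where
  "digraph V E \<longleftrightarrow> V \<noteq> {} \<and> E \<subseteq> V \<times> V"

definition Var :: "('a \<times> 'a) set \<Rightarrow> 'a \<Rightarrow> 'a set" where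
  "Var E x = {y. (x, y) \<in> E}"

definition Cl :: "('a \<times> 'a) set \<Rightarrow> 'a \<Rightarrow> 'a set" where
  "Cl E x = {y. (y, x) \<in> E}"

text \<open>Degrees are extended naturals, so that a vertex with infinitely many neighbours has
  degree \<open>\<infinity>\<close> (the value of \<open>card\<close> would be \<open>0\<close>).\<close>

definition degree :: "('a \<times> 'a) set \<Rightarrow> 'a \<Rightarrow> enat" where
  "degree E x =
     (if finite (Var E x \<union> Cl E x) then enat (card (Var E x \<union> Cl E x)) else \<infinity>)"

definition maxdeg :: "'a set \<Rightarrow> ('a \<times> 'a) set \<Rightarrow> enat" where
  "maxdeg V E = (SUP x\<in>V. degree E x)"

text \<open>Balls in the graph distance that ignores the orientation of the edges.\<close>

definition nbhd :: "('a \<times> 'a) set \<Rightarrow> 'a \<Rightarrow> nat \<Rightarrow> 'a set" where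
  "nbhd E x r = {y. \<exists>n\<le>r. (x, y) \<in> (E \<union> E\<inverse>) ^^ n}"

definition Rel :: "'a set \<Rightarrow> ('a \<times> 'a) set \<Rightarrow> ('a \<times> 'a) set" where
  "Rel V E = {(x, y). x \<in> V \<and> y \<in> V \<and> Var E x \<inter> Var E y \<noteq> {}}"

text \<open>The number \<open>b\<close> stands for \<open>{0,\<dots>,b-1}\<close>. Functions with domain \<open>X\<close> are
  represented extensionally, i.e. they take the value \<open>undefined\<close> outside \<open>X\<close>. In particular
  \<open>colourings b {}\<close> has exactly one element.\<close>

abbreviation colourings :: "nat \<Rightarrow> 'x set \<Rightarrow> ('x \<Rightarrow> nat) set" where
  "colourings b X \<equiv> X \<rightarrow>\<^sub>E {..<b}"

definition local_rule ::
    "nat \<Rightarrow> 'a set \<Rightarrow> ('a \<times> 'a) set \<Rightarrow> ('a \<Rightarrow> ('a \<Rightarrow> nat) set) \<Rightarrow> bool" where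
  "local_rule b V E R \<longleftrightarrow>
     (\<forall>x\<in>V. R x \<subseteq> colourings b (Var E x) \<and>
            (Var E x = {} \<longrightarrow> R x = colourings b (Var E x)))"

definition rule_compl ::
    "nat \<Rightarrow> ('a \<times> 'a) set \<Rightarrow> ('a \<Rightarrow> ('a \<Rightarrow> nat) set) \<Rightarrow> 'a \<Rightarrow> ('a \<Rightarrow> nat) set" where
  "rule_compl b E R x = colourings b (Var E x) - R x"

definition satisfies ::
    "'a set \<Rightarrow> ('a \<times> 'a) set \<Rightarrow> ('a \<Rightarrow> nat) \<Rightarrow> ('a \<Rightarrow> ('a \<Rightarrow> nat) set) \<Rightarrow> bool" where
  "satisfies V E f R \<longleftrightarrow> (\<forall>x\<in>V. restrict f (Var E x) \<in> R x)"

text \<open>In contrast to \<^const>\<open>partition_on\<close>, a partition is finite and one of its parts may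
  be empty.\<close>

definition fin_partition :: "'a set \<Rightarrow> 'a set set \<Rightarrow> bool" where
  "fin_partition V \<pi> \<longleftrightarrow> finite \<pi> \<and> disjoint \<pi> \<and> \<Union>\<pi> = V"

definition part_of :: "'a set set \<Rightarrow> 'a \<Rightarrow> 'a set" where
  "part_of \<pi> x = (THE S. S \<in> \<pi> \<and> x \<in> S)"

definition sparse :: "'a set \<Rightarrow> ('a \<times> 'a) set \<Rightarrow> nat \<Rightarrow> 'a set set \<Rightarrow> bool" where
  "sparse V E r \<pi> \<longleftrightarrow> (\<forall>x\<in>V. inj_on (part_of \<pi>) (nbhd E x r))"

definition borel_digraph :: "'a measure \<Rightarrow> ('a \<times> 'a) set \<Rightarrow> bool" where
  "borel_digraph M E \<longleftrightarrow>
     standard_borel_space M \<and> digraph (space M) E \<and> E \<in> sets (M \<Otimes>\<^sub>M M) \<and>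
     maxdeg (space M) E < \<infinity>"

definition rule_code ::
    "nat \<Rightarrow> ('a \<times> 'a) set \<Rightarrow> ('a \<Rightarrow> ('a \<Rightarrow> nat) set) \<Rightarrow> 'a set set \<Rightarrow> 'a \<Rightarrow> ('a set \<Rightarrow> nat) set" where
  "rule_code b E R \<pi> x =
     {\<psi> \<in> colourings b \<pi>. restrict (\<psi> \<circ> part_of \<pi>) (Var E x) \<in> R x}"

text \<open>Every Borel digraph has a Borel 2-sparse partition and measurability of
  \<^const>\<open>rule_code\<close> does not depend on its choice, so it is required for some such partition.\<close>

definition borel_local_rule ::
    "nat \<Rightarrow> 'a measure \<Rightarrow> ('a \<times> 'a) set \<Rightarrow> ('a \<Rightarrow> ('a \<Rightarrow> nat) set) \<Rightarrow> bool" where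
  "borel_local_rule b M E R \<longleftrightarrow>
     local_rule b (space M) E R \<and>
     (\<exists>\<pi>. fin_partition (space M) \<pi> \<and> \<pi> \<subseteq> sets M \<and> sparse (space M) E 2 \<pi> \<and>
          rule_code b E R \<pi> \<in> measurable M (count_space (Pow (colourings b \<pi>))))"

definition borel_colouring_problem ::
    "nat \<Rightarrow> 'a measure \<Rightarrow> ('a \<times> 'a) set \<Rightarrow> ('a \<Rightarrow> ('a \<Rightarrow> nat) set) \<Rightarrow> bool" where
  "borel_colouring_problem b M E R \<longleftrightarrow> borel_digraph M E \<and> borel_local_rule b M E R"

end

theory Submission
  imports Defs
begin

text \<open>
  The assignment is found by a parallel Moser--Tardos algorithm whose random bits are shared by all
  vertices of the same colour, for a finite Borel colouring that is injective on balls of radius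
  \<open>3 r + 1\<close>. Call a seed bad if some rule is resampled \<open>m\<close> times, and look at the first time this
  happens, at the vertex \<open>x\<close>. At that time every other rule has been resampled at most \<open>m\<close> times, so by
  the growth bound there is \<open>k < r\<close> such that passing from the ball of radius \<open>3 k\<close> around \<open>x\<close> to that of
  radius \<open>3 k + 3\<close> increases the number of resamplings by a factor of at most \<open>1 + \<epsilon>\<close>. The resamplings
  in the larger ball determine which bits are read in the smaller one. Counting the histories up to
  commutation, each resampling costs a factor \<open>e \<Delta>\<close> and each one in the smaller ball gains a factor
  \<open>q\<close>, the largest violation probability. As \<open>q (e \<Delta>)\<close> to the power \<open>1 + \<epsilon>\<close> is less than 1 and the
  number of possible local structures is independent of \<open>m\<close>, a seed that is good everywhere exists
  for large \<open>m\<close>. With such a seed every variable changes finitely often, and the limit is a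
  Borel solution.

  Borel measurability of the algorithm requires that the neighbours of a vertex are given by finitely
  many Borel maps, which follows from the Lusin--Souslin theorem.
\<close>

subsection \<open>The Lusin--Souslin theorem\<close>

text \<open>The outcome must be good at every vertex of a possibly uncountable space, so no estimate
  that fails with small probability at each vertex can be summed over the vertices. Sharing bits by
  colour turns the seed into one finite table, and a union bound over finitely many coloured ball
  structures takes the place of one over vertices. The price is that resamplings at distant vertices
  are no longer independent, so every estimate has to live inside one ball on which the colouring is
  injective. Such a ball does not see what happens outside it: near its boundary a variable may also
  be resampled by an outside rule, and then it is unknown which bits a rule has read. Resamplings
  there are recorded, but yield no factor \<open>q\<close>. The growth bound serves to keep their
  number at most \<epsilon> times the number of those that do yield it, and the exponent
  \<open>1 + \<epsilon>\<close> is this ratio of all entries to the gaining ones. Rules with a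
  common variable are at distance at most 2, so a margin of 3 shows everything that touches the
  variables of rules in the smaller ball.\<close>

type_synonym sequence = "nat \<Rightarrow> nat"

definition agree :: "nat \<Rightarrow> sequence \<Rightarrow> sequence \<Rightarrow> bool" where
  "agree k x y \<longleftrightarrow> (\<forall>i<k. x i = y i)"

text \<open>Closed subsets of the square of the Baire space, described by prefixes.\<close>

definition closed_rel :: "(sequence \<times> sequence) set \<Rightarrow> bool" where
  "closed_rel D \<longleftrightarrow>
     (\<forall>x y. (\<forall>k. \<exists>x' y'. (x', y') \<in> D \<and> agree k x x' \<and> agree k y y') \<longrightarrow> (x, y) \<in> D)"

definition baire :: "sequence measure" where
  "baire = (\<Pi>\<^sub>M i\<in>UNIV. count_space UNIV)"

lemma space_baire [simp]: "space baire = UNIV"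
  by (simp add: baire_def space_PiM)

lemma agree_refl [simp]: "agree k x x"
  by (simp add: agree_def)

lemma closed_relD:
  assumes "closed_rel D" "\<And>k. \<exists>x' y'. (x', y') \<in> D \<and> agree k x x' \<and> agree k y y'"
  shows "(x, y) \<in> D"
  using assms unfolding closed_rel_def by blast

text \<open>The second hypothesis is continuity of \<open>(g1, g2)\<close>: a prefix of the values
  is determined near a point by a prefix of the arguments.\<close>

lemma closed_rel_vimage:
  assumes D: "closed_rel D"
    and g: "\<And>x y k. \<exists>K. \<forall>x' y'. agree K x x' \<longrightarrow> agree K y y' \<longrightarrow>
              agree k (g1 x y) (g1 x' y') \<and> agree k (g2 x y) (g2 x' y')"
  shows "closed_rel {(x, y). (g1 x y, g2 x y) \<in> D}"
  unfolding closed_rel_def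
proof (intro allI impI)
  fix x y
  assume lim: "\<forall>k. \<exists>x' y'. (x', y') \<in> {(x, y). (g1 x y, g2 x y) \<in> D} \<and> agree k x x' \<and> agree k y y'"
  have "(g1 x y, g2 x y) \<in> D"
  proof (rule closed_relD[OF D])
    fix k
    from g obtain K where "\<forall>x' y'. agree K x x' \<longrightarrow> agree K y y' \<longrightarrow>
              agree k (g1 x y) (g1 x' y') \<and> agree k (g2 x y) (g2 x' y')" by blast
    with lim show "\<exists>x' y'. (x', y') \<in> D \<and> agree k (g1 x y) x' \<and> agree k (g2 x y) y'"
      by blast
  qed
  then show "(x, y) \<in> {(x, y). (g1 x y, g2 x y) \<in> D}" by simp
qed

text \<open>The second coordinate is a witness of membership. Plain projections of closed sets give
  all analytic sets; uniqueness of the witness confines the notion to Borel sets, by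
  \<open>lusin_souslin_closed\<close>.\<close>

definition injective_projection :: "sequence set \<Rightarrow> bool" where
  "injective_projection A \<longleftrightarrow> (\<exists>D. closed_rel D \<and> inj_on fst D \<and> fst ` D = A)"

lemma injective_projection_cylinder: "injective_projection {x. x i \<in> B}"
proof -
  let ?D = "{(x, y). x i \<in> B \<and> y = (\<lambda>_. 0)} :: (sequence \<times> sequence) set"
  have "closed_rel ?D"
    unfolding closed_rel_def
  proof (intro allI impI)
    fix x y :: sequence
    assume lim: "\<forall>k. \<exists>x' y'. (x', y') \<in> ?D \<and> agree k x x' \<and> agree k y y'"
    have "x i \<in> B" using lim[rule_format, of "Suc i"] by (auto simp: agree_def)
    moreover have "y k = 0" for k using lim[rule_format, of "Suc k"] by (auto simp: agree_def)
    ultimately show "(x, y) \<in> ?D" by auto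
  qed
  moreover have "inj_on fst ?D" by (auto simp: inj_on_def)
  moreover have "fst ` ?D = {x. x i \<in> B}" by force
  ultimately show ?thesis unfolding injective_projection_def by blast
qed

text \<open>Countably many witnesses are packed into one sequence, whose \<open>n\<close>-th column
  under \<open>prod_encode\<close> is the witness for \<open>A n\<close>. Since each column is
  unique, so is the packed sequence.\<close>

lemma injective_projection_INT:
  assumes "\<And>n::nat. injective_projection (A n)"
  shows "injective_projection (\<Inter>n. A n)"
proof -
  from assms obtain D where D: "\<And>n. closed_rel (D n)" "\<And>n. inj_on fst (D n)" "\<And>n. fst ` D n = A n"
    unfolding injective_projection_def by metis
  let ?col = "\<lambda>n (y::sequence) k. y (prod_encode (n, k))"
  let ?D = "{(x, y). \<forall>n. (x, ?col n y) \<in> D n}"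
  have "closed_rel {(x, y). (x, ?col n y) \<in> D n}" for n
  proof (rule closed_rel_vimage[OF D(1)])
    fix x y :: sequence and k
    obtain K where K: "\<And>j. j < k \<Longrightarrow> prod_encode (n, j) < K"
      using finite_nat_set_iff_bounded[of "(\<lambda>j. prod_encode (n, j)) ` {..<k}"] by auto
    show "\<exists>K. \<forall>x' y'. agree K x x' \<longrightarrow> agree K y y' \<longrightarrow> agree k x x' \<and> agree k (?col n y) (?col n y')"
      by (rule exI[of _ "max k K"]) (auto simp: agree_def dest!: K)
  qed
  then have "closed_rel ?D"
    unfolding closed_rel_def by fast
  moreover have "inj_on fst ?D"
  proof (rule inj_onI)
    fix p q assume p: "p \<in> ?D" and q: "q \<in> ?D" and eq: "fst p = fst q"
    have "?col n (snd p) = ?col n (snd q)" for n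
      using inj_onD[OF D(2)[of n], of "(fst p, ?col n (snd p))" "(fst q, ?col n (snd q))"] p q eq
      by (auto simp: case_prod_beta)
    then have "snd p (prod_encode (n, k)) = snd q (prod_encode (n, k))" for n k by (rule fun_cong)
    then have "snd p i = snd q i" for i by (metis prod_decode_inverse surj_pair)
    with eq show "p = q" by (auto simp: prod_eq_iff)
  qed
  moreover have "fst ` ?D = (\<Inter>n. A n)"
  proof (intro equalityI subsetI)
    fix x assume "x \<in> (\<Inter>n. A n)"
    then have "\<forall>n. \<exists>y. (x, y) \<in> D n" using D(3) by force
    then obtain f where f: "\<And>n. (x, f n) \<in> D n" by metis
    define y where "y = (\<lambda>i. case prod_decode i of (n, k) \<Rightarrow> f n k)"
    have "?col n y = f n" for n by (simp add: y_def)
    then have "(x, y) \<in> ?D" using f by simp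
    then show "x \<in> fst ` ?D" by (rule image_eqI[rotated]) simp
  next
    fix x assume "x \<in> fst ` ?D"
    then obtain y where "\<forall>n. (x, ?col n y) \<in> D n" by auto
    then have "x \<in> fst ` D n" for n by (metis fst_conv image_eqI)
    then show "x \<in> (\<Inter>n. A n)" using D(3) by auto
  qed
  ultimately show ?thesis unfolding injective_projection_def by blast
qed

text \<open>The witness starts with the index \<open>n\<close>; disjointness makes this index, and
  hence the whole witness, unique.\<close>

lemma injective_projection_disjoint_UN:
  assumes "\<And>n::nat. injective_projection (A n)" and disj: "disjoint_family A"
  shows "injective_projection (\<Union>n. A n)"
proof -
  from assms obtain D where D: "\<And>n. closed_rel (D n)" "\<And>n. inj_on fst (D n)" "\<And>n. fst ` D n = A n"
    unfolding injective_projection_def by metis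
  let ?tl = "\<lambda>(y::sequence) k. y (Suc k)"
  let ?D = "{(x, y). (x, ?tl y) \<in> D (y 0)}"
  have "closed_rel ?D"
    unfolding closed_rel_def
  proof (intro allI impI)
    fix x y
    assume lim: "\<forall>k. \<exists>x' y'. (x', y') \<in> ?D \<and> agree k x x' \<and> agree k y y'"
    have "(x, ?tl y) \<in> D (y 0)"
    proof (rule closed_relD[OF D(1)])
      fix k
      from lim obtain x' y' where xy': "(x', y') \<in> ?D" "agree (Suc k) x x'" "agree (Suc k) y y'"
        by blast
      then have "y' 0 = y 0" by (simp add: agree_def)
      with xy' have "(x', ?tl y') \<in> D (y 0)" "agree k x x'" "agree k (?tl y) (?tl y')"
        by (auto simp: agree_def)
      then show "\<exists>x' y'. (x', y') \<in> D (y 0) \<and> agree k x x' \<and> agree k (?tl y) y'" by blast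
    qed
    then show "(x, y) \<in> ?D" by simp
  qed
  moreover have "inj_on fst ?D"
  proof (rule inj_onI)
    fix p q assume p: "p \<in> ?D" and q: "q \<in> ?D" and eq: "fst p = fst q"
    obtain x y z where pq: "p = (x, y)" "q = (x, z)" using eq by (metis prod.collapse)
    have y: "(x, ?tl y) \<in> D (y 0)" and z: "(x, ?tl z) \<in> D (z 0)" using p q pq by auto
    then have "x \<in> A (y 0)" "x \<in> A (z 0)" using D(3) by force+
    then have 0: "y 0 = z 0" using disj by (auto simp: disjoint_family_on_def)
    then have "?tl y = ?tl z"
      using y z inj_onD[OF D(2)[of "z 0"], of "(x, ?tl y)" "(x, ?tl z)"] by auto
    then have "y i = z i" for i using 0 by (cases i) (auto dest: fun_cong)
    then show "p = q" using pq by auto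
  qed
  moreover have "fst ` ?D = (\<Union>n. A n)"
  proof (intro equalityI subsetI)
    fix x assume "x \<in> (\<Union>n. A n)"
    then obtain n y where "(x, y) \<in> D n" using D(3) by force
    then have "(x, case_nat n y) \<in> ?D" by simp
    then show "x \<in> fst ` ?D" by (rule image_eqI[rotated]) simp
  next
    fix x assume "x \<in> fst ` ?D"
    then obtain y where "(x, ?tl y) \<in> D (y 0)" by auto
    then have "x \<in> fst ` D (y 0)" by (metis fst_conv image_eqI)
    then show "x \<in> (\<Union>n. A n)" using D(3) by auto
  qed
  ultimately show ?thesis unfolding injective_projection_def by blast
qed

lemma injective_projection_Int:
  assumes "injective_projection A" "injective_projection B"
  shows "injective_projection (A \<inter> B)"
proof -
  have "injective_projection (\<Inter>n::nat. if n = 0 then A else B)"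
    by (rule injective_projection_INT) (use assms in auto)
  moreover have "(\<Inter>n::nat. if n = 0 then A else B) = A \<inter> B"
    by (auto split: if_splits)
  ultimately show ?thesis by simp
qed

lemma injective_projection_finite_INT:
  assumes "\<And>i. i < (n::nat) \<Longrightarrow> injective_projection (A i)"
  shows "injective_projection (\<Inter>i<n. A i)"
proof -
  have U: "injective_projection UNIV"
    using injective_projection_cylinder[of 0 UNIV] by simp
  have "injective_projection (\<Inter>i. if i < n then A i else UNIV)"
    by (rule injective_projection_INT) (use assms U in auto)
  moreover have "(\<Inter>i. if i < n then A i else UNIV) = (\<Inter>i<n. A i)"
    by (auto split: if_splits)
  ultimately show ?thesis by simp
qed

text \<open>A closed set with unique witnesses for \<open>A\<close> does not yield one for the
  complement, so the induction carries both. The complements also serve to make a union disjoint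
  before it is formed.\<close>

lemma injective_projection_baire:
  assumes "A \<in> sets baire"
  shows "injective_projection A"
proof -
  have sets: "sets baire = sigma_sets UNIV {{f. f i \<in> A} | i A. True}"
    unfolding baire_def by (subst sets_PiM_single) (simp add: PiE_def Pi_def extensional_def)
  from assms have "A \<in> sigma_sets UNIV {{f. f i \<in> A} | i A. True}" by (simp add: sets)
  then have "injective_projection A \<and> injective_projection (- A)"
  proof induction
    case (Basic a)
    then obtain i B where a: "a = {f. f i \<in> B}" by auto
    then have "- a = {f. f i \<in> - B}" by auto
    then show ?case using a injective_projection_cylinder by metis
  next
    case Empty
    show ?case
      using injective_projection_cylinder[of 0 UNIV] injective_projection_cylinder[of 0 "{}"] by simp
  next
    case (Compl a)
    then show ?case by (simp add: Compl_eq_Diff_UNIV[symmetric])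
  next
    case (Union a)
    have "injective_projection (\<Inter>n. - a n)"
      using Union by (intro injective_projection_INT) auto
    moreover have "injective_projection (\<Union>n. a n \<inter> (\<Inter>m<n. - a m))"
    proof (rule injective_projection_disjoint_UN)
      show "injective_projection (a n \<inter> (\<Inter>m<n. - a m))" for n
        using Union by (intro injective_projection_Int injective_projection_finite_INT) auto
      show "disjoint_family (\<lambda>n. a n \<inter> (\<Inter>m<n. - a m))"
      proof -
        have "m = n" if "x \<in> a m" "x \<in> a n" "\<forall>i<m. x \<notin> a i" "\<forall>i<n. x \<notin> a i" for x m n
          using that by (metis linorder_neqE_nat)
        then show ?thesis by (auto simp: disjoint_family_on_def)
      qed
    qed
    moreover have "(\<Union>n. a n \<inter> (\<Inter>m<n. - a m)) = (\<Union>n. a n)"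
    proof (intro equalityI subsetI)
      fix x assume "x \<in> (\<Union>n. a n)"
      then obtain n where "x \<in> a n" by auto
      then have "x \<in> a (LEAST n. x \<in> a n)" "\<forall>m < (LEAST n. x \<in> a n). x \<notin> a m"
        by (auto intro: LeastI dest: not_less_Least)
      then show "x \<in> (\<Union>n. a n \<inter> (\<Inter>m<n. - a m))" by blast
    qed auto
    ultimately show ?case by simp
  qed
  then show ?thesis ..
qed

section \<open>Borel separation and injective images of closed sets\<close>

lemma UNIV_sets_baire [simp]: "UNIV \<in> sets baire"
  using sets.top[of baire] by simp

lemma measurable_coordinate [measurable]: "(\<lambda>x. x i) \<in> baire \<rightarrow>\<^sub>M count_space UNIV"
  unfolding baire_def by measurable

lemma measurable_prefix: "(\<lambda>x. map x [0..<k]) \<in> baire \<rightarrow>\<^sub>M count_space UNIV"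
proof (induction k)
  case (Suc k)
  have "(\<lambda>x. map x [0..<k] @ [x k]) \<in> baire \<rightarrow>\<^sub>M count_space UNIV"
    by (rule measurable_compose_countable[OF _ Suc]) simp
  then show ?case by simp
qed simp

lemma prefix_eq_iff: "map y [0..<k] = map z [0..<k] \<longleftrightarrow> agree k y z"
  by (auto simp: agree_def)

text \<open>If two pieces are inseparable, then so are some two refinements with one more coordinate
  prescribed, as separating sets for all countably many refinements could be combined. The prefixes
  of nested inseparable pieces converge to one first coordinate with a witness in \<open>D\<close>
  and another in \<open>E\<close>, against disjointness.\<close>

lemma lusin_separation:
  assumes D: "closed_rel D" and E: "closed_rel E" and disj: "fst ` D \<inter> fst ` E = {}"
  obtains B where "B \<in> sets baire" "fst ` D \<subseteq> B" "B \<inter> fst ` E = {}"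
proof -
  define piece where "piece F k x y = {x'. \<exists>y'. (x', y') \<in> F \<and> agree k x x' \<and> agree k y y'}"
    for F k and x y :: sequence
  define sep where "sep P Q \<longleftrightarrow> (\<exists>B\<in>sets baire. P \<subseteq> B \<and> B \<inter> Q = {})" for P Q
  have step: "\<exists>a c d. \<not> sep (piece D (Suc k) (x(k := a)) (y(k := c))) (piece E (Suc k) (x(k := a)) (z(k := d)))"
    if insep: "\<not> sep (piece D k x y) (piece E k x z)" for k x y z
  proof (rule ccontr)
    assume "\<not> ?thesis"
    then obtain B where B: "\<And>a c d. B a c d \<in> sets baire"
      "\<And>a c d. piece D (Suc k) (x(k := a)) (y(k := c)) \<subseteq> B a c d"
      "\<And>a c d. B a c d \<inter> piece E (Suc k) (x(k := a)) (z(k := d)) = {}"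
      unfolding sep_def by metis
    \<comment> \<open>Points with different \<open>k\<close>-th coordinates are separated by a
      cylinder, which is why both pieces may share the prefix \<open>x\<close>. For equal
      coordinates, a union over the choices for \<open>D\<close> of intersections over the choices
      for \<open>E\<close> separates.\<close>
    let ?B = "\<Union>a. {x \<in> space baire. x k = a} \<inter> (\<Union>c. \<Inter>d. B a c d)"
    have "?B \<in> sets baire" using B(1) by measurable
    moreover have "piece D k x y \<subseteq> ?B"
    proof
      fix x' assume "x' \<in> piece D k x y"
      then obtain y' where y': "(x', y') \<in> D" "agree k x x'" "agree k y y'"
        by (auto simp: piece_def)
      then have "x' \<in> piece D (Suc k) (x(k := x' k)) (y(k := y' k))"
        by (auto simp: piece_def agree_def less_Suc_eq intro!: exI[of _ y'])
      then have "x' \<in> B (x' k) (y' k) d" for d using B(2) by blast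
      then show "x' \<in> ?B" by auto
    qed
    moreover have "?B \<inter> piece E k x z = {}"
    proof (rule ccontr)
      assume "?B \<inter> piece E k x z \<noteq> {}"
      then obtain x' c where x': "\<And>d. x' \<in> B (x' k) c d" "x' \<in> piece E k x z" by auto
      then obtain z' where z': "(x', z') \<in> E" "agree k x x'" "agree k z z'"
        by (auto simp: piece_def)
      then have "x' \<in> piece E (Suc k) (x(k := x' k)) (z(k := z' k))"
        by (auto simp: piece_def agree_def less_Suc_eq intro!: exI[of _ z'])
      then show False using x'(1) B(3) by blast
    qed
    ultimately show False using insep unfolding sep_def by blast
  qed
  have "sep (fst ` D) (fst ` E)"
  proof (rule ccontr)
    assume "\<not> sep (fst ` D) (fst ` E)"
    moreover have "piece F 0 x y = fst ` F" for F x y by (force simp: piece_def agree_def)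
    ultimately have base: "\<not> sep (piece D 0 (\<lambda>_. 0) (\<lambda>_. 0)) (piece E 0 (\<lambda>_. 0) (\<lambda>_. 0))" by simp
    let ?P = "\<lambda>k (x, y, z). \<not> sep (piece D k x y) (piece E k x z)"
    let ?Q = "\<lambda>k (x, y, z) (x', y', z'). \<exists>a c d. x' = x(k := a) \<and> y' = y(k := c) \<and> z' = z(k := d :: nat)"
    have "\<exists>f. \<forall>k. ?P k (f k) \<and> ?Q k (f k) (f (Suc k))"
      by (rule dependent_nat_choice) (use base step in fastforce)+
    then obtain f where "\<forall>k. ?P k (f k) \<and> ?Q k (f k) (f (Suc k))" ..
    then have f: "?P k (f k)" "?Q k (f k) (f (Suc k))" for k by simp_all
    define X where "X k = fst (f k)" for k
    define Y where "Y k = fst (snd (f k))" for k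
    define Z where "Z k = snd (snd (f k))" for k
    have P: "\<not> sep (piece D k (X k) (Y k)) (piece E k (X k) (Z k))" for k
      using f(1)[of k] by (auto simp: X_def Y_def Z_def split: prod.splits)
    have Q: "\<exists>a. X (Suc k) = (X k)(k := a)" "\<exists>a. Y (Suc k) = (Y k)(k := a)" "\<exists>a. Z (Suc k) = (Z k)(k := a)" for k
      using f(2)[of k] by (auto simp: X_def Y_def Z_def split: prod.splits)
    \<comment> \<open>Step \<open>k\<close> changes coordinate \<open>k\<close> only, so the
      diagonal sequence agrees below \<open>k\<close> with the \<open>k\<close>-th
      approximation.\<close>
    have lim: "agree k (\<lambda>i. W (Suc i) i) (W k)" if "\<And>k. \<exists>a. W (Suc k) = (W k)(k := a :: nat)" for W k
    proof (induction k)
      case (Suc k)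
      then show ?case using that[of k] by (auto simp: agree_def less_Suc_eq)
    qed (simp add: agree_def)
    let ?x = "\<lambda>i. X (Suc i) i" and ?y = "\<lambda>i. Y (Suc i) i" and ?z = "\<lambda>i. Z (Suc i) i"
    have nonempty: "piece D k (X k) (Y k) \<noteq> {}" "piece E k (X k) (Z k) \<noteq> {}" for k
    proof -
      have "sep {} S" "sep S {}" for S
        unfolding sep_def by (rule bexI[of _ "{}"], simp_all) (rule bexI[of _ "space baire"], simp_all)
      then show "piece D k (X k) (Y k) \<noteq> {}" "piece E k (X k) (Z k) \<noteq> {}" using P[of k] by metis+
    qed
    have lims: "agree k ?x (X k)" "agree k ?y (Y k)" "agree k ?z (Z k)" for k
      using lim[OF Q(1)] lim[OF Q(2)] lim[OF Q(3)] by simp_all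
    have "(?x, ?y) \<in> D"
    proof (rule closed_relD[OF D])
      fix k
      obtain x' y' where "(x', y') \<in> D" "agree k (X k) x'" "agree k (Y k) y'"
        using nonempty(1)[of k] by (auto simp: piece_def)
      with lims[of k] show "\<exists>x' y'. (x', y') \<in> D \<and> agree k ?x x' \<and> agree k ?y y'"
        by (auto simp: agree_def)
    qed
    moreover have "(?x, ?z) \<in> E"
    proof (rule closed_relD[OF E])
      fix k
      obtain x' z' where "(x', z') \<in> E" "agree k (X k) x'" "agree k (Z k) z'"
        using nonempty(2)[of k] by (auto simp: piece_def)
      with lims[of k] show "\<exists>x' z'. (x', z') \<in> E \<and> agree k ?x x' \<and> agree k ?z z'"
        by (auto simp: agree_def)
    qed
    ultimately show False using disj by force
  qed
  then show ?thesis using that unfolding sep_def by blast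
qed

text \<open>By injectivity, the pieces \<open>A s\<close> for different \<open>s\<close> of one
  length are disjoint, so they can be enclosed in pairwise disjoint Borel sets \<open>B' s\<close>.
  A point enclosed at every level then determines a single branch, which is its witness because
  \<open>D\<close> is closed. This replaces an uncountable union over witnesses by countable
  operations.\<close>

lemma lusin_souslin_closed:
  assumes D: "closed_rel D" and inj: "inj_on fst D"
  shows "fst ` D \<in> sets baire"
proof -
  define A where "A s = {x. \<exists>y. (x, y) \<in> D \<and> map y [0..<length s] = s}" for s :: "nat list"
  have "\<exists>B\<in>sets baire. A s \<subseteq> B \<and> B \<inter> A t = {}" if "s \<noteq> t" "length s = length t" for s t
  proof -
    let ?D = "\<lambda>s. D \<inter> {(x, y). map y [0..<length s] = s}"
    have A: "A s = fst ` ?D s" for s by (force simp: A_def)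
    have "closed_rel (?D s)" for s
      unfolding closed_rel_def
    proof (intro allI impI)
      fix x y
      assume lim: "\<forall>k. \<exists>x' y'. (x', y') \<in> ?D s \<and> agree k x x' \<and> agree k y y'"
      then have "(x, y) \<in> D" using closed_relD[OF D] by blast
      moreover from lim obtain y' where "map y' [0..<length s] = s" "agree (length s) y y'" by blast
      ultimately show "(x, y) \<in> ?D s" using prefix_eq_iff[of y "length s" y'] by simp
    qed
    moreover have "fst ` ?D s \<inter> fst ` ?D t = {}"
      using that inj by (auto simp: inj_on_def)
    ultimately show ?thesis unfolding A using lusin_separation[of "?D s" "?D t"] by metis
  qed
  then obtain Sep where Sep: "\<And>s t. s \<noteq> t \<Longrightarrow> length s = length t \<Longrightarrow>
      Sep s t \<in> sets baire \<and> A s \<subseteq> Sep s t \<and> Sep s t \<inter> A t = {}"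
    by metis
  define B where "B s = (\<Inter>t. if t \<noteq> s \<and> length t = length s then Sep s t else space baire)" for s
  define B' where "B' s = B s - (\<Union>t. if t \<noteq> s \<and> length t = length s then B t else {})" for s
  \<comment> \<open>The enclosures alone say nothing about closeness to \<open>D\<close>. Agreement
    with a point of \<open>A s\<close> on \<open>length s\<close> coordinates plays the part of the
    closure of \<open>A s\<close>, and is enough once \<open>length s\<close> tends to
    infinity.\<close>
  define near where "near s = {x. \<exists>x'\<in>A s. agree (length s) x x'}" for s
  have B: "B s \<in> sets baire" for s
    unfolding B_def by (intro sets.countable_INT) (use Sep in auto)
  have B': "B' s \<in> sets baire" for s
    unfolding B'_def by (intro sets.Diff sets.countable_UN) (use B in auto)
  have near: "near s \<in> sets baire" for s
  proof -
    define S where "S = {map x' [0..<length s] | x'. x' \<in> A s}"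
    have "near s = {x. map x [0..<length s] \<in> S}"
      unfolding near_def S_def using prefix_eq_iff by auto
    then show ?thesis
      using measurable_sets[OF measurable_prefix, of S] by (simp add: vimage_def)
  qed
  have unique: "s = t" if "x \<in> B' s" "x \<in> B' t" "length s = length t" for s t x
    using that by (auto simp: B'_def split: if_splits)
  have A_sub: "A s \<subseteq> B' s" for s
  proof
    fix x assume x: "x \<in> A s"
    have "x \<in> Sep s t" if "t \<noteq> s" "length t = length s" for t
      using Sep[of s t] that x by auto
    then have "x \<in> B s" by (auto simp: B_def)
    moreover have "x \<notin> B t" if "t \<noteq> s" "length t = length s" for t
      using Sep[of t s] that x by (auto simp: B_def split: if_splits)
    ultimately show "x \<in> B' s" by (auto simp: B'_def)
  qed
  let ?G = "\<Inter>k. \<Union>s\<in>{s. length s = k}. (\<Inter>j. B' (take j s)) \<inter> near s"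
  have "?G \<in> sets baire"
    using B' near by (intro sets.countable_INT sets.countable_UN'' sets.Int) auto
  moreover have "fst ` D = ?G"
  proof (intro equalityI subsetI)
    fix x assume "x \<in> fst ` D"
    then obtain y where xy: "(x, y) \<in> D" by auto
    have xA: "x \<in> A (map y [0..<k])" for k
      using xy by (auto simp: A_def)
    moreover have "take j (map y [0..<k]) = map y [0..<min j k]" for j k
      by (simp add: take_map take_upt min_def)
    ultimately have "x \<in> B' (take j (map y [0..<k]))" for j k
      using A_sub[of "map y [0..<min j k]"] by auto
    moreover have "x \<in> near (map y [0..<k])" for k
      using xA[of k] unfolding near_def by (auto intro: bexI[of _ x])
    ultimately have "x \<in> (\<Union>s\<in>{s. length s = k}. (\<Inter>j. B' (take j s)) \<inter> near s)" for k
      by (intro UN_I[of "map y [0..<k]"]) simp_all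
    then show "x \<in> ?G" by (rule INT_I)
  next
    fix x assume "x \<in> ?G"
    have "\<exists>s. length s = k \<and> (\<forall>j. x \<in> B' (take j s)) \<and> x \<in> near s" for k
      using INT_D[OF \<open>x \<in> ?G\<close>, of k] by auto
    then obtain s where s: "\<And>k. length (s k) = k" "\<And>k j. x \<in> B' (take j (s k))" "\<And>k. x \<in> near (s k)"
      by metis
    \<comment> \<open>Disjointness within each level forces the separately chosen prefixes to
      cohere.\<close>
    have take: "take j (s k) = s j" if "j \<le> k" for j k
      using unique[of x "take j (s k)" "s j"] s(2)[of j k] s(2)[of j j] s(1) that by simp
    define y where "y i = s (Suc i) ! i" for i
    have y: "map y [0..<k] = s k" for k
    proof (rule nth_equalityI)
      fix i assume "i < length (map y [0..<k])"
      then show "map y [0..<k] ! i = s k ! i"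
        using take[of "Suc i" k] by (auto simp: y_def) (metis lessI nth_take)
    qed (simp add: s)
    have "(x, y) \<in> D"
    proof (rule closed_relD[OF D])
      fix k
      obtain x' y' where "(x', y') \<in> D" "map y' [0..<k] = s k" "agree k x x'"
        using s(3)[of k] s(1)[of k] by (auto simp: near_def A_def)
      then show "\<exists>x' y'. (x', y') \<in> D \<and> agree k x x' \<and> agree k y y'"
        using y prefix_eq_iff by metis
    qed
    then show "x \<in> fst ` D" by force
  qed
  ultimately show ?thesis by simp
qed

text \<open>Coded by interleaving, \<open>F\<close> is an injective projection of a closed set with
  some further witness. Interleaving that witness with the second coordinate of \<open>F\<close>
  shows that the image under \<open>fst\<close> is an injective projection of a closed set as
  well.\<close>

theorem lusin_souslin_baire:
  assumes F: "F \<in> sets (baire \<Otimes>\<^sub>M baire)" and inj: "inj_on fst F"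
  shows "fst ` F \<in> sets baire"
proof -
  define il where "il x y = (\<lambda>i. if even i then x (i div 2) else y (i div 2) :: nat)"
    for x y :: sequence
  define ev where "ev x = (\<lambda>i. x (2 * i) :: nat)" for x :: sequence
  define od where "od x = (\<lambda>i. x (Suc (2 * i)) :: nat)" for x :: sequence
  have il: "ev (il x y) = x" "od (il x y) = y" "il (ev x) (od x) = x" for x y
    by (auto simp: il_def ev_def od_def fun_eq_iff) 
  have [measurable]: "ev \<in> baire \<rightarrow>\<^sub>M baire" "od \<in> baire \<rightarrow>\<^sub>M baire"
    unfolding ev_def od_def by (subst (2) baire_def, rule measurable_PiM_single', simp_all)+
  have "(\<lambda>u. (ev u, od u)) -` F \<inter> space baire \<in> sets baire"
    by (rule measurable_sets[OF _ F]) measurable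
  then have "{u. (ev u, od u) \<in> F} \<in> sets baire" by (simp add: vimage_def)
  then obtain D where D: "closed_rel D" "inj_on fst D" "fst ` D = {u. (ev u, od u) \<in> F}"
    using injective_projection_baire unfolding injective_projection_def by blast
  let ?D = "{(x, y). (il x (ev y), od y) \<in> D}"
  have "closed_rel ?D"
  proof (rule closed_rel_vimage[OF D(1)])
    fix x y :: sequence and k
    show "\<exists>K. \<forall>x' y'. agree K x x' \<longrightarrow> agree K y y' \<longrightarrow>
            agree k (il x (ev y)) (il x' (ev y')) \<and> agree k (od y) (od y')"
      by (rule exI[of _ "2 * k + 1"]) (auto simp: agree_def il_def ev_def od_def)
  qed
  moreover have "inj_on fst ?D"
  proof (rule inj_onI)
    fix p q assume p: "p \<in> ?D" and q: "q \<in> ?D" and eq: "fst p = fst q"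
    obtain x y z where pq: "p = (x, y)" "q = (x, z)" using eq by (metis prod.collapse)
    have y: "(il x (ev y), od y) \<in> D" and z: "(il x (ev z), od z) \<in> D" using p q pq by auto
    have "(x, ev y) \<in> F" "(x, ev z) \<in> F"
      using imageI[OF y, of fst] imageI[OF z, of fst] D(3) by (auto simp: il)
    then have ev: "ev y = ev z" using inj_onD[OF inj, of "(x, ev y)" "(x, ev z)"] by simp
    then have "od y = od z" using y z inj_onD[OF D(2), OF _ y z] by auto
    with ev have "y = z" using il(3) by metis
    then show "p = q" using pq by simp
  qed
  ultimately have "fst ` ?D \<in> sets baire" by (rule lusin_souslin_closed)
  also have "fst ` ?D = fst ` F"
  proof (intro equalityI subsetI)
    fix x assume "x \<in> fst ` ?D"
    then obtain y where "(il x (ev y), od y) \<in> D" by auto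
    from imageI[OF this, of fst] have "(x, ev y) \<in> F" using D(3) by (auto simp: il)
    then show "x \<in> fst ` F" by (rule image_eqI[rotated]) simp
  next
    fix x assume "x \<in> fst ` F"
    then obtain v where "(x, v) \<in> F" by auto
    then have "il x v \<in> fst ` D" using D(3) by (simp add: il)
    then obtain z where "(il x v, z) \<in> D" by auto
    then have "(x, il v z) \<in> ?D" by (simp add: il)
    then show "x \<in> fst ` ?D" by (rule image_eqI[rotated]) simp
  qed
  finally show ?thesis .
qed

section \<open>Transfer from the Baire space to standard Borel spaces\<close>

lemma measurable_baireI:
  assumes "\<And>n. (\<lambda>x. f x n) \<in> M \<rightarrow>\<^sub>M count_space UNIV"
  shows "f \<in> M \<rightarrow>\<^sub>M baire"
  unfolding baire_def by (rule measurable_PiM_single') (use assms in auto)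

lemma pred_eq_countable:
  fixes f g :: "'a \<Rightarrow> 'b :: countable"
  assumes "f \<in> M \<rightarrow>\<^sub>M count_space UNIV" "g \<in> M \<rightarrow>\<^sub>M count_space UNIV"
  shows "Measurable.pred M (\<lambda>x. f x = g x)"
proof (rule measurable_compose_countable[OF _ assms(1)])
  show "Measurable.pred M (\<lambda>x. i = g x)" for i
    by (rule measurable_compose[OF assms(2)]) simp
qed

text \<open>A point is coded by indices of points of a countable dense set that approximate it to
  within \<open>(1/2) ^ n\<close>; decoding takes the limit, which exists by completeness.\<close>

lemma standard_borel_baire_retract:
  assumes M: "standard_borel_space M" and ne: "space M \<noteq> {}"
  obtains \<phi> \<psi> where "\<phi> \<in> M \<rightarrow>\<^sub>M baire" "\<psi> \<in> baire \<rightarrow>\<^sub>M M" "\<And>x. x \<in> space M \<Longrightarrow> \<psi> (\<phi> x) = x"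
proof -
  obtain X where X: "completely_metrizable_space X" "separable_space X" "topspace X = space M"
    "sets M = sigma_sets (space M) {U. openin X U}"
    using M unfolding standard_borel_space_def by blast
  then obtain d where ms: "Metric_space (space M) d" and mc: "Metric_space.mcomplete (space M) d"
    and Xd: "X = Metric_space.mtopology (space M) d"
    unfolding completely_metrizable_space_def by (metis Metric_space.topspace_mtopology)
  interpret Metric_space "space M" d by (rule ms)
  obtain C where C: "countable C" "C \<subseteq> space M" "mtopology closure_of C = space M"
    using X(2,3) Xd unfolding separable_space_def by auto
  define q where "q = from_nat_into C"
  have C_ne: "C \<noteq> {}" using C(3) ne by auto
  have q: "q i \<in> space M" for i
    using from_nat_into[OF C_ne] C(2) unfolding q_def by blast
  have dense: "\<exists>i. d x (q i) < e" if x: "x \<in> space M" and e: "e > 0" for x e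
  proof -
    have "x \<in> mtopology closure_of C" using C(3) x by simp
    then obtain y where "y \<in> C" "y \<in> mball x e" using e unfolding metric_closure_of by auto
    then show ?thesis using from_nat_into_surj[OF C(1)] unfolding q_def by (auto simp: in_mball)
  qed
  have ball: "mball x e \<in> sets M" for x e
    unfolding X(4) Xd by (rule sigma_sets.Basic) (simp add: openin_mball)
  define h :: "nat \<Rightarrow> real" where "h n = (1/2) ^ n" for n
  have h: "h n > 0" for n by (simp add: h_def)
  have h_small: "\<exists>n. h n < e" if "e > 0" for e
    unfolding h_def using real_arch_pow_inv[OF that, of "1/2"] by simp
  define \<phi> where "\<phi> x n = (LEAST i. d x (q i) < h n)" for x n
  have \<phi>: "d x (q (\<phi> x n)) < h n" if "x \<in> space M" for x n
    unfolding \<phi>_def by (rule LeastI_ex) (rule dense[OF that h])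
  have \<phi>_meas: "\<phi> \<in> M \<rightarrow>\<^sub>M baire"
  proof (rule measurable_baireI)
    have "{x \<in> space M. d x (q i) < h n} = mball (q i) (h n)" for i n
      using q by (auto simp: in_mball commute)
    then have [measurable]: "Measurable.pred M (\<lambda>x. d x (q i) < h n)" for i n
      using ball[of "q i" "h n"] by (simp add: pred_def)
    show "(\<lambda>x. \<phi> x n) \<in> M \<rightarrow>\<^sub>M count_space UNIV" for n
      unfolding \<phi>_def by measurable
  qed
  \<comment> \<open>Countably many conditions on pairs of coordinates, hence Borel. By the triangle
    inequality they hold for every code \<open>\<phi> x\<close>, and they make the coded points a
    Cauchy sequence with a known rate.\<close>
  define K where "K = {\<sigma>. \<forall>m n. d (q (\<sigma> m)) (q (\<sigma> n)) < h m + h n}"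
  define lim where "lim \<sigma> L \<longleftrightarrow> L \<in> space M \<and> (\<forall>n. d L (q (\<sigma> n)) \<le> h n)" for \<sigma> :: sequence and L
  have lim_unique: "L = L'" if "lim \<sigma> L" "lim \<sigma> L'" for \<sigma> L L'
  proof (rule ccontr)
    assume "L \<noteq> L'"
    then have "d L L' > 0" using that by (auto simp: lim_def)
    then obtain n where n: "h n < d L L' / 2" using h_small[of "d L L' / 2"] by auto
    have "d L L' \<le> d L (q (\<sigma> n)) + d (q (\<sigma> n)) L'"
      using that q by (intro triangle) (auto simp: lim_def)
    also have "\<dots> \<le> h n + h n"
    proof (rule add_mono)
      show "d L (q (\<sigma> n)) \<le> h n" using that by (simp add: lim_def)
      show "d (q (\<sigma> n)) L' \<le> h n" using that by (simp add: lim_def commute[of _ L'])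
    qed
    finally show False using n by simp
  qed
  have lim_ex: "\<exists>L. lim \<sigma> L" if "\<sigma> \<in> K" for \<sigma>
  proof -
    have h_mono: "h m \<le> h n" if "n \<le> m" for m n
      unfolding h_def by (rule power_decreasing) (use that in auto)
    have "MCauchy (\<lambda>n. q (\<sigma> n))"
      unfolding MCauchy_def
    proof (intro conjI allI impI)
      show "range (\<lambda>n. q (\<sigma> n)) \<subseteq> space M" using q by auto
      fix e :: real assume "e > 0"
      then obtain N where N: "h N < e / 2" using h_small[of "e / 2"] by auto
      show "\<exists>N. \<forall>n n'. N \<le> n \<longrightarrow> N \<le> n' \<longrightarrow> d (q (\<sigma> n)) (q (\<sigma> n')) < e"
      proof (intro exI allI impI)
        fix n n' assume "N \<le> n" "N \<le> n'"
        then have "h n \<le> h N" "h n' \<le> h N" using h_mono by auto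
        moreover have "d (q (\<sigma> n)) (q (\<sigma> n')) < h n + h n'" using \<open>\<sigma> \<in> K\<close> by (simp add: K_def)
        ultimately show "d (q (\<sigma> n)) (q (\<sigma> n')) < e" using N by linarith
      qed
    qed
    then obtain L where L: "limitin mtopology (\<lambda>n. q (\<sigma> n)) L sequentially"
      using mc unfolding mcomplete_def by blast
    then have LM: "L \<in> space M" by (simp add: limitin_metric)
    have "d L (q (\<sigma> n)) \<le> h n" for n
    proof (rule field_le_epsilon)
      fix e :: real assume "e > 0"
      then obtain N where N: "h N < e / 2" using h_small[of "e / 2"] by auto
      have "\<forall>\<^sub>F m in sequentially. d (q (\<sigma> m)) L < e / 2"
        using L \<open>e > 0\<close> by (auto simp: limitin_metric elim!: allE[of _ "e / 2"] eventually_mono)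
      then obtain N' where N': "\<And>m. m \<ge> N' \<Longrightarrow> d (q (\<sigma> m)) L < e / 2"
        unfolding eventually_sequentially by blast
      let ?m = "max N N'"
      have "d L (q (\<sigma> n)) \<le> d L (q (\<sigma> ?m)) + d (q (\<sigma> ?m)) (q (\<sigma> n))"
        by (intro triangle) (use LM q in auto)
      moreover have "d L (q (\<sigma> ?m)) < e / 2" using N'[of ?m] by (simp add: commute)
      moreover have "d (q (\<sigma> ?m)) (q (\<sigma> n)) < h ?m + h n" using \<open>\<sigma> \<in> K\<close> by (simp add: K_def)
      moreover have "h ?m \<le> h N" by (rule h_mono) simp
      ultimately show "d L (q (\<sigma> n)) \<le> h n + e" using N by linarith
    qed
    then show ?thesis using LM unfolding lim_def by blast
  qed
  obtain x0 where x0: "x0 \<in> space M" using ne by auto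
  define \<psi> where "\<psi> \<sigma> = (if \<sigma> \<in> K then (THE L. lim \<sigma> L) else x0)" for \<sigma>
  have \<psi>: "lim \<sigma> (\<psi> \<sigma>)" if "\<sigma> \<in> K" for \<sigma>
    unfolding \<psi>_def using lim_ex[OF that] lim_unique that by (auto intro: theI2)
  have \<psi>_space: "\<psi> \<sigma> \<in> space M" for \<sigma>
    using \<psi>[of \<sigma>] x0 by (cases "\<sigma> \<in> K") (auto simp: lim_def \<psi>_def)
  have K_meas [measurable]: "Measurable.pred baire (\<lambda>\<sigma>. \<sigma> \<in> K)"
    unfolding K_def mem_Collect_eq
  proof (intro pred_intros_countable)
    fix m n
    have "(\<lambda>\<sigma>. d (q (\<sigma> m)) (q (\<sigma> n)) < h m + h n) \<in> baire \<rightarrow>\<^sub>M count_space UNIV"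
    proof (rule measurable_compose_countable[where f = "\<lambda>i \<sigma>. d (q i) (q (\<sigma> n)) < h m + h n" and g = "\<lambda>\<sigma>. \<sigma> m"])
      show "(\<lambda>\<sigma>. d (q i) (q (\<sigma> n)) < h m + h n) \<in> baire \<rightarrow>\<^sub>M count_space UNIV" for i
        by (rule measurable_compose[OF measurable_coordinate]) simp
    qed measurable
    then show "Measurable.pred baire (\<lambda>\<sigma>. d (q (\<sigma> m)) (q (\<sigma> n)) < h m + h n)" .
  qed
  have \<psi>_meas: "\<psi> \<in> baire \<rightarrow>\<^sub>M M"
  proof (rule measurable_sigma_sets[OF X(4)])
    show "{U. openin X U} \<subseteq> Pow (space M)" using openin_subset X(3) by blast
    show "\<psi> \<in> space baire \<rightarrow> space M" using \<psi>_space by auto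
    fix U assume "U \<in> {U. openin X U}"
    then have U: "openin mtopology U" using Xd by simp
    \<comment> \<open>The limit lies within \<open>h n\<close> of the \<open>n\<close>-th coded
      point, so membership in an open set is detected by balls of radius \<open>2 * h n\<close>
      around dense points, of which there are countably many.\<close>
    have "\<psi> \<sigma> \<in> U \<longleftrightarrow> (if \<sigma> \<in> K then \<exists>n. mball (q (\<sigma> n)) (2 * h n) \<subseteq> U else x0 \<in> U)" for \<sigma>
    proof (cases "\<sigma> \<in> K")
      case True
      have "\<psi> \<sigma> \<in> U" if "mball (q (\<sigma> n)) (2 * h n) \<subseteq> U" for n
      proof -
        have "d (q (\<sigma> n)) (\<psi> \<sigma>) \<le> h n" using \<psi>[OF True] by (simp add: lim_def commute)
        then have "\<psi> \<sigma> \<in> mball (q (\<sigma> n)) (2 * h n)"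
          using q \<psi>_space[of \<sigma>] h[of n] by (simp add: in_mball)
        then show ?thesis using that by auto
      qed
      moreover have "\<exists>n. mball (q (\<sigma> n)) (2 * h n) \<subseteq> U" if "\<psi> \<sigma> \<in> U"
      proof -
        obtain e where e: "e > 0" "mball (\<psi> \<sigma>) e \<subseteq> U" using U \<open>\<psi> \<sigma> \<in> U\<close> unfolding openin_mtopology by blast
        obtain n where n: "h n < e / 3" using h_small[of "e / 3"] e by auto
        have "mball (q (\<sigma> n)) (2 * h n) \<subseteq> mball (\<psi> \<sigma>) e"
        proof
          fix y assume y: "y \<in> mball (q (\<sigma> n)) (2 * h n)"
          have "d (\<psi> \<sigma>) y \<le> d (\<psi> \<sigma>) (q (\<sigma> n)) + d (q (\<sigma> n)) y"
            by (intro triangle) (use y \<psi>_space in \<open>auto simp: in_mball\<close>)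
          also have "\<dots> < h n + 2 * h n"
            using y \<psi>[OF True] by (intro add_le_less_mono) (auto simp: lim_def in_mball)
          finally show "y \<in> mball (\<psi> \<sigma>) e" using n y \<psi>_space by (auto simp: in_mball)
        qed
        then show ?thesis using e by blast
      qed
      ultimately show ?thesis using True by auto
    qed (simp add: \<psi>_def)
    moreover have "Measurable.pred baire (\<lambda>\<sigma>. if \<sigma> \<in> K then \<exists>n. mball (q (\<sigma> n)) (2 * h n) \<subseteq> U else x0 \<in> U)"
    proof -
      have [measurable]: "Measurable.pred baire (\<lambda>\<sigma>. mball (q (\<sigma> n)) (2 * h n) \<subseteq> U)" for n
        by (rule measurable_compose[OF measurable_coordinate]) simp
      show ?thesis by measurable
    qed
    ultimately have "Measurable.pred baire (\<lambda>\<sigma>. \<psi> \<sigma> \<in> U)" by simp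
    then show "\<psi> -` U \<inter> space baire \<in> sets baire" by (simp add: pred_def vimage_def)
  qed
  have "\<psi> (\<phi> x) = x" if x: "x \<in> space M" for x
  proof -
    have "\<phi> x \<in> K"
      unfolding K_def
    proof (intro CollectI allI)
      fix m n
      have "d (q (\<phi> x m)) (q (\<phi> x n)) \<le> d (q (\<phi> x m)) x + d x (q (\<phi> x n))"
        by (intro triangle) (use q x in auto)
      also have "\<dots> < h m + h n" using \<phi>[OF x, of m] \<phi>[OF x, of n] by (simp add: commute)
      finally show "d (q (\<phi> x m)) (q (\<phi> x n)) < h m + h n" .
    qed
    moreover have "lim (\<phi> x) x" using \<phi>[OF x] x by (auto simp: lim_def less_imp_le)
    ultimately show ?thesis using \<psi> lim_unique by blast
  qed
  then show ?thesis using that \<phi>_meas \<psi>_meas by blast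
qed

theorem lusin_souslin:
  assumes M: "standard_borel_space M" and F: "F \<in> sets (M \<Otimes>\<^sub>M M)" and inj: "inj_on fst F"
  shows "fst ` F \<in> sets M"
proof (cases "space M = {}")
  case True
  then have "F = {}" using sets.sets_into_space[OF F] by (auto simp: space_pair_measure)
  then show ?thesis by simp
next
  case False
  then obtain \<phi> \<psi> where [measurable]: "\<phi> \<in> M \<rightarrow>\<^sub>M baire" "\<psi> \<in> baire \<rightarrow>\<^sub>M M"
    and \<psi>: "\<And>x. x \<in> space M \<Longrightarrow> \<psi> (\<phi> x) = x"
    using standard_borel_baire_retract[OF M] by metis
  have F_space: "x \<in> space M" "y \<in> space M" if "(x, y) \<in> F" for x y
    using sets.sets_into_space[OF F] that by (auto simp: space_pair_measure)
  \<comment> \<open>Since \<open>\<psi>\<close> need not be injective, a plain pullback of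
    \<open>F\<close> would lose injectivity of \<open>fst\<close>. The fixed points of
    \<open>\<phi> \<circ> \<psi>\<close> are the codes of points of the space, one for each
    point.\<close>
  let ?F = "{p \<in> space (baire \<Otimes>\<^sub>M baire). (\<psi> (fst p), \<psi> (snd p)) \<in> F \<and>
      \<phi> (\<psi> (fst p)) = fst p \<and> \<phi> (\<psi> (snd p)) = snd p}"
  have eq: "Measurable.pred (baire \<Otimes>\<^sub>M baire) (\<lambda>p. \<phi> (\<psi> (f p)) = f p)"
    if [measurable]: "f \<in> (baire \<Otimes>\<^sub>M baire) \<rightarrow>\<^sub>M baire" for f
  proof -
    have "Measurable.pred (baire \<Otimes>\<^sub>M baire) (\<lambda>p. \<forall>n. \<phi> (\<psi> (f p)) n = f p n)"
    proof (intro pred_intros_countable)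
      fix n
      have f: "(\<lambda>p. f p n) \<in> (baire \<Otimes>\<^sub>M baire) \<rightarrow>\<^sub>M count_space UNIV"
        by (rule measurable_compose[OF that measurable_coordinate])
      have "(\<lambda>p. \<phi> (\<psi> (f p)) n) \<in> (baire \<Otimes>\<^sub>M baire) \<rightarrow>\<^sub>M count_space UNIV"
        by (rule measurable_compose[OF _ measurable_coordinate]) measurable
      then show "Measurable.pred (baire \<Otimes>\<^sub>M baire) (\<lambda>p. \<phi> (\<psi> (f p)) n = f p n)"
        using f by (rule pred_eq_countable)
    qed
    then show ?thesis by (simp add: fun_eq_iff)
  qed
  have "(\<lambda>p. (\<psi> (fst p), \<psi> (snd p))) \<in> baire \<Otimes>\<^sub>M baire \<rightarrow>\<^sub>M M \<Otimes>\<^sub>M M" by measurable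
  from measurable_sets[OF this F]
  have "Measurable.pred (baire \<Otimes>\<^sub>M baire) (\<lambda>p. (\<psi> (fst p), \<psi> (snd p)) \<in> F)"
    by (simp add: pred_def vimage_def Int_def conj_commute)
  from pred_intros_logic(3)[OF this pred_intros_logic(3)[OF eq[OF measurable_fst] eq[OF measurable_snd]]]
  have F_meas: "?F \<in> sets (baire \<Otimes>\<^sub>M baire)" by (simp add: pred_def)
  have "inj_on fst ?F"
  proof (rule inj_onI)
    fix p p' assume p: "p \<in> ?F" "p' \<in> ?F" and eq: "fst p = fst p'"
    then have "(\<psi> (fst p), \<psi> (snd p)) = (\<psi> (fst p'), \<psi> (snd p'))" by (intro inj_onD[OF inj]) auto
    then have "snd p = snd p'" using p by (metis (mono_tags, lifting) mem_Collect_eq prod.inject)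
    with eq show "p = p'" by (simp add: prod_eq_iff)
  qed
  with F_meas have "fst ` ?F \<in> sets baire" by (rule lusin_souslin_baire)
  then have "\<phi> -` (fst ` ?F) \<inter> space M \<in> sets M" by (rule measurable_sets[rotated]) measurable
  also have "\<phi> -` (fst ` ?F) \<inter> space M = fst ` F"
  proof (intro equalityI subsetI)
    fix x assume "x \<in> \<phi> -` (fst ` ?F) \<inter> space M"
    then obtain v where "(\<psi> (\<phi> x), \<psi> v) \<in> F" "x \<in> space M" by auto
    then have "(x, \<psi> v) \<in> F" using \<psi> by simp
    then show "x \<in> fst ` F" by (rule image_eqI[rotated]) simp
  next
    fix x assume "x \<in> fst ` F"
    then obtain y where xy: "(x, y) \<in> F" by auto
    then have "(\<phi> x, \<phi> y) \<in> ?F" using \<psi> F_space[OF xy] by (simp add: space_pair_measure)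
    then have "\<phi> x \<in> fst ` ?F" by (rule image_eqI[rotated]) simp
    then show "x \<in> \<phi> -` (fst ` ?F) \<inter> space M" using F_space[OF xy] by simp
  qed
  finally show ?thesis .
qed

subsection \<open>Borel colourings of balls\<close>

lemma nbhd_0 [simp]: "nbhd E x 0 = {x}"
  by (auto simp: nbhd_def)

lemma nbhd_self [simp]: "x \<in> nbhd E x n"
  by (auto simp: nbhd_def intro!: exI[of _ 0])

lemma nbhd_mono: "m \<le> n \<Longrightarrow> nbhd E x m \<subseteq> nbhd E x n"
  unfolding nbhd_def by (auto intro: order_trans)

lemma nbhd_1: "nbhd E x 1 = insert x {y. (x, y) \<in> E \<or> (y, x) \<in> E}"
  by (auto simp: nbhd_def le_Suc_eq)

lemma nbhd_trans: "y \<in> nbhd E x m \<Longrightarrow> z \<in> nbhd E y n \<Longrightarrow> z \<in> nbhd E x (m + n)"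
  unfolding nbhd_def by (auto intro!: relpow_trans add_mono)

lemma nbhd_sym: "y \<in> nbhd E x n \<Longrightarrow> x \<in> nbhd E y n"
proof -
  have "(z, x) \<in> (E \<union> E\<inverse>) ^^ m" if "(x, z) \<in> (E \<union> E\<inverse>) ^^ m" for m z
    using that
  proof (induction m arbitrary: z)
    case (Suc m)
    then obtain y where "(y, x) \<in> (E \<union> E\<inverse>) ^^ m" "(z, y) \<in> E \<union> E\<inverse>" by auto
    then show ?case by (meson relpow_Suc_I2)
  qed simp
  then show "y \<in> nbhd E x n \<Longrightarrow> x \<in> nbhd E y n" by (auto simp: nbhd_def)
qed

lemma nbhd_Suc: "nbhd E x (Suc n) = (\<Union>y\<in>nbhd E x n. nbhd E y 1)"
proof (intro equalityI subsetI)
  fix z assume "z \<in> nbhd E x (Suc n)"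
  then obtain m where m: "m \<le> Suc n" "(x, z) \<in> (E \<union> E\<inverse>) ^^ m" by (auto simp: nbhd_def)
  show "z \<in> (\<Union>y\<in>nbhd E x n. nbhd E y 1)"
  proof (cases m)
    case 0
    then have "z = x" using m by simp
    then show ?thesis using nbhd_self[of x E n] nbhd_self[of x E 1] by blast
  next
    case (Suc k)
    then obtain y where y: "(x, y) \<in> (E \<union> E\<inverse>) ^^ k" "(y, z) \<in> E \<union> E\<inverse>" using m by auto
    then have "y \<in> nbhd E x n" using m Suc by (auto simp: nbhd_def)
    then show ?thesis using y unfolding nbhd_1 by auto
  qed
next
  fix z assume "z \<in> (\<Union>y\<in>nbhd E x n. nbhd E y 1)"
  then show "z \<in> nbhd E x (Suc n)" using nbhd_trans[of _ E x n z 1] by auto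
qed

lemma nbhd_subset:
  assumes "E \<subseteq> V \<times> V" "x \<in> V"
  shows "nbhd E x n \<subseteq> V"
proof (induction n)
  case (Suc n)
  then show ?case using assms unfolding nbhd_Suc nbhd_1 by auto
qed (use assms in simp)

lemma part_of_eq:
  assumes "fin_partition V \<pi>" "Q \<in> \<pi>" "x \<in> Q"
  shows "part_of \<pi> x = Q"
proof -
  have uniq: "S = Q" if "S \<in> \<pi> \<and> x \<in> S" for S
    using assms that disjointD[of \<pi> S Q] unfolding fin_partition_def by blast
  show ?thesis unfolding part_of_def by (rule the_equality) (use assms uniq in blast)+
qed

lemma part_of_in:
  assumes "fin_partition V \<pi>" "x \<in> V"
  shows "part_of \<pi> x \<in> \<pi>" "x \<in> part_of \<pi> x"
proof -
  obtain Q where "Q \<in> \<pi>" "x \<in> Q" using assms by (auto simp: fin_partition_def)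
  then show "part_of \<pi> x \<in> \<pi>" "x \<in> part_of \<pi> x" using part_of_eq[OF assms(1)] by auto
qed

text \<open>The neighbours of a vertex lie in different parts, so the edges into one part form the graph
  of a partial function, whose domain is Borel by the Lusin--Souslin theorem.\<close>

lemma borel_neighbour_maps:
  assumes M: "standard_borel_space M" and E: "E \<in> sets (M \<Otimes>\<^sub>M M)"
    and part: "fin_partition (space M) \<pi>" and sets: "\<pi> \<subseteq> sets M" and sparse: "sparse (space M) E 2 \<pi>"
  obtains F where "finite F" "F \<subseteq> M \<rightarrow>\<^sub>M M" "\<And>x. x \<in> space M \<Longrightarrow> (\<lambda>g. g x) ` F = nbhd E x 1"
proof -
  have E_sub: "E \<subseteq> space M \<times> space M"
    using sets.sets_into_space[OF E] by (simp add: space_pair_measure)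
  define S where "S Q = (E \<union> E\<inverse>) \<inter> (space M \<times> Q)" for Q
  have "E\<inverse> = (\<lambda>p. (snd p, fst p)) -` E \<inter> space (M \<Otimes>\<^sub>M M)"
    using E_sub by (auto simp: space_pair_measure)
  also have "\<dots> \<in> sets (M \<Otimes>\<^sub>M M)" by (rule measurable_sets[OF _ E]) measurable
  finally have S: "S Q \<in> sets (M \<Otimes>\<^sub>M M)" if "Q \<in> sets M" for Q
    unfolding S_def using E that by (intro sets.Int sets.Un pair_measureI) auto
  have S_1: "y \<in> nbhd E x 1" if "(x, y) \<in> S Q" for x y Q
    using that unfolding S_def nbhd_1 by auto
  have inj: "inj_on fst (S Q)" if "Q \<in> \<pi>" for Q
  proof (rule inj_onI)
    fix p p' assume p: "p \<in> S Q" "p' \<in> S Q" and eq: "fst p = fst p'"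
    have "snd q \<in> nbhd E (fst q) 2" if "q \<in> S Q" for q
      using S_1[of "fst q" "snd q" Q] nbhd_mono[of 1 2 E "fst q"] that by auto
    then have "snd p \<in> nbhd E (fst p) 2" "snd p' \<in> nbhd E (fst p) 2"
      using p eq by metis+
    moreover have "part_of \<pi> (snd p) = part_of \<pi> (snd p')"
      using p part_of_eq[OF part \<open>Q \<in> \<pi>\<close>] by (auto simp: S_def)
    moreover have "fst p \<in> space M" using p by (auto simp: S_def)
    ultimately have "snd p = snd p'" using sparse by (auto simp: sparse_def dest: inj_onD)
    with eq show "p = p'" by (simp add: prod_eq_iff)
  qed
  \<comment> \<open>The default value \<open>x\<close> keeps \<open>g Q x\<close> inside the ball of
    radius 1 when \<open>x\<close> has no neighbour in \<open>Q\<close>.\<close>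
  define g where "g Q x = (if x \<in> fst ` S Q then (THE y. (x, y) \<in> S Q) else x)" for Q x
  have g: "g Q x = y" if "(x, y) \<in> S Q" "Q \<in> \<pi>" for Q x y
  proof -
    have "(THE y. (x, y) \<in> S Q) = y"
      using that inj_onD[OF inj[OF that(2)]] by (intro the_equality) auto
    moreover have "x \<in> fst ` S Q" using that(1) by (rule image_eqI[rotated]) simp
    ultimately show ?thesis by (simp add: g_def)
  qed
  have g_1: "g Q x \<in> nbhd E x 1" if "Q \<in> \<pi>" for Q x
    using g[OF _ that, of x] S_1[of x _ Q] by (cases "x \<in> fst ` S Q") (auto simp: g_def)
  have g_meas: "g Q \<in> M \<rightarrow>\<^sub>M M" if Q: "Q \<in> \<pi>" for Q
  proof (rule measurableI)
    fix x assume "x \<in> space M"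
    then show "g Q x \<in> space M" using g_1[OF Q, of x] nbhd_subset[OF E_sub] by auto
  next
    fix B assume B: "B \<in> sets M"
    have B_sub: "B \<subseteq> space M" by (rule sets.sets_into_space[OF B])
    have "g Q -` B \<inter> space M = fst ` (S Q \<inter> (space M \<times> B)) \<union> (B - fst ` S Q)"
    proof (rule set_eqI)
      fix x
      show "x \<in> g Q -` B \<inter> space M \<longleftrightarrow> x \<in> fst ` (S Q \<inter> (space M \<times> B)) \<union> (B - fst ` S Q)"
      proof (cases "x \<in> fst ` S Q")
        case True
        then obtain y where y: "(x, y) \<in> S Q" by auto
        have "x \<in> space M" using y by (auto simp: S_def)
        moreover have "x \<in> fst ` (S Q \<inter> (space M \<times> B)) \<longleftrightarrow> y \<in> B"
          using g[OF y Q] g[OF _ Q, of x] y \<open>x \<in> space M\<close> by (auto simp: image_iff Bex_def)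
        ultimately show ?thesis using True g[OF y Q] by auto
      next
        case False
        then have "g Q x = x" by (simp add: g_def)
        then show ?thesis using False B_sub by auto
      qed
    qed
    moreover have "fst ` S Q \<in> sets M"
      by (rule lusin_souslin[OF M S inj]) (use sets Q in auto)
    moreover have "fst ` (S Q \<inter> (space M \<times> B)) \<in> sets M"
      by (rule lusin_souslin[OF M]) (use S[of Q] B sets Q inj[OF Q] in \<open>auto intro: inj_on_subset\<close>)
    ultimately show "g Q -` B \<inter> space M \<in> sets M" using B by auto
  qed
  have "(\<lambda>h. h x) ` insert (\<lambda>x. x) (g ` \<pi>) = nbhd E x 1" if x: "x \<in> space M" for x
  proof (intro equalityI subsetI)
    fix y assume y: "y \<in> nbhd E x 1"
    have "y \<in> space M" using y nbhd_subset[OF E_sub x] by auto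
    then have "part_of \<pi> y \<in> \<pi>" "y \<in> part_of \<pi> y" using part_of_in[OF part] by auto
    then have "y = x \<or> y = g (part_of \<pi> y) x"
      using y x g[of x y "part_of \<pi> y"] unfolding nbhd_1 by (auto simp: S_def)
    then show "y \<in> (\<lambda>h. h x) ` insert (\<lambda>x. x) (g ` \<pi>)" using \<open>part_of \<pi> y \<in> \<pi>\<close> by auto
  qed (use g_1 in auto)
  moreover have "finite (insert (\<lambda>x. x) (g ` \<pi>))" using part by (simp add: fin_partition_def)
  moreover have "insert (\<lambda>x. x) (g ` \<pi>) \<subseteq> M \<rightarrow>\<^sub>M M" using g_meas by auto
  ultimately show ?thesis using that by blast
qed

lemma borel_ball_maps:
  assumes F: "finite F" "F \<subseteq> M \<rightarrow>\<^sub>M M" "\<And>x. x \<in> space M \<Longrightarrow> (\<lambda>g. g x) ` F = nbhd E x 1"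
  obtains G where "finite G" "G \<subseteq> M \<rightarrow>\<^sub>M M" "\<And>x. x \<in> space M \<Longrightarrow> (\<lambda>g. g x) ` G = nbhd E x k"
proof -
  have "\<exists>G. finite G \<and> G \<subseteq> M \<rightarrow>\<^sub>M M \<and> (\<forall>x\<in>space M. (\<lambda>g. g x) ` G = nbhd E x k)"
  proof (induction k)
    case 0
    show ?case by (rule exI[of _ "{\<lambda>x. x}"]) auto
  next
    case (Suc k)
    then obtain G where G: "finite G" "G \<subseteq> M \<rightarrow>\<^sub>M M" "\<forall>x\<in>space M. (\<lambda>g. g x) ` G = nbhd E x k"
      by blast
    let ?G = "(\<lambda>(f, g) x. f (g x)) ` (F \<times> G)"
    have "finite ?G" using F G by auto
    moreover have "?G \<subseteq> M \<rightarrow>\<^sub>M M" using F G by (auto intro: measurable_compose)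
    moreover have "(\<lambda>g. g x) ` ?G = nbhd E x (Suc k)" if x: "x \<in> space M" for x
    proof -
      have "(\<lambda>g. g x) ` ?G = (\<Union>y\<in>(\<lambda>g. g x) ` G. (\<lambda>f. f y) ` F)" by force
      also have "\<dots> = (\<Union>g\<in>G. nbhd E (g x) 1)"
      proof -
        have "(\<lambda>f. f (g x)) ` F = nbhd E (g x) 1" if "g \<in> G" for g
          using F(3) measurable_space[of g M M x] that G(2) x by auto
        then show ?thesis by simp
      qed
      also have "\<dots> = (\<Union>y\<in>(\<lambda>g. g x) ` G. nbhd E y 1)" by simp
      also have "\<dots> = nbhd E x (Suc k)" by (simp only: nbhd_Suc bspec[OF G(3) x])
      finally show ?thesis .
    qed
    ultimately show ?case by (intro exI[of _ ?G] conjI ballI)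
  qed
  then show ?thesis by (elim exE conjE) (rule that, assumption, assumption, rule bspec)
qed

text \<open>A vertex is coloured by its shortest prefix in the Baire space that tells it apart from its
  neighbours.\<close>

lemma countable_borel_colouring:
  assumes M: "standard_borel_space M" "space M \<noteq> {}" and G: "finite G" "G \<subseteq> M \<rightarrow>\<^sub>M M"
  obtains c :: "'a \<Rightarrow> nat" where "c \<in> M \<rightarrow>\<^sub>M count_space UNIV"
    "\<And>x y g. \<lbrakk>x \<in> space M; y \<in> space M; g \<in> G; y = g x; x \<noteq> y\<rbrakk> \<Longrightarrow> c x \<noteq> c y"
proof -
  obtain \<phi> \<psi> where \<phi>: "\<phi> \<in> M \<rightarrow>\<^sub>M baire" and \<psi>: "\<And>x. x \<in> space M \<Longrightarrow> \<psi> (\<phi> x) = x"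
    using standard_borel_baire_retract[OF M] by metis
  \<comment> \<open>The first alternative covers the case \<open>g x = x\<close>; on the space,
    every other \<open>g x\<close> has a different code.\<close>
  define split where "split k x \<longleftrightarrow> (\<forall>g\<in>G. (\<forall>i. \<phi> x i = \<phi> (g x) i) \<or> (\<exists>i<k. \<phi> x i \<noteq> \<phi> (g x) i))"
    for k x
  have coord: "(\<lambda>x. \<phi> x i) \<in> M \<rightarrow>\<^sub>M count_space UNIV" for i
    by (rule measurable_compose[OF \<phi> measurable_coordinate])
  have split_meas [measurable]: "Measurable.pred M (split k)" for k
    unfolding split_def
  proof (intro pred_intros_finite(3) G)
    fix g assume "g \<in> G"
    then have "g \<in> M \<rightarrow>\<^sub>M M" using G by auto
    then have [measurable]: "Measurable.pred M (\<lambda>x. \<phi> x i = \<phi> (g x) i)" for i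
      by (intro pred_eq_countable coord measurable_compose[OF _ coord])
    show "Measurable.pred M (\<lambda>x. (\<forall>i. \<phi> x i = \<phi> (g x) i) \<or> (\<exists>i<k. \<phi> x i \<noteq> \<phi> (g x) i))"
      by measurable
  qed
  define L where "L x = (LEAST k. split k x)" for x
  have L_meas: "L \<in> M \<rightarrow>\<^sub>M count_space UNIV" unfolding L_def by measurable
  have split_L: "split (L x) x" for x
  proof -
    have "\<exists>k. \<forall>g\<in>G. (\<forall>i. \<phi> x i = \<phi> (g x) i) \<or> (\<exists>i<k. \<phi> x i \<noteq> \<phi> (g x) i)"
    proof -
      have "\<forall>g\<in>G. \<exists>i. (\<forall>i. \<phi> x i = \<phi> (g x) i) \<or> \<phi> x i \<noteq> \<phi> (g x) i" by blast
      then obtain i where "\<And>g. g \<in> G \<Longrightarrow> (\<forall>i. \<phi> x i = \<phi> (g x) i) \<or> \<phi> x (i g) \<noteq> \<phi> (g x) (i g)" by metis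
      moreover obtain k where "\<And>g. g \<in> G \<Longrightarrow> i g < k"
        using finite_nat_set_iff_bounded[of "i ` G"] G(1) by auto
      ultimately show ?thesis by blast
    qed
    then show ?thesis unfolding L_def split_def by (rule LeastI_ex)
  qed
  define c where "c x = to_nat (map (\<phi> x) [0..<L x])" for x
  have "(\<lambda>x. map (\<phi> x) [0..<L x]) \<in> M \<rightarrow>\<^sub>M count_space UNIV"
    by (rule measurable_compose_countable[OF _ L_meas]) (rule measurable_compose[OF \<phi> measurable_prefix])
  then have "c \<in> M \<rightarrow>\<^sub>M count_space UNIV"
    unfolding c_def by (rule measurable_compose) simp
  moreover have "c x \<noteq> c (g x)" if "x \<in> space M" "g x \<in> space M" "g \<in> G" "x \<noteq> g x" for x g
  proof
    assume "c x = c (g x)"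
    then have eq: "map (\<phi> x) [0..<L x] = map (\<phi> (g x)) [0..<L (g x)]" by (simp add: c_def)
    \<comment> \<open>Equal colours give equal prefixes of equal length, so the codes agree up to
      the very length at which \<open>x\<close> is told apart.\<close>
    from arg_cong[OF this, of length] have "L x = L (g x)" by simp
    with eq have "agree (L x) (\<phi> x) (\<phi> (g x))" using prefix_eq_iff by metis
    moreover have "\<phi> x \<noteq> \<phi> (g x)" using that \<psi> by metis
    ultimately show False using split_L[of x] \<open>g \<in> G\<close> by (auto simp: split_def agree_def)
  qed
  ultimately show ?thesis using that by blast
qed

text \<open>Greedy recolouring along a countable Borel colouring \<open>c0\<close>: stage
  \<open>n\<close> treats the vertices with \<open>c0 x = n\<close>, which are pairwise unrelated,
  and gives each the least colour not taken by an image under \<open>G\<close> treated earlier. At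
  most \<open>card G\<close> colours are forbidden. Symmetry lets the later of two related vertices
  see the earlier one.\<close>

lemma finite_borel_colouring:
  assumes M: "standard_borel_space M" "space M \<noteq> {}" and G: "finite G" "G \<subseteq> M \<rightarrow>\<^sub>M M"
    and sym: "\<forall>x\<in>space M. \<forall>g\<in>G. \<exists>h\<in>G. h (g x) = x"
  obtains c :: "'a \<Rightarrow> nat" where "c \<in> M \<rightarrow>\<^sub>M count_space UNIV" "\<And>x. x \<in> space M \<Longrightarrow> c x \<le> card G"
    "\<And>x g. x \<in> space M \<Longrightarrow> g \<in> G \<Longrightarrow> g x \<noteq> x \<Longrightarrow> c (g x) \<noteq> c x"
proof -
  obtain c0 :: "'a \<Rightarrow> nat" where c0_meas: "c0 \<in> M \<rightarrow>\<^sub>M count_space UNIV"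
    and c0: "\<And>x y g. \<lbrakk>x \<in> space M; y \<in> space M; g \<in> G; y = g x; x \<noteq> y\<rbrakk> \<Longrightarrow> c0 x \<noteq> c0 y"
    using countable_borel_colouring[OF M G] by metis
  have G_space: "g x \<in> space M" if "g \<in> G" "x \<in> space M" for g x
    using measurable_space[of g M M x] that G by auto
  define free where "free s n x k \<longleftrightarrow> (\<forall>g\<in>G. c0 (g x) < n \<longrightarrow> s (g x) \<noteq> k)"
    for s :: "'a \<Rightarrow> nat" and n x k
  define st where "st = rec_nat (\<lambda>_. 0 :: nat) (\<lambda>n s x. if c0 x = n then LEAST k. free s n x k else s x)"
  have st_Suc: "st (Suc n) x = (if c0 x = n then LEAST k. free (st n) n x k else st n x)" for n x
    by (simp add: st_def)
  have st_meas: "st n \<in> M \<rightarrow>\<^sub>M count_space UNIV" for n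
  proof (induction n)
    case 0
    have "st 0 = (\<lambda>_. 0)" by (simp add: st_def)
    then show ?case by simp
  next
    case (Suc n)
    have [measurable]: "Measurable.pred M (\<lambda>x. free (st n) n x k)" for k
      unfolding free_def
    proof (intro pred_intros_finite(3) G)
      fix g assume "g \<in> G"
      then have g: "g \<in> M \<rightarrow>\<^sub>M M" using G by auto
      have "Measurable.pred M (\<lambda>x. c0 (g x) < n)"
        by (rule measurable_compose[OF measurable_compose[OF g c0_meas]]) simp
      moreover have "Measurable.pred M (\<lambda>x. st n (g x) \<noteq> k)"
        by (rule measurable_compose[OF measurable_compose[OF g Suc]]) simp
      ultimately show "Measurable.pred M (\<lambda>x. c0 (g x) < n \<longrightarrow> st n (g x) \<noteq> k)"
        by (rule pred_intros_logic(4))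
    qed
    have [measurable]: "Measurable.pred M (\<lambda>x. c0 x = n)"
      by (rule measurable_compose[OF c0_meas]) simp
    note Suc [measurable]
    have "(\<lambda>x. if c0 x = n then LEAST k. free (st n) n x k else st n x) \<in> M \<rightarrow>\<^sub>M count_space UNIV"
      by measurable
    then show ?case by (simp add: st_Suc[abs_def])
  qed
  have free_ex: "\<exists>k\<le>card G. free s n x k" for s n x
  proof (rule ccontr)
    assume "\<not> ?thesis"
    then have "{..card G} \<subseteq> (\<lambda>g. s (g x)) ` G" by (auto simp: free_def)
    then have "card {..card G} \<le> card ((\<lambda>g. s (g x)) ` G)" using G by (intro card_mono) auto
    also have "\<dots> \<le> card G" by (rule card_image_le[OF G(1)])
    finally show False by simp
  qed
  define c where "c x = st (Suc (c0 x)) x" for x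
  have st_c: "st (Suc (c0 x + m)) x = c x" for m x
    by (induction m) (auto simp: c_def st_Suc)
  then have st_c: "st m x = c x" if "c0 x < m" for m x
    using that less_imp_Suc_add by metis
  have free_c: "free (st (c0 x)) (c0 x) x (c x)" for x
  proof -
    have "\<exists>k. free (st (c0 x)) (c0 x) x k" using free_ex by blast
    from LeastI_ex[OF this] show ?thesis by (simp add: c_def st_Suc)
  qed
  have lt: "c (g x) \<noteq> c x" if "x \<in> space M" "g \<in> G" "c0 (g x) < c0 x" for x g
    using free_c[of x] that st_c[of "g x" "c0 x"] by (auto simp: free_def)
  have "c \<in> M \<rightarrow>\<^sub>M count_space UNIV"
    unfolding c_def
    by (rule measurable_compose_countable[OF _ measurable_compose[OF c0_meas]]) (use st_meas in auto)
  moreover have "c x \<le> card G" for x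
  proof -
    obtain k where k: "k \<le> card G" "free (st (c0 x)) (c0 x) x k" using free_ex by blast
    then have "c x \<le> k" by (auto simp: c_def st_Suc intro: Least_le)
    then show ?thesis using k by simp
  qed
  moreover have "c (g x) \<noteq> c x" if x: "x \<in> space M" "g \<in> G" "g x \<noteq> x" for x g
  proof -
    have "c0 x \<noteq> c0 (g x)" using c0[of x "g x" g] G_space x by auto
    then consider "c0 (g x) < c0 x" | "c0 x < c0 (g x)" by linarith
    then show ?thesis
    proof cases
      case 2
      obtain h where "h \<in> G" "h (g x) = x" using sym x by blast
      then show ?thesis using lt[of "g x" h] 2 G_space x by force
    qed (use lt x in auto)
  qed
  ultimately show ?thesis using that by blast
qed

text \<open>Two points of a ball of radius \<open>k\<close> have distance at most
  \<open>2 * k\<close>, so the maps fed to the greedy colouring enumerate balls of radius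
  \<open>2 * k\<close>.\<close>

lemma borel_sparse_colouring:
  assumes M: "standard_borel_space M" "space M \<noteq> {}" and E: "E \<subseteq> space M \<times> space M"
    and F: "finite F" "F \<subseteq> M \<rightarrow>\<^sub>M M" "\<And>x. x \<in> space M \<Longrightarrow> (\<lambda>g. g x) ` F = nbhd E x 1"
  obtains c :: "'a \<Rightarrow> nat" and n where "c \<in> M \<rightarrow>\<^sub>M count_space UNIV" "\<And>x. x \<in> space M \<Longrightarrow> c x < n"
    "\<And>x. x \<in> space M \<Longrightarrow> inj_on c (nbhd E x k)"
proof -
  obtain G where G: "finite G" "G \<subseteq> M \<rightarrow>\<^sub>M M" "\<And>x. x \<in> space M \<Longrightarrow> (\<lambda>g. g x) ` G = nbhd E x (2 * k)"
    using borel_ball_maps[OF F] by metis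
  have sym: "\<exists>h\<in>G. h (g x) = x" if "x \<in> space M" "g \<in> G" for x g
  proof -
    have gx: "g x \<in> nbhd E x (2 * k)" using G(3) that by auto
    then have "x \<in> (\<lambda>h. h (g x)) ` G"
      using G(3)[of "g x"] nbhd_sym[OF gx] nbhd_subset[OF E that(1)] by auto
    then obtain h where "h \<in> G" "x = h (g x)" by blast
    then show ?thesis by (intro bexI[of _ h]) simp_all
  qed
  obtain c :: "'a \<Rightarrow> nat" where c: "c \<in> M \<rightarrow>\<^sub>M count_space UNIV" "\<And>x. x \<in> space M \<Longrightarrow> c x \<le> card G"
    "\<And>x g. x \<in> space M \<Longrightarrow> g \<in> G \<Longrightarrow> g x \<noteq> x \<Longrightarrow> c (g x) \<noteq> c x"
    using finite_borel_colouring[OF M G(1,2)] sym by metis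
  have "inj_on c (nbhd E x k)" if x: "x \<in> space M" for x
  proof (rule inj_onI, rule ccontr)
    fix y z assume yz: "y \<in> nbhd E x k" "z \<in> nbhd E x k" "c y = c z" "y \<noteq> z"
    have "z \<in> nbhd E y (k + k)" by (rule nbhd_trans[OF nbhd_sym[OF yz(1)] yz(2)])
    moreover have y: "y \<in> space M" using yz nbhd_subset[OF E x] by auto
    ultimately obtain g where "g \<in> G" "z = g y" using G(3)[OF y] by (auto simp: mult_2)
    then show False using c(3)[OF y, of g] yz by simp
  qed
  then show ?thesis using that[of c "Suc (card G)"] c by (simp add: less_Suc_eq_le)
qed

subsection \<open>Counting histories\<close>

text \<open>A history of resamplings is recorded up to commutation of resamplings without common
  variables: an entry is put into the lowest layer above all earlier entries sharing a variable
  with it. The record then consists of disjointly acting layers, each contained in the neighbourhood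
  of the previous one. Layers may be empty, so all records have the same length.\<close>

definition adj :: "'v set \<Rightarrow> ('v \<Rightarrow> 'w set) \<Rightarrow> 'v set \<Rightarrow> 'v set" where
  "adj J W X = {j \<in> J. \<exists>i\<in>X. W j \<inter> W i \<noteq> {}}"

fun layerings :: "'v set \<Rightarrow> ('v \<Rightarrow> 'w set) \<Rightarrow> nat \<Rightarrow> 'v set \<Rightarrow> 'v set list set" where
  "layerings J W 0 X = {[]}"
| "layerings J W (Suc h) X = (\<Union>Y\<in>Pow X. (#) Y ` layerings J W h (adj J W Y))"

lemma adj_subset: "adj J W X \<subseteq> J"
  by (auto simp: adj_def)

lemma layerings_iff:
  "Ys \<in> layerings J W h X \<longleftrightarrow> length Ys = h \<and> (0 < h \<longrightarrow> Ys ! 0 \<subseteq> X) \<and>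
     (\<forall>l. Suc l < h \<longrightarrow> Ys ! Suc l \<subseteq> adj J W (Ys ! l))"
proof (induction h arbitrary: X Ys)
  case (Suc h)
  show ?case
  proof (cases Ys)
    case (Cons Y Zs)
    have "Ys \<in> layerings J W (Suc h) X \<longleftrightarrow> Y \<subseteq> X \<and> Zs \<in> layerings J W h (adj J W Y)"
      using Cons by auto
    also have "\<dots> \<longleftrightarrow> Y \<subseteq> X \<and> length Zs = h \<and> (0 < h \<longrightarrow> Zs ! 0 \<subseteq> adj J W Y) \<and>
        (\<forall>l. Suc l < h \<longrightarrow> Zs ! Suc l \<subseteq> adj J W (Zs ! l))"
      using Suc by simp
    also have "\<dots> \<longleftrightarrow> Y \<subseteq> X \<and> length Zs = h \<and> (\<forall>l<h. Zs ! l \<subseteq> adj J W (Ys ! l))"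
      unfolding Cons
    proof (intro conj_cong refl iffI allI impI)
      fix l assume *: "(0 < h \<longrightarrow> Zs ! 0 \<subseteq> adj J W Y) \<and> (\<forall>l. Suc l < h \<longrightarrow> Zs ! Suc l \<subseteq> adj J W (Zs ! l))"
        and "l < h"
      then show "Zs ! l \<subseteq> adj J W ((Y # Zs) ! l)" by (cases l) auto
    next
      assume *: "\<forall>l<h. Zs ! l \<subseteq> adj J W ((Y # Zs) ! l)"
      then show "(0 < h \<longrightarrow> Zs ! 0 \<subseteq> adj J W Y) \<and> (\<forall>l. Suc l < h \<longrightarrow> Zs ! Suc l \<subseteq> adj J W (Zs ! l))"
        by (metis nth_Cons_0 nth_Cons_Suc)
    qed
    finally show ?thesis using Cons by (simp del: layerings.simps) blast
  qed auto
qed simp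

lemma layerings_nth_subset:
  assumes "Ys \<in> layerings J W h J" "l < h"
  shows "Ys ! l \<subseteq> J"
proof (cases l)
  case (Suc k)
  then have "Ys ! l \<subseteq> adj J W (Ys ! k)" using assms unfolding layerings_iff by simp
  then show ?thesis using adj_subset[of J W "Ys ! k"] by (rule order_trans)
qed (use assms in \<open>simp add: layerings_iff\<close>)

lemma finite_layerings:
  assumes "finite J" "X \<subseteq> J"
  shows "finite (layerings J W h X)"
  using assms(2)
proof (induction h arbitrary: X)
  case (Suc h)
  have "finite (layerings J W h (adj J W Y))" for Y by (rule Suc.IH[OF adj_subset])
  moreover have "finite X" by (rule finite_subset[OF Suc.prems assms(1)])
  ultimately show ?case by simp
qed simp

section \<open>Weighted counts of records and of the seeds admitting them\<close>

lemma sum_Pow_power_card: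
  fixes a :: real
  assumes "finite X"
  shows "(\<Sum>Y\<in>Pow X. a ^ card Y) = (1 + a) ^ card X"
  using assms
proof induction
  case (insert x F)
  have "(\<Sum>Y\<in>Pow (insert x F). a ^ card Y) = (\<Sum>Y\<in>Pow F. a ^ card Y) + (\<Sum>Y\<in>insert x ` Pow F. a ^ card Y)"
    unfolding Pow_insert by (rule sum.union_disjoint) (use insert in auto)
  also have "(\<Sum>Y\<in>insert x ` Pow F. a ^ card Y) = (\<Sum>Y\<in>Pow F. a ^ card (insert x Y))"
    by (rule sum.reindex_cong[of "insert x"]) (use insert in \<open>auto simp: inj_on_def\<close>)
  also have "\<dots> = (\<Sum>Y\<in>Pow F. a * a ^ card Y)"
    by (rule sum.cong) (use insert in \<open>auto simp: card_insert_if finite_subset\<close>)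
  finally show ?case using insert by (simp add: sum_distrib_left[symmetric] algebra_simps)
qed simp

text \<open>The bound reproduces itself under the recursion. A first layer \<open>Y\<close> leaves
  at most \<open>\<Delta> * card Y\<close> candidates for the next one; as
  \<open>(1 + 1 / \<Delta>) ^ \<Delta> \<le> exp 1\<close>, the factor \<open>exp 1\<close> in the
  weight is used up, and summing \<open>(1 / \<Delta>) ^ card Y\<close> over
  \<open>Y \<subseteq> X\<close> gives the bound again. In particular it does not depend on
  \<open>h\<close>.\<close>

lemma sum_layerings_le:
  assumes J: "finite J" and deg: "\<And>i. i \<in> J \<Longrightarrow> card (adj J W {i}) \<le> \<Delta>" and \<Delta>: "\<Delta> > 0" and X: "X \<subseteq> J"
  shows "(\<Sum>Ys\<in>layerings J W h X. (1 / (exp 1 * real \<Delta>)) ^ (\<Sum>Y\<leftarrow>Ys. card Y)) \<le> (1 + 1 / real \<Delta>) ^ card X"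
  using X
proof (induction h arbitrary: X)
  case (Suc h)
  let ?w = "1 / (exp 1 * real \<Delta>)" and ?a = "1 / real \<Delta>"
  have finX: "finite X" using Suc.prems J finite_subset by blast
  have "(\<Sum>Ys\<in>layerings J W (Suc h) X. ?w ^ (\<Sum>Y\<leftarrow>Ys. card Y)) =
      (\<Sum>Y\<in>Pow X. \<Sum>Ys\<in>(#) Y ` layerings J W h (adj J W Y). ?w ^ (\<Sum>Y\<leftarrow>Ys. card Y))"
    unfolding layerings.simps
  proof (rule sum.UNION_disjoint)
    show "\<forall>Y\<in>Pow X. finite ((#) Y ` layerings J W h (adj J W Y))"
      by (intro ballI finite_imageI finite_layerings[OF J adj_subset])
  qed (use finX in auto)
  also have "\<dots> = (\<Sum>Y\<in>Pow X. ?w ^ card Y * (\<Sum>Ys\<in>layerings J W h (adj J W Y). ?w ^ (\<Sum>Y\<leftarrow>Ys. card Y)))"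
    by (simp add: sum.reindex power_add sum_distrib_left)
  also have "\<dots> \<le> (\<Sum>Y\<in>Pow X. ?a ^ card Y)"
  proof (rule sum_mono)
    fix Y assume Y: "Y \<in> Pow X"
    have finY: "finite Y" using Y finX finite_subset by auto
    have "card (adj J W Y) \<le> card (\<Union>i\<in>Y. adj J W {i})"
      using J finY by (intro card_mono finite_UN_I) (auto simp: adj_def)
    also have "\<dots> \<le> (\<Sum>i\<in>Y. card (adj J W {i}))" by (rule card_UN_le[OF finY])
    also have "\<dots> \<le> \<Delta> * card Y"
      using sum_mono[of Y "\<lambda>i. card (adj J W {i})" "\<lambda>_. \<Delta>"] deg Y Suc.prems by (auto simp: mult.commute)
    finally have card: "card (adj J W Y) \<le> \<Delta> * card Y" .
    have "(\<Sum>Ys\<in>layerings J W h (adj J W Y). ?w ^ (\<Sum>Y\<leftarrow>Ys. card Y)) \<le> (1 + ?a) ^ card (adj J W Y)"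
      by (rule Suc.IH[OF adj_subset])
    also have "\<dots> \<le> (1 + ?a) ^ (\<Delta> * card Y)" by (rule power_increasing[OF card]) simp
    also have "\<dots> \<le> exp ?a ^ (\<Delta> * card Y)" by (rule power_mono) (use \<Delta> in \<open>auto intro: exp_ge_add_one_self\<close>)
    also have "\<dots> = exp 1 ^ card Y"
      using \<Delta> by (simp add: power_mult exp_of_nat_mult[symmetric])
    finally have "?w ^ card Y * (\<Sum>Ys\<in>layerings J W h (adj J W Y). ?w ^ (\<Sum>Y\<leftarrow>Ys. card Y)) \<le> ?w ^ card Y * exp 1 ^ card Y"
      by (intro mult_left_mono) auto
    also have "\<dots> = ?a ^ card Y" by (simp add: power_mult_distrib[symmetric])
    finally show "?w ^ card Y * (\<Sum>Ys\<in>layerings J W h (adj J W Y). ?w ^ (\<Sum>Y\<leftarrow>Ys. card Y)) \<le> ?a ^ card Y" .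
  qed
  also have "\<dots> = (1 + ?a) ^ card X" by (rule sum_Pow_power_card[OF finX])
  finally show ?case .
qed simp

text \<open>The seed assigns to every variable \<open>y\<close> a stream \<open>\<sigma> (y, 0), \<sigma> (y, 1), \<dots>\<close>, and an entry in layer \<open>l\<close>
  reads the stream of \<open>y\<close> at position \<open>touch W Ys l y\<close>. Hence different entries read different
  positions, which gives the product bound in \<open>card_consistent_le\<close>.\<close>

definition touch :: "('v \<Rightarrow> 'w set) \<Rightarrow> 'v set list \<Rightarrow> nat \<Rightarrow> 'w \<Rightarrow> nat" where
  "touch W Ys l y = card {k. k < l \<and> (\<exists>u\<in>Ys ! k. y \<in> W u)}"

text \<open>\<open>Q u\<close> will be the set of violating assignments, so the seed has to justify
  each recorded resampling. Only entries in the inner set \<open>I\<close> are tested, because for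
  the others the record need not know the positions that were really read.\<close>

definition consistent ::
    "'v set \<Rightarrow> ('v \<Rightarrow> 'w set) \<Rightarrow> ('v \<Rightarrow> ('w \<Rightarrow> nat) set) \<Rightarrow> ('w \<times> nat \<Rightarrow> nat) \<Rightarrow> 'v set list \<Rightarrow> bool" where
  "consistent I W Q \<sigma> Ys \<longleftrightarrow>
     (\<forall>l<length Ys. \<forall>u\<in>Ys ! l \<inter> I. restrict (\<lambda>y. \<sigma> (y, touch W Ys l y)) (W u) \<in> Q u)"

definition independent_layers :: "('v \<Rightarrow> 'w set) \<Rightarrow> 'v set list \<Rightarrow> bool" where
  "independent_layers W Ys \<longleftrightarrow>
     (\<forall>l<length Ys. \<forall>u\<in>Ys ! l. \<forall>v\<in>Ys ! l. u \<noteq> v \<longrightarrow> W u \<inter> W v = {})"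

text \<open>Independence in counting form: the constraints live on disjoint blocks, and each holds
  with probability at most \<open>q\<close>. Splitting off one block shrinks the domain, hence
  \<open>D\<close> varies in the induction.\<close>

lemma card_PiE_block_constraints:
  fixes B :: "'p \<Rightarrow> 'd set" and P :: "'p set"
  assumes "finite P" "finite D" "\<And>p. p \<in> P \<Longrightarrow> B p \<subseteq> D"
    and "\<And>p p'. p \<in> P \<Longrightarrow> p' \<in> P \<Longrightarrow> p \<noteq> p' \<Longrightarrow> B p \<inter> B p' = {}"
    and "\<And>p. p \<in> P \<Longrightarrow> real (card {\<tau> \<in> B p \<rightarrow>\<^sub>E {..<b}. C p \<tau>}) \<le> q * real b ^ card (B p)"
    and "\<And>p \<sigma>. p \<in> P \<Longrightarrow> C p \<sigma> = C p (restrict \<sigma> (B p))" and q: "q \<ge> 0"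
  shows "real (card {\<sigma> \<in> D \<rightarrow>\<^sub>E {..<b}. \<forall>p\<in>P. C p \<sigma>}) \<le> q ^ card P * real b ^ card D"
  using assms(1-6)
proof (induction P arbitrary: D)
  case empty
  show ?case using empty.prems(1) by (simp add: card_PiE)
next
  case (insert p P)
  let ?S = "{\<sigma> \<in> D \<rightarrow>\<^sub>E {..<b}. \<forall>p\<in>insert p P. C p \<sigma>}"
  let ?T = "{\<tau> \<in> B p \<rightarrow>\<^sub>E {..<b}. C p \<tau>}"
  let ?U = "{\<sigma> \<in> (D - B p) \<rightarrow>\<^sub>E {..<b}. \<forall>p\<in>P. C p \<sigma>}"
  have Bp: "B p \<subseteq> D" "finite (B p)" using insert.prems(1,2) finite_subset[of "B p" D] by auto
  have BP: "B p' \<subseteq> D - B p" if "p' \<in> P" for p'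
    using insert.prems(2)[of p'] insert.prems(3)[of p' p] insert.hyps that by auto
  have "inj_on (\<lambda>\<sigma>. (restrict \<sigma> (B p), restrict \<sigma> (D - B p))) ?S"
  proof (rule inj_onI)
    fix \<sigma> \<tau> assume *: "\<sigma> \<in> ?S" "\<tau> \<in> ?S"
      "(restrict \<sigma> (B p), restrict \<sigma> (D - B p)) = (restrict \<tau> (B p), restrict \<tau> (D - B p))"
    show "\<sigma> = \<tau>"
    proof (rule PiE_ext)
      show "\<sigma> \<in> D \<rightarrow>\<^sub>E {..<b}" "\<tau> \<in> D \<rightarrow>\<^sub>E {..<b}" using * by auto
      fix x assume "x \<in> D"
      then show "\<sigma> x = \<tau> x"
        using * by (cases "x \<in> B p") (auto dest!: fun_cong[where x = x])
    qed
  qed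
  moreover have "(\<lambda>\<sigma>. (restrict \<sigma> (B p), restrict \<sigma> (D - B p))) ` ?S \<subseteq> ?T \<times> ?U"
  proof (intro image_subsetI)
    fix \<sigma> assume \<sigma>: "\<sigma> \<in> ?S"
    have "C p' (restrict \<sigma> (D - B p))" if "p' \<in> P" for p'
    proof -
      have p': "p' \<in> insert p P" using that by simp
      have "C p' \<sigma> = C p' (restrict \<sigma> (B p'))" by (rule insert.prems(5)[OF p'])
      also have "restrict \<sigma> (B p') = restrict (restrict \<sigma> (D - B p)) (B p')"
        using BP[OF that] by (simp add: Int_absorb1)
      also have "C p' \<dots> = C p' (restrict \<sigma> (D - B p))" by (rule insert.prems(5)[OF p', symmetric])
      finally show ?thesis using \<sigma> that by simp
    qed
    moreover have "C p (restrict \<sigma> (B p))" using insert.prems(5)[of p \<sigma>] \<sigma> by blast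
    ultimately show "(restrict \<sigma> (B p), restrict \<sigma> (D - B p)) \<in> ?T \<times> ?U" using \<sigma> Bp by auto
  qed
  moreover have "finite (?T \<times> ?U)"
  proof (rule finite_SigmaI)
    show "finite ?T"
      by (rule finite_subset[OF _ finite_PiE[of "B p" "\<lambda>_. {..<b}"]]) (use Bp in auto)
    show "finite ?U"
      by (rule finite_subset[OF _ finite_PiE[of "D - B p" "\<lambda>_. {..<b}"]]) (use insert.prems(1) in auto)
  qed
  ultimately have "card ?S \<le> card (?T \<times> ?U)" by (rule card_inj_on_le)
  then have "real (card ?S) \<le> real (card ?T) * real (card ?U)"
    by (simp add: card_cartesian_product flip: of_nat_mult)
  also have "\<dots> \<le> (q * real b ^ card (B p)) * (q ^ card P * real b ^ card (D - B p))"
  proof (intro mult_mono)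
    show "real (card ?T) \<le> q * real b ^ card (B p)" using insert.prems(4) by simp
    show "real (card ?U) \<le> q ^ card P * real b ^ card (D - B p)"
    proof (rule insert.IH)
      show "finite (D - B p)" using insert.prems(1) by simp
      show "B p' \<inter> B p'' = {}" if "p' \<in> P" "p'' \<in> P" "p' \<noteq> p''" for p' p''
        by (rule insert.prems(3)) (use that in auto)
      show "real (card {\<tau> \<in> B p' \<rightarrow>\<^sub>E {..<b}. C p' \<tau>}) \<le> q * real b ^ card (B p')" if "p' \<in> P" for p'
        by (rule insert.prems(4)) (use that in auto)
      show "C p' \<sigma> = C p' (restrict \<sigma> (B p'))" if "p' \<in> P" for p' \<sigma>
        by (rule insert.prems(5)) (use that in auto)
    qed (rule BP)
  qed (use q in auto)
  also have "\<dots> = q ^ card (insert p P) * real b ^ (card (B p) + card (D - B p))"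
    using insert.hyps by (simp add: power_add)
  also have "card (B p) + card (D - B p) = card D"
    using Bp insert.prems(1) by (simp add: card_Diff_subset card_mono)
  finally show ?case .
qed

lemma touch_less:
  assumes "k < l" "u \<in> Ys ! k" "y \<in> W u"
  shows "touch W Ys k y < touch W Ys l y"
  unfolding touch_def by (rule psubset_card_mono) (use assms in auto)

lemma touch_le: "touch W Ys l y \<le> l"
proof -
  have "touch W Ys l y \<le> card {..<l}"
    unfolding touch_def by (rule card_mono) auto
  then show ?thesis by simp
qed

lemma card_consistent_le:
  fixes W :: "'v \<Rightarrow> 'w set"
  assumes C: "finite C" and W: "\<And>i. W i \<subseteq> C" and I: "finite I" and q: "q \<ge> 0"
    and Q: "\<And>i. i \<in> I \<Longrightarrow> Q i \<subseteq> W i \<rightarrow>\<^sub>E {..<b} \<and> real (card (Q i)) \<le> q * real b ^ card (W i)"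
    and indep: "independent_layers W Ys"
  shows "real (card {\<sigma> \<in> (C \<times> {..<length Ys}) \<rightarrow>\<^sub>E {..<b}. consistent I W Q \<sigma> Ys})
           \<le> q ^ (\<Sum>Y\<leftarrow>Ys. card (Y \<inter> I)) * real b ^ (card C * length Ys)"
proof -
  let ?D = "C \<times> {..<length Ys}"
  define P where "P = (SIGMA l:{..<length Ys}. Ys ! l \<inter> I)"
  define B where "B = (\<lambda>(l, u). (\<lambda>y. (y, touch W Ys l y)) ` W u)"
  define K where "K = (\<lambda>(l, u) \<sigma>. restrict (\<lambda>y. \<sigma> (y, touch W Ys l y)) (W u) \<in> Q u)"
  have B_mem: "(y, touch W Ys l y) \<in> B (l, u)" if "y \<in> W u" for y l u using that by (auto simp: B_def)
  have inj: "inj_on (\<lambda>y. (y, touch W Ys l y)) A" for l A by (auto simp: inj_on_def)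
  have fin_W: "finite (W u)" for u using W C finite_subset by blast
  have "real (card {\<sigma> \<in> ?D \<rightarrow>\<^sub>E {..<b}. \<forall>p\<in>P. K p \<sigma>}) \<le> q ^ card P * real b ^ card ?D"
  proof (rule card_PiE_block_constraints[where B = B])
    show "finite P" using I by (auto simp: P_def)
    show "finite ?D" using C by simp
    show "B p \<subseteq> ?D" if "p \<in> P" for p
      using that W le_less_trans[OF touch_le[of W Ys]] by (auto simp: P_def B_def)
    show "K p \<sigma> = K p (restrict \<sigma> (B p))" for p \<sigma>
    proof (cases p)
      case (Pair l u)
      have "restrict (\<lambda>y. \<sigma> (y, touch W Ys l y)) (W u) =
          restrict (\<lambda>y. restrict \<sigma> (B (l, u)) (y, touch W Ys l y)) (W u)"
        by (rule restrict_ext) (simp add: B_mem)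
      then show ?thesis by (simp add: K_def Pair)
    qed
    show "B p \<inter> B p' = {}" if p: "p \<in> P" "p' \<in> P" "p \<noteq> p'" for p p'
    proof (rule ccontr)
      assume "B p \<inter> B p' \<noteq> {}"
      then obtain l u l' u' y where *: "p = (l, u)" "p' = (l', u')" "y \<in> W u" "y \<in> W u'"
        "touch W Ys l y = touch W Ys l' y"
        by (cases p, cases p') (auto simp: B_def)
      \<comment> \<open>A layer using \<open>y\<close> advances the stream of \<open>y\<close>, so a
        position of \<open>y\<close> is shared only within one layer, where variable sets are
        disjoint.\<close>
      have "l = l'"
        using touch_less[of l l' u Ys y W] touch_less[of l' l u' Ys y W] * p
        by (cases l l' rule: linorder_cases) (auto simp: P_def)
      then show False using indep * p by (auto simp: independent_layers_def P_def)
    qed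
    show "real (card {\<tau> \<in> B p \<rightarrow>\<^sub>E {..<b}. K p \<tau>}) \<le> q * real b ^ card (B p)" if p_in: "p \<in> P" for p
    proof -
      obtain l u where p: "p = (l, u)" "u \<in> I" using p_in by (auto simp: P_def)
      let ?g = "\<lambda>\<tau>. restrict (\<lambda>y. \<tau> (y, touch W Ys l y)) (W u)"
      have "inj_on ?g {\<tau> \<in> B p \<rightarrow>\<^sub>E {..<b}. K p \<tau>}"
      proof (rule inj_onI)
        fix \<sigma> \<tau> assume *: "\<sigma> \<in> {\<tau> \<in> B p \<rightarrow>\<^sub>E {..<b}. K p \<tau>}" "\<tau> \<in> {\<tau> \<in> B p \<rightarrow>\<^sub>E {..<b}. K p \<tau>}" "?g \<sigma> = ?g \<tau>"
        show "\<sigma> = \<tau>"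
        proof (rule PiE_ext)
          show "\<sigma> \<in> B p \<rightarrow>\<^sub>E {..<b}" "\<tau> \<in> B p \<rightarrow>\<^sub>E {..<b}" using * by auto
          fix z assume "z \<in> B p"
          then obtain y where "z = (y, touch W Ys l y)" "y \<in> W u" using p by (auto simp: B_def)
          then show "\<sigma> z = \<tau> z" using fun_cong[OF *(3), of y] by simp
        qed
      qed
      moreover have "?g ` {\<tau> \<in> B p \<rightarrow>\<^sub>E {..<b}. K p \<tau>} \<subseteq> Q u" using p by (auto simp: K_def)
      moreover have "finite (Q u)"
        using Q[OF p(2)] fin_W by (meson finite_PiE finite_lessThan finite_subset)
      ultimately have "card {\<tau> \<in> B p \<rightarrow>\<^sub>E {..<b}. K p \<tau>} \<le> card (Q u)" by (rule card_inj_on_le)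
      moreover have "card (B p) = card (W u)" unfolding p B_def by (simp add: card_image inj)
      ultimately show ?thesis using Q[OF p(2)] by (metis (no_types, lifting) of_nat_mono order_trans)
    qed
  qed (rule q)
  moreover have "(\<forall>p\<in>P. K p \<sigma>) \<longleftrightarrow> consistent I W Q \<sigma> Ys" for \<sigma>
    by (auto simp: P_def K_def consistent_def)
  moreover have "card P = (\<Sum>Y\<leftarrow>Ys. card (Y \<inter> I))"
    using I by (simp add: P_def sum_list_sum_nth atLeast0LessThan)
  ultimately show ?thesis by (simp add: card_cartesian_product)
qed

text \<open>The two inequalities are what the first vertex to reach \<open>m\<close> provides, see
  \<open>activity_bounded\<close>. They constrain the record alone, so the seeds can be counted
  record by record.\<close>

definition bad_seeds ::
    "'v set \<Rightarrow> 'v set \<Rightarrow> ('v \<Rightarrow> 'v set) \<Rightarrow> ('v \<Rightarrow> ('v \<Rightarrow> nat) set) \<Rightarrow> nat \<Rightarrow> nat \<Rightarrow> real \<Rightarrow> ('v \<times> nat \<Rightarrow> nat) set" where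
  "bad_seeds I J W Q h m \<epsilon> = {\<sigma>. \<exists>Ys\<in>layerings J W h J. independent_layers W Ys \<and> consistent I W Q \<sigma> Ys \<and>
     m \<le> (\<Sum>Y\<leftarrow>Ys. card (Y \<inter> I)) \<and> real (\<Sum>Y\<leftarrow>Ys. card Y) \<le> (1 + \<epsilon>) * real (\<Sum>Y\<leftarrow>Ys. card (Y \<inter> I))}"

lemma card_bad_seeds_le:
  assumes C: "finite C" and W: "\<And>i. W i \<subseteq> C" and J: "I \<subseteq> J" "J \<subseteq> C" and q: "q \<ge> 0"
    and Q: "\<And>i. i \<in> I \<Longrightarrow> Q i \<subseteq> W i \<rightarrow>\<^sub>E {..<b} \<and> real (card (Q i)) \<le> q * real b ^ card (W i)"
    and deg: "\<And>i. i \<in> J \<Longrightarrow> card (adj J W {i}) \<le> \<Delta>" and \<Delta>: "\<Delta> > 0" and \<epsilon>: "\<epsilon> > 0"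
    and \<rho>: "\<rho> = q * (exp 1 * real \<Delta>) powr (1 + \<epsilon>)" "\<rho> < 1"
  shows "real (card (((C \<times> {..<h}) \<rightarrow>\<^sub>E {..<b}) \<inter> bad_seeds I J W Q h m \<epsilon>))
           \<le> \<rho> ^ m * 2 ^ card C * real b ^ (card C * h)"
proof -
  let ?w = "1 / (exp 1 * real \<Delta>)"
  let ?A = "\<lambda>Ys. \<Sum>Y\<leftarrow>Ys. card (Y \<inter> I)" and ?N = "\<lambda>Ys. \<Sum>Y\<leftarrow>Ys. card Y"
  let ?L = "{Ys \<in> layerings J W h J. independent_layers W Ys \<and> m \<le> ?A Ys \<and> real (?N Ys) \<le> (1 + \<epsilon>) * real (?A Ys)}"
  let ?S = "\<lambda>Ys. {\<sigma> \<in> (C \<times> {..<h}) \<rightarrow>\<^sub>E {..<b}. consistent I W Q \<sigma> Ys}"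
  have fin_J: "finite J" "finite I"
    using finite_subset[OF J(2) C] finite_subset[OF order_trans[OF J] C] by simp_all
  have fin_L: "finite ?L"
    by (rule finite_subset[OF _ finite_layerings[OF fin_J(1) order_refl]]) auto
  have e\<Delta>: "exp 1 * real \<Delta> \<ge> 1"
    using \<Delta> mult_mono[of 1 "exp 1" 1 "real \<Delta>"] by simp
  have \<rho>0: "\<rho> \<ge> 0" using q \<rho> by simp
  have "((C \<times> {..<h}) \<rightarrow>\<^sub>E {..<b}) \<inter> bad_seeds I J W Q h m \<epsilon> = (\<Union>Ys\<in>?L. ?S Ys)"
    by (auto simp: bad_seeds_def)
  then have "real (card (((C \<times> {..<h}) \<rightarrow>\<^sub>E {..<b}) \<inter> bad_seeds I J W Q h m \<epsilon>)) \<le> (\<Sum>Ys\<in>?L. real (card (?S Ys)))"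
    using card_UN_le[OF fin_L, of ?S] by (simp flip: of_nat_sum)
  also have "\<dots> \<le> (\<Sum>Ys\<in>?L. \<rho> ^ m * ?w ^ ?N Ys * real b ^ (card C * h))"
  proof (rule sum_mono)
    fix Ys assume Ys: "Ys \<in> ?L"
    have "length Ys = h" using Ys by (simp add: layerings_iff)
    then have "real (card (?S Ys)) \<le> q ^ ?A Ys * real b ^ (card C * h)"
      using card_consistent_le[OF C W fin_J(2) q Q, where Ys = Ys] Ys by simp
    \<comment> \<open>All entries number at most \<open>1 + \<epsilon>\<close> times the inner ones,
      so the gain \<open>q\<close> of an inner entry pays for the factor
      \<open>exp 1 * \<Delta>\<close> of all of them. This leaves \<rho> for each inner entry, and
      there are at least \<open>m\<close>.\<close>
    also have "q ^ ?A Ys \<le> \<rho> ^ m * ?w ^ ?N Ys"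
    proof -
      have "q ^ ?A Ys * (exp 1 * real \<Delta>) ^ ?N Ys \<le> q ^ ?A Ys * (exp 1 * real \<Delta>) powr ((1 + \<epsilon>) * real (?A Ys))"
        using Ys q e\<Delta> by (intro mult_left_mono) (auto simp: powr_realpow[symmetric] intro!: powr_mono)
      also have "\<dots> = \<rho> ^ ?A Ys"
        using e\<Delta> \<Delta> by (simp add: \<rho>(1) power_mult_distrib powr_powr[symmetric] powr_realpow)
      also have "\<dots> \<le> \<rho> ^ m" by (rule power_decreasing) (use Ys \<rho>0 \<rho>(2) in auto)
      finally show ?thesis using \<Delta> by (simp add: power_divide divide_simps)
    qed
    finally show "real (card (?S Ys)) \<le> \<rho> ^ m * ?w ^ ?N Ys * real b ^ (card C * h)"
      by (simp add: mult_right_mono)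
  qed
  also have "\<dots> \<le> (\<Sum>Ys\<in>layerings J W h J. \<rho> ^ m * ?w ^ ?N Ys * real b ^ (card C * h))"
    using \<rho>0 finite_layerings[OF fin_J(1) order_refl] by (intro sum_mono2) auto
  also have "\<dots> = \<rho> ^ m * (\<Sum>Ys\<in>layerings J W h J. ?w ^ ?N Ys) * real b ^ (card C * h)"
    by (simp add: sum_distrib_left sum_distrib_right)
  also have "\<dots> \<le> \<rho> ^ m * 2 ^ card C * real b ^ (card C * h)"
  proof (intro mult_right_mono mult_left_mono)
    have "(\<Sum>Ys\<in>layerings J W h J. ?w ^ ?N Ys) \<le> (1 + 1 / real \<Delta>) ^ card J"
      by (rule sum_layerings_le[OF fin_J(1) deg \<Delta> order_refl])
    also have "\<dots> \<le> 2 ^ card J" by (rule power_mono) (use \<Delta> in auto)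
    also have "\<dots> \<le> 2 ^ card C" by (rule power_increasing) (use card_mono[OF C J(2)] in auto)
    finally show "(\<Sum>Ys\<in>layerings J W h J. ?w ^ ?N Ys) \<le> 2 ^ card C" .
  qed (use \<rho>0 in auto)
  finally show ?thesis .
qed


text \<open>The new entry goes into layer \<open>j\<close>, directly above the last layer adjacent
  to \<open>v\<close>, or into layer 0. From \<open>j\<close> on nothing used the variables of
  \<open>v\<close>, so older entries keep their reading positions, and the new one reads where the
  streams stand at the end of the history.\<close>

lemma layer_insertion:
  assumes J: "finite J" and Ys: "Ys \<in> layerings J W h J" "independent_layers W Ys" "consistent I W Q \<sigma> Ys"
    and v: "v \<in> J" "W v \<noteq> {}" and total: "(\<Sum>l<h. card (Ys ! l)) < h"
    and Q: "v \<in> I \<Longrightarrow> restrict (\<lambda>y. \<sigma> (y, touch W Ys h y)) (W v) \<in> Q v"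
  obtains Zs where "Zs \<in> layerings J W h J" "independent_layers W Zs" "consistent I W Q \<sigma> Zs"
    "\<And>u. card {l. l < h \<and> u \<in> Zs ! l} = card {l. l < h \<and> u \<in> Ys ! l} + (if u = v then 1 else 0)"
    "\<And>y. touch W Zs h y = touch W Ys h y + (if y \<in> W v then 1 else 0)"
proof -
  have len: "length Ys = h" and step: "\<And>l. Suc l < h \<Longrightarrow> Ys ! Suc l \<subseteq> adj J W (Ys ! l)"
    and zero: "0 < h \<Longrightarrow> Ys ! 0 \<subseteq> J"
    using Ys(1) by (auto simp: layerings_iff)
  have Ys_J: "Ys ! l \<subseteq> J" if "l < h" for l
    by (rule layerings_nth_subset[OF Ys(1) that])
  define free where "free j \<longleftrightarrow> (\<forall>l. j \<le> l \<and> l < h \<longrightarrow> v \<notin> adj J W (Ys ! l))" for j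
  define j where "j = (LEAST j. free j)"
  have "free h" by (auto simp: free_def)
  then have free_j: "free j" unfolding j_def by (rule LeastI)
  have disj: "W v \<inter> W u = {}" if "j \<le> l" "l < h" "u \<in> Ys ! l" for l u
    using free_j that v by (auto simp: free_def adj_def)
  have below: "j - 1 < h \<and> v \<in> adj J W (Ys ! (j - 1))" if "0 < j"
  proof -
    have "\<not> free (j - 1)" using that not_less_Least[of "j - 1" free] unfolding j_def by simp
    then obtain l where l: "j - 1 \<le> l" "l < h" "v \<in> adj J W (Ys ! l)" by (auto simp: free_def)
    moreover have "\<not> j \<le> l" using free_j l by (auto simp: free_def)
    ultimately have "l = j - 1" by simp
    then show ?thesis using l by simp
  qed
  \<comment> \<open>This is where \<open>h\<close> has to exceed the number of entries: every layer
    below \<open>j\<close> is nonempty, as a nonempty layer lies in the neighbourhood of the one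
    before it, so there are at least \<open>j\<close> entries.\<close>
  have "j < h"
  proof (cases "j = 0")
    case False
    have nonempty: "Ys ! (j - 1 - i) \<noteq> {}" if "i < j" for i
      using that
    proof (induction i)
      case 0
      then show ?case using below by (auto simp: adj_def)
    next
      case (Suc i)
      then have "Ys ! (j - 1 - i) \<noteq> {}" by simp
      moreover have "j - 1 - i = Suc (j - 1 - Suc i)" using Suc.prems by simp
      moreover have "j - 1 - i < h" using below False by (metis diff_le_self le_less_trans neq0_conv)
      ultimately show ?case using step[of "j - 1 - Suc i"] by (auto simp: adj_def)
    qed
    have "1 \<le> card (Ys ! l)" if "l < j" for l
    proof -
      have "Ys ! l \<noteq> {}" using nonempty[of "j - 1 - l"] that by simp
      moreover have "l < h" using below that by linarith
      then have "finite (Ys ! l)" by (rule finite_subset[OF Ys_J J])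
      ultimately show ?thesis by (simp add: Suc_le_eq card_gt_0_iff)
    qed
    then have "(\<Sum>l<j. 1) \<le> (\<Sum>l<j. card (Ys ! l))" by (intro sum_mono) auto
    also have "\<dots> \<le> (\<Sum>l<h. card (Ys ! l))" using below False by (intro sum_mono2) auto
    finally show ?thesis using total by simp
  qed (use total in simp)
  define Zs where "Zs = Ys[j := insert v (Ys ! j)]"
  have Zs: "Zs ! l = (if l = j then insert v (Ys ! l) else Ys ! l)" if "l < h" for l
    using that len \<open>j < h\<close> by (simp add: Zs_def)
  have lenZ: "length Zs = h" by (simp add: Zs_def len)
  have v_notin: "v \<notin> Ys ! l" if "j \<le> l" "l < h" for l
    using disj[OF that, of v] v by auto
  have v_last: "\<not> (\<exists>u\<in>Ys ! l. y \<in> W u)" if "j \<le> l" "l < h" "y \<in> W v" for l y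
    using disj[OF that(1,2)] that(3) by auto
  have touch_Z: "touch W Zs l y = touch W Ys l y + (if y \<in> W v \<and> j < l then 1 else 0)" if "l \<le> h" for l y
  proof (cases "y \<in> W v \<and> j < l")
    case True
    have "{k. k < l \<and> (\<exists>u\<in>Zs ! k. y \<in> W u)} = insert j {k. k < l \<and> (\<exists>u\<in>Ys ! k. y \<in> W u)}"
      using True that Zs by auto
    moreover have "j \<notin> {k. k < l \<and> (\<exists>u\<in>Ys ! k. y \<in> W u)}"
      using v_last[of j y] True \<open>j < h\<close> by blast
    ultimately show ?thesis using True by (simp add: touch_def)
  next
    case False
    have "(\<exists>u\<in>Zs ! k. y \<in> W u) \<longleftrightarrow> (\<exists>u\<in>Ys ! k. y \<in> W u)" if "k < l" for k
      using False Zs[of k] \<open>l \<le> h\<close> that by (cases "k = j") auto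
    then have "{k. k < l \<and> (\<exists>u\<in>Zs ! k. y \<in> W u)} = {k. k < l \<and> (\<exists>u\<in>Ys ! k. y \<in> W u)}"
      by blast
    then show ?thesis using False by (simp add: touch_def)
  qed
  have touch_v: "touch W Ys l y = touch W Ys h y" if "j \<le> l" "l \<le> h" "y \<in> W v" for l y
  proof -
    have "{k. k < l \<and> (\<exists>u\<in>Ys ! k. y \<in> W u)} = {k. k < h \<and> (\<exists>u\<in>Ys ! k. y \<in> W u)}"
      using v_last[of _ y] that by (meson less_le_trans linorder_not_le order_trans)
    then show ?thesis by (simp add: touch_def)
  qed
  show ?thesis
  proof (rule that[of Zs])
    have "Zs ! Suc l \<subseteq> adj J W (Zs ! l)" if "Suc l < h" for l
    proof -
      have "Zs ! Suc l \<subseteq> adj J W (Ys ! l)"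
        using Zs[OF that] step[OF that] below by auto
      also have "\<dots> \<subseteq> adj J W (Zs ! l)" using Zs[of l] that by (auto simp: adj_def)
      finally show ?thesis .
    qed
    moreover have "Zs ! 0 \<subseteq> J" if "0 < h" using Zs[OF that] zero[OF that] v by auto
    ultimately show "Zs \<in> layerings J W h J" by (simp add: layerings_iff lenZ)
    show "independent_layers W Zs"
      unfolding independent_layers_def lenZ
    proof (intro allI impI ballI)
      fix l u u' assume *: "l < h" "u \<in> Zs ! l" "u' \<in> Zs ! l" "u \<noteq> u'"
      then show "W u \<inter> W u' = {}"
        using Ys(2) disj[of l] Zs[of l] len unfolding independent_layers_def
        by (auto split: if_splits) blast+
    qed
    show "consistent I W Q \<sigma> Zs"
      unfolding consistent_def lenZ
    proof (intro allI impI ballI)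
      fix l u assume l: "l < h" and u: "u \<in> Zs ! l \<inter> I"
      show "restrict (\<lambda>y. \<sigma> (y, touch W Zs l y)) (W u) \<in> Q u"
      proof (cases "u \<in> Ys ! l")
        case True
        have "touch W Zs l y = touch W Ys l y" if "y \<in> W u" for y
          using touch_Z[of l y] v_last[of l y] True that l by auto
        then have "restrict (\<lambda>y. \<sigma> (y, touch W Zs l y)) (W u) = restrict (\<lambda>y. \<sigma> (y, touch W Ys l y)) (W u)"
          by (intro restrict_ext) simp
        then show ?thesis using Ys(3) True u l len by (auto simp: consistent_def)
      next
        case False
        then have uv: "u = v" "l = j" using u Zs[OF l] by (auto split: if_splits)
        have "touch W Zs l y = touch W Ys h y" if "y \<in> W v" for y
          using touch_Z[of l y] touch_v[of l y] that uv l by auto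
        then have "restrict (\<lambda>y. \<sigma> (y, touch W Zs l y)) (W u) = restrict (\<lambda>y. \<sigma> (y, touch W Ys h y)) (W v)"
          unfolding uv by (intro restrict_ext) (simp add: uv)
        then show ?thesis using Q u uv by auto
      qed
    qed
    show "card {l. l < h \<and> u \<in> Zs ! l} = card {l. l < h \<and> u \<in> Ys ! l} + (if u = v then 1 else 0)" for u
    proof (cases "u = v")
      case True
      have "{l. l < h \<and> u \<in> Zs ! l} = insert j {l. l < h \<and> u \<in> Ys ! l}"
        using Zs True \<open>j < h\<close> by auto
      moreover have "j \<notin> {l. l < h \<and> u \<in> Ys ! l}" using v_notin[of j] True \<open>j < h\<close> by auto
      ultimately show ?thesis using True by simp
    next
      case False
      then have "{l. l < h \<and> u \<in> Zs ! l} = {l. l < h \<and> u \<in> Ys ! l}"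
        using Zs by (auto split: if_splits)
      then show ?thesis using False by simp
    qed
    show "touch W Zs h y = touch W Ys h y + (if y \<in> W v then 1 else 0)" for y
      using touch_Z[of h y] \<open>j < h\<close> by simp
  qed
qed

text \<open>The possible local structures, up to renaming vertices by their colours. Their number does not
  depend on \<open>m\<close>, so the union bound over them is beaten by the factor \<open>\<rho> ^ m\<close>.\<close>

definition instances ::
    "nat \<Rightarrow> nat \<Rightarrow> (nat set \<times> nat set \<times> (nat \<Rightarrow> nat set) \<times> (nat \<Rightarrow> (nat \<Rightarrow> nat) set)) set" where
  "instances n b = {(I, J, W, Q). I \<subseteq> J \<and> J \<subseteq> {..<n} \<and> (\<forall>i. W i \<subseteq> {..<n}) \<and>
     (\<forall>i. Q i \<subseteq> W i \<rightarrow>\<^sub>E {..<b}) \<and> (\<forall>i. i \<ge> n \<longrightarrow> W i = {} \<and> Q i = {})}"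

text \<open>The values \<open>{}\<close> prescribed beyond \<open>n\<close> leave only finitely many
  functions.\<close>

lemma finite_instances: "finite (instances n b)"
proof -
  let ?V = "Pow {..<n}" and ?F = "Pow (\<Union>A\<in>Pow {..<n}. A \<rightarrow>\<^sub>E {..<b})"
  let ?W = "{W. \<forall>i. (i \<in> {..<n} \<longrightarrow> W i \<in> ?V) \<and> (i \<notin> {..<n} \<longrightarrow> W i = {})}"
  let ?Q = "{Q. \<forall>i. (i \<in> {..<n} \<longrightarrow> Q i \<in> ?F) \<and> (i \<notin> {..<n} \<longrightarrow> Q i = {})}"
  have "finite (A \<rightarrow>\<^sub>E {..<b})" if "A \<in> Pow {..<n}" for A
    by (rule finite_PiE) (use that finite_subset[of A "{..<n}"] in auto)
  then have "finite ?F" by (intro finite_Pow_iff[THEN iffD2] finite_UN_I) auto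
  then have "finite (?V \<times> ?V \<times> ?W \<times> ?Q)"
    by (intro finite_SigmaI finite_set_of_finite_funs) auto
  moreover have "instances n b \<subseteq> ?V \<times> ?V \<times> ?W \<times> ?Q"
  proof
    fix t assume "t \<in> instances n b"
    then obtain I J W Q where t: "t = (I, J, W, Q)" "I \<subseteq> J" "J \<subseteq> {..<n}" "\<And>i. W i \<subseteq> {..<n}"
      "\<And>i. Q i \<subseteq> W i \<rightarrow>\<^sub>E {..<b}" "\<And>i. i \<ge> n \<Longrightarrow> W i = {} \<and> Q i = {}"
      unfolding instances_def by blast
    have "Q i \<in> ?F" for i
      by (intro PowI order_trans[OF t(5)] UN_upper) (use t(4) in simp)
    then show "t \<in> ?V \<times> ?V \<times> ?W \<times> ?Q" using t by auto
  qed
  ultimately show ?thesis by (rule finite_subset[rotated])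
qed

lemma exists_good_seed:
  fixes q \<epsilon> :: real
  assumes b: "b > 0" and q: "q \<ge> 0" and \<Delta>: "\<Delta> > 0" and \<epsilon>: "\<epsilon> > 0"
    and \<rho>: "q * (exp 1 * real \<Delta>) powr (1 + \<epsilon>) < 1"
  obtains m \<sigma> where "m > 0" "\<sigma> \<in> ({..<n} \<times> {..<n * m + 1}) \<rightarrow>\<^sub>E {..<b}"
    "\<And>I J W Q. \<lbrakk>(I, J, W, Q) \<in> instances n b; \<forall>i\<in>J. card (adj J W {i}) \<le> \<Delta>;
       \<forall>i\<in>I. real (card (Q i)) \<le> q * real b ^ card (W i)\<rbrakk> \<Longrightarrow> \<sigma> \<notin> bad_seeds I J W Q (n * m + 1) m \<epsilon>"
proof -
  let ?\<rho> = "q * (exp 1 * real \<Delta>) powr (1 + \<epsilon>)"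
  let ?T = "{(I, J, W, Q). (I, J, W, Q) \<in> instances n b \<and> (\<forall>i\<in>J. card (adj J W {i}) \<le> \<Delta>) \<and>
       (\<forall>i\<in>I. real (card (Q i)) \<le> q * real b ^ card (W i))}"
  have fin: "finite ?T" by (rule finite_subset[OF _ finite_instances[of n b]]) auto
  let ?c = "real (card ?T) * 2 ^ n"
  obtain m0 where m0: "?\<rho> ^ m0 < 1 / (?c + 1)"
    using real_arch_pow_inv[of "1 / (?c + 1)" ?\<rho>] \<rho> by (auto simp: divide_simps add_nonneg_pos)
  \<comment> \<open>The successor guarantees \<open>m > 0\<close>, so that no vertex has reached
    \<open>m\<close> at time 0.\<close>
  define m where "m = Suc m0"
  have "?\<rho> ^ m \<le> ?\<rho> ^ m0" unfolding m_def by (rule power_decreasing) (use q \<rho> in auto)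
  with m0 have "?\<rho> ^ m < 1 / (?c + 1)" by simp
  then have "?\<rho> ^ m * (?c + 1) < 1" by (simp add: pos_less_divide_eq add_nonneg_pos)
  moreover have "0 \<le> ?\<rho> ^ m" using q by simp
  ultimately have small: "?c * ?\<rho> ^ m < 1" by (simp add: algebra_simps)
  \<comment> \<open>At most \<open>n\<close> rules with at most \<open>m\<close> resamplings each
    leave room for one more insertion.\<close>
  let ?h = "n * m + 1"
  let ?D = "({..<n} \<times> {..<?h}) \<rightarrow>\<^sub>E {..<b}"
  let ?B = "\<lambda>(I, J, W, Q). ?D \<inter> bad_seeds I J W Q ?h m \<epsilon>"
  have card_D: "card ?D = b ^ (n * ?h)" by (simp add: card_PiE card_cartesian_product)
  have "real (card (\<Union>t\<in>?T. ?B t)) \<le> (\<Sum>t\<in>?T. real (card (?B t)))"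
    using card_UN_le[OF fin, of ?B] by (simp flip: of_nat_sum)
  also have "\<dots> \<le> (\<Sum>t\<in>?T. ?\<rho> ^ m * 2 ^ n * real b ^ (n * ?h))"
  proof (rule sum_mono)
    fix t assume t: "t \<in> ?T"
    obtain I J W Q where [simp]: "t = (I, J, W, Q)" by (cases t)
    have "real (card (?D \<inter> bad_seeds I J W Q ?h m \<epsilon>)) \<le> ?\<rho> ^ m * 2 ^ card {..<n} * real b ^ (card {..<n} * ?h)"
      by (rule card_bad_seeds_le) (use t q \<Delta> \<epsilon> \<rho> in \<open>auto simp: instances_def\<close>)
    then show "real (card (?B t)) \<le> ?\<rho> ^ m * 2 ^ n * real b ^ (n * ?h)" by simp
  qed
  also have "\<dots> = (?c * ?\<rho> ^ m) * real b ^ (n * ?h)" by simp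
  also have "\<dots> < 1 * real b ^ (n * ?h)" by (rule mult_strict_right_mono[OF small]) (use b in simp)
  finally have "real (card (\<Union>t\<in>?T. ?B t)) < real (card ?D)"
    unfolding card_D by (simp only: mult_1 of_nat_power)
  then have less: "card (\<Union>t\<in>?T. ?B t) < card ?D" by (simp only: of_nat_less_iff)
  have fin_B: "finite (\<Union>t\<in>?T. ?B t)"
  proof (rule finite_subset)
    show "(\<Union>t\<in>?T. ?B t) \<subseteq> ?D" by auto
    show "finite ?D" by (rule finite_PiE) auto
  qed
  have "\<not> ?D \<subseteq> (\<Union>t\<in>?T. ?B t)"
  proof
    assume "?D \<subseteq> (\<Union>t\<in>?T. ?B t)"
    from card_mono[OF fin_B this] less show False by (rule leD[THEN notE])
  qed
  then obtain \<sigma> where \<sigma>: "\<sigma> \<in> ?D" "\<sigma> \<notin> (\<Union>t\<in>?T. ?B t)" unfolding subset_iff not_all not_imp by (elim exE conjE)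
  show ?thesis
  proof (rule that[of m \<sigma>])
    show "m > 0" by (simp add: m_def)
    show "\<sigma> \<in> ?D" by (rule \<sigma>)
    fix I J W Q
    assume "(I, J, W, Q) \<in> instances n b" "\<forall>i\<in>J. card (adj J W {i}) \<le> \<Delta>"
       "\<forall>i\<in>I. real (card (Q i)) \<le> q * real b ^ card (W i)"
    then have "(I, J, W, Q) \<in> ?T" by simp
    then have "\<sigma> \<notin> ?B (I, J, W, Q)" using \<sigma>(2) by blast
    then show "\<sigma> \<notin> bad_seeds I J W Q ?h m \<epsilon>" using \<sigma>(1) by simp
  qed
qed

subsection \<open>The resampling algorithm\<close>

declare layerings.simps [simp del]

text \<open>Double counting by layers and by rules; it turns sizes of records into sums of
  activities.\<close>

lemma sum_card_layers:
  assumes "finite J" "length Ys = h" "\<And>l. l < h \<Longrightarrow> Ys ! l \<subseteq> J"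
  shows "(\<Sum>Y\<leftarrow>Ys. card (Y \<inter> K)) = (\<Sum>i\<in>J \<inter> K. card {l. l < h \<and> i \<in> Ys ! l})"
proof -
  have "(\<Sum>Y\<leftarrow>Ys. card (Y \<inter> K)) = (\<Sum>l<h. card (Ys ! l \<inter> K))"
    using assms(2) by (simp add: sum_list_sum_nth atLeast0LessThan)
  also have "\<dots> = (\<Sum>l<h. \<Sum>i\<in>J \<inter> K. if i \<in> Ys ! l then 1 else 0)"
  proof (rule sum.cong)
    fix l assume "l \<in> {..<h}"
    then have "Ys ! l \<inter> K = {i \<in> J \<inter> K. i \<in> Ys ! l}" using assms(3)[of l] by auto
    then show "card (Ys ! l \<inter> K) = (\<Sum>i\<in>J \<inter> K. if i \<in> Ys ! l then 1 else 0)"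
      using assms(1) by (simp add: sum.If_cases Int_def)
  qed simp
  also have "\<dots> = (\<Sum>i\<in>J \<inter> K. \<Sum>l<h. if i \<in> Ys ! l then 1 else 0)" by (rule sum.swap)
  also have "\<dots> = (\<Sum>i\<in>J \<inter> K. card {l. l < h \<and> i \<in> Ys ! l})"
    by (rule sum.cong) (simp_all add: sum.If_cases Int_def)
  finally show ?thesis .
qed

text \<open>The radius \<open>3 * r + 1\<close> is \<open>3 * k + 4\<close> for the largest
  \<open>k < r\<close>, the distance up to which rules in the outer ball of radius
  \<open>3 * k + 3\<close> have variables.\<close>

locale resampling =
  fixes V :: "'a set" and E :: "('a \<times> 'a) set" and R :: "'a \<Rightarrow> ('a \<Rightarrow> nat) set"
    and c :: "'a \<Rightarrow> nat" and n r b :: nat and \<omega> :: "nat \<times> nat \<Rightarrow> nat"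
  assumes E_sub: "E \<subseteq> V \<times> V"
    and finite_Var: "x \<in> V \<Longrightarrow> finite (Var E x)" and finite_Cl: "x \<in> V \<Longrightarrow> finite (Cl E x)"
    and c_less: "x \<in> V \<Longrightarrow> c x < n" and c_inj: "x \<in> V \<Longrightarrow> inj_on c (nbhd E x (3 * r + 1))"
    and rule: "local_rule b V E R" and \<omega>_less: "\<omega> p < b"
begin

text \<open>\<open>resampled t y\<close> counts the resamplings of the variable \<open>y\<close> before time \<open>t\<close>, so the current
  value of \<open>y\<close> is \<open>\<omega> (c y, resampled t y)\<close>; \<open>activity t x\<close> counts the resamplings caused by the
  rule at \<open>x\<close>.\<close>

definition violated :: "('a \<Rightarrow> nat) \<Rightarrow> 'a \<Rightarrow> bool" where
  "violated h x \<longleftrightarrow> x \<in> V \<and> restrict (\<lambda>y. \<omega> (c y, h y)) (Var E x) \<notin> R x"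

text \<open>Time runs through the colours cyclically: each rule has its turn every \<open>n\<close>
  steps, and where \<open>c\<close> is injective at most one rule acts at a time.\<close>

definition active :: "nat \<Rightarrow> ('a \<Rightarrow> nat) \<Rightarrow> 'a \<Rightarrow> bool" where
  "active t h x \<longleftrightarrow> violated h x \<and> c x = t mod n"

primrec resampled :: "nat \<Rightarrow> 'a \<Rightarrow> nat" where
  "resampled 0 = (\<lambda>_. 0)"
| "resampled (Suc t) = (\<lambda>y. if \<exists>x. active t (resampled t) x \<and> y \<in> Var E x
     then Suc (resampled t y) else resampled t y)"

primrec activity :: "nat \<Rightarrow> 'a \<Rightarrow> nat" where
  "activity 0 = (\<lambda>_. 0)"
| "activity (Suc t) = (\<lambda>x. if active t (resampled t) x then Suc (activity t x) else activity t x)"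

lemma Var_V: "y \<in> Var E x \<Longrightarrow> x \<in> V \<and> y \<in> V"
  using E_sub by (auto simp: Var_def)

lemma Var_nbhd: "y \<in> Var E x \<Longrightarrow> y \<in> nbhd E x 1"
  unfolding nbhd_1 by (simp add: Var_def)

lemma nbhd_V: "x \<in> V \<Longrightarrow> nbhd E x k \<subseteq> V"
  by (rule nbhd_subset[OF E_sub])

lemma c_inj_le: "x \<in> V \<Longrightarrow> k \<le> 3 * r + 1 \<Longrightarrow> inj_on c (nbhd E x k)"
  using c_inj nbhd_mono inj_on_subset by metis

lemma finite_nbhd:
  assumes "x \<in> V" "k \<le> 3 * r + 1"
  shows "finite (nbhd E x k)"
proof (rule finite_imageD[OF _ c_inj_le[OF assms]])
  show "finite (c ` nbhd E x k)"
    by (rule finite_subset[of _ "{..<n}"]) (use nbhd_V[OF assms(1)] c_less in auto)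
qed

text \<open>Here the convention for rules without variables enters: a violated rule always has
  something to resample.\<close>

lemma violated_Var: "violated h x \<Longrightarrow> Var E x \<noteq> {}"
proof
  assume viol: "violated h x" and empty: "Var E x = {}"
  then have "R x = colourings b {}" using rule by (auto simp: violated_def local_rule_def)
  then show False using viol empty by (auto simp: violated_def restrict_def)
qed

lemma resampled_le_activity:
  assumes "y \<in> V"
  shows "resampled t y \<le> (\<Sum>x\<in>Cl E y. activity t x)"
proof (induction t)
  case (Suc t)
  show ?case
  proof (cases "\<exists>x. active t (resampled t) x \<and> y \<in> Var E x")
    case True
    then obtain x where x: "active t (resampled t) x" "x \<in> Cl E y" by (auto simp: Var_def Cl_def)
    have "(\<Sum>x\<in>Cl E y. activity t x) < (\<Sum>x\<in>Cl E y. activity (Suc t) x)"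
      by (rule sum_strict_mono_ex1[OF finite_Cl[OF assms]]) (use x in auto)
    then show ?thesis using Suc True by simp
  next
    case False
    have "(\<Sum>x\<in>Cl E y. activity t x) \<le> (\<Sum>x\<in>Cl E y. activity (Suc t) x)"
      by (rule sum_mono) simp
    moreover have "resampled (Suc t) y = resampled t y" using False by auto
    ultimately show ?thesis using Suc by simp
  qed
qed simp

lemma resampled_mono: "s \<le> t \<Longrightarrow> resampled s y \<le> resampled t y"
  by (rule lift_Suc_mono_le[of "\<lambda>t. resampled t y"]) auto

text \<open>If the limit violated the rule at \<open>x\<close>, then \<open>x\<close> would have a
  turn after its finitely many variables had settled, and would change them once more. Writing the
  final count as a least bound defines it by countably many conditions, as needed for
  measurability.\<close>

lemma limit_satisfies:
  assumes bound: "\<And>t x. x \<in> V \<Longrightarrow> activity t x < m"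
  shows "satisfies V E (\<lambda>y. \<omega> (c y, LEAST k. \<forall>t. resampled t y \<le> k)) R"
proof -
  define l where "l y = (LEAST k. \<forall>t. resampled t y \<le> k)" for y
  have ev: "\<exists>t0. \<forall>t\<ge>t0. resampled t y = l y" if y: "y \<in> V" for y
  proof -
    let ?m = "card (Cl E y) * m"
    have "resampled t y \<le> ?m" for t
    proof -
      have "resampled t y \<le> (\<Sum>x\<in>Cl E y. activity t x)" by (rule resampled_le_activity[OF y])
      also have "\<dots> \<le> (\<Sum>x\<in>Cl E y. m)"
        by (rule sum_mono) (use bound E_sub in \<open>auto simp: Cl_def intro!: less_imp_le\<close>)
      finally show ?thesis by simp
    qed
    then have "\<exists>k. \<forall>t. resampled t y \<le> k" by blast
    then have le: "\<forall>t. resampled t y \<le> l y" unfolding l_def by (rule LeastI_ex)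
    have "\<exists>t0. resampled t0 y \<ge> l y"
    proof (rule ccontr)
      assume "\<not> ?thesis"
      then have lt: "resampled t y < l y" for t by (auto simp: not_le)
      then have "\<forall>t. resampled t y \<le> l y - 1" by (metis Suc_pred' le0 le_trans less_Suc_eq_le not_less0 gr_zeroI)
      then have "l y \<le> l y - 1" unfolding l_def by (rule Least_le)
      then show False using lt[of 0] by simp
    qed
    then obtain t0 where "resampled t0 y \<ge> l y" ..
    then have "resampled t y = l y" if "t \<ge> t0" for t
      using resampled_mono[OF that, of y] le by (meson le_antisym le_trans)
    then show ?thesis by blast
  qed
  have "restrict (\<lambda>y. \<omega> (c y, l y)) (Var E x) \<in> R x" if x: "x \<in> V" for x
  proof (rule ccontr)
    assume viol: "restrict (\<lambda>y. \<omega> (c y, l y)) (Var E x) \<notin> R x"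
    obtain T where T: "\<And>y t. y \<in> Var E x \<Longrightarrow> t \<ge> T y \<Longrightarrow> resampled t y = l y"
      using ev Var_V by metis
    define t0 where "t0 = Max (insert 0 (T ` Var E x))"
    have "T y \<le> t0" if "y \<in> Var E x" for y
      unfolding t0_def using finite_Var[OF x] that by (intro Max_ge) auto
    then have stable: "resampled t y = l y" if "y \<in> Var E x" "t \<ge> t0" for y t
      using T that le_trans by blast
    define t where "t = n * t0 + c x"
    have "t mod n = c x" using c_less[OF x] by (simp add: t_def)
    moreover have "t \<ge> t0" using c_less[OF x] by (cases n) (auto simp: t_def)
    ultimately have t: "t \<ge> t0" "c x = t mod n" by simp_all
    have "restrict (\<lambda>y. \<omega> (c y, resampled t y)) (Var E x) = restrict (\<lambda>y. \<omega> (c y, l y)) (Var E x)"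
      by (rule restrict_ext) (use stable t in auto)
    then have violated: "violated (resampled t) x" using viol x by (simp add: violated_def)
    then have active: "active t (resampled t) x" using t by (simp add: active_def)
    obtain y where y: "y \<in> Var E x" using violated_Var[OF violated] by blast
    then have "resampled (Suc t) y = Suc (resampled t y)" using active by auto
    then show False using stable[OF y t(1)] stable[OF y, of "Suc t"] t by simp
  qed
  then show ?thesis unfolding satisfies_def l_def by blast
qed

text \<open>The structure of the ball around \<open>x\<close>, with its vertices replaced by their colours.\<close>

definition local_inner :: "'a \<Rightarrow> nat \<Rightarrow> nat set" where
  "local_inner x k = c ` nbhd E x (3 * k)"

definition local_outer :: "'a \<Rightarrow> nat \<Rightarrow> nat set" where
  "local_outer x k = c ` nbhd E x (3 * k + 3)"

definition local_Var :: "'a \<Rightarrow> nat \<Rightarrow> nat \<Rightarrow> nat set" where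
  "local_Var x k i = (if i \<in> local_outer x k
     then c ` Var E (inv_into (nbhd E x (3 * k + 3)) c i) else {})"

text \<open>The violating assignments of the rule with colour \<open>i\<close>, transported from
  variables to colours; this instantiates \<open>Q\<close>.\<close>

definition local_compl :: "'a \<Rightarrow> nat \<Rightarrow> nat \<Rightarrow> (nat \<Rightarrow> nat) set" where
  "local_compl x k i = (if i \<in> local_outer x k
     then {\<psi> \<in> local_Var x k i \<rightarrow>\<^sub>E {..<b}.
       restrict (\<lambda>y. \<psi> (c y)) (Var E (inv_into (nbhd E x (3 * k + 3)) c i)) \<notin> R (inv_into (nbhd E x (3 * k + 3)) c i)}
     else {})"

section \<open>Records of the run inside one ball\<close>

context
  fixes x k
  assumes x: "x \<in> V" and k: "k < r"
begin

abbreviation (input) "core \<equiv> nbhd E x (3 * k)"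
abbreviation (input) "shell \<equiv> nbhd E x (3 * k + 3)"
abbreviation (input) "region \<equiv> nbhd E x (3 * k + 4)"

lemma c_inj_region: "inj_on c region"
  by (rule c_inj_le[OF x]) (use k in simp)

lemma inner_outer: "core \<subseteq> shell" and outer_region: "shell \<subseteq> region"
  by (rule nbhd_mono, simp)+

lemma c_inj_outer: "inj_on c shell"
  using c_inj_region outer_region inj_on_subset by metis

lemma Var_region: "v \<in> shell \<Longrightarrow> Var E v \<subseteq> region"
proof
  fix y assume "v \<in> shell" "y \<in> Var E v"
  then have "y \<in> nbhd E x (3 * k + 3 + 1)" by (intro nbhd_trans[OF _ Var_nbhd])
  moreover have "3 * k + 3 + 1 = 3 * k + 4" by simp
  ultimately show "y \<in> region" by (simp only:)
qed

lemma outer_V: "shell \<subseteq> V"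
  by (rule nbhd_V[OF x])

lemma local_Var_c: "v \<in> shell \<Longrightarrow> local_Var x k (c v) = c ` Var E v"
  using inv_into_f_f[OF c_inj_outer] by (simp add: local_Var_def local_outer_def)

lemma local_compl_c: "v \<in> shell \<Longrightarrow> local_compl x k (c v) =
    {\<psi> \<in> (c ` Var E v) \<rightarrow>\<^sub>E {..<b}. restrict (\<lambda>y. \<psi> (c y)) (Var E v) \<notin> R v}"
  using inv_into_f_f[OF c_inj_outer] local_Var_c by (simp add: local_compl_def local_outer_def)

lemma local_instance: "(local_inner x k, local_outer x k, local_Var x k, local_compl x k) \<in> instances n b"
proof -
  have outer_n: "local_outer x k \<subseteq> {..<n}"
    using outer_V c_less by (auto simp: local_outer_def)
  have "local_Var x k i \<subseteq> {..<n}" for i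
  proof (cases "i \<in> local_outer x k")
    case True
    then obtain v where v: "v \<in> shell" "i = c v" by (auto simp: local_outer_def)
    show ?thesis unfolding v(2) local_Var_c[OF v(1)] using Var_V c_less by blast
  qed (simp add: local_Var_def)
  moreover have "local_compl x k i \<subseteq> local_Var x k i \<rightarrow>\<^sub>E {..<b}" for i
    unfolding local_compl_def by auto
  moreover have "local_Var x k i = {} \<and> local_compl x k i = {}" if "i \<ge> n" for i
  proof -
    have "i \<notin> local_outer x k" using outer_n that by auto
    then show ?thesis by (simp add: local_Var_def local_compl_def)
  qed
  moreover have "local_inner x k \<subseteq> local_outer x k"
    unfolding local_inner_def local_outer_def by (rule image_mono[OF inner_outer])
  ultimately show ?thesis using outer_n unfolding instances_def by simp
qed

text \<open>All variables of the shell lie in the region, where \<open>c\<close> is injective, so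
  passing to colours creates no new coincidences of variables.\<close>

lemma local_degree:
  assumes "\<And>v. v \<in> V \<Longrightarrow> finite {u \<in> V. Var E v \<inter> Var E u \<noteq> {}} \<and> card {u \<in> V. Var E v \<inter> Var E u \<noteq> {}} \<le> \<Delta>"
    and "i \<in> local_outer x k"
  shows "card (adj (local_outer x k) (local_Var x k) {i}) \<le> \<Delta>"
proof -
  obtain v where v: "v \<in> shell" "i = c v" using assms(2) by (auto simp: local_outer_def)
  let ?N = "{u \<in> V. Var E v \<inter> Var E u \<noteq> {}}"
  have "adj (local_outer x k) (local_Var x k) {i} \<subseteq> c ` ?N"
  proof
    fix j assume "j \<in> adj (local_outer x k) (local_Var x k) {i}"
    then obtain u where u: "u \<in> shell" "j = c u" "local_Var x k (c u) \<inter> local_Var x k (c v) \<noteq> {}"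
      using v by (auto simp: adj_def local_outer_def)
    then obtain y z where yz: "y \<in> Var E u" "z \<in> Var E v" "c y = c z"
      using local_Var_c v by auto
    then have "y = z"
      using inj_onD[OF c_inj_region, of y z] Var_region[OF u(1)] Var_region[OF v(1)] by blast
    then have "u \<in> ?N" using yz u outer_V by blast
    then show "j \<in> c ` ?N" using u by blast
  qed
  moreover have "finite ?N \<and> card ?N \<le> \<Delta>" using assms(1) v outer_V by blast
  ultimately show ?thesis by (meson card_image_le card_mono finite_imageI le_trans)
qed

lemma local_compl_card:
  assumes "\<And>v. v \<in> V \<Longrightarrow> real (card (rule_compl b E R v)) \<le> q * real b ^ card (Var E v)"
    and "i \<in> local_outer x k"
  shows "real (card (local_compl x k i)) \<le> q * real b ^ card (local_Var x k i)"
proof -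
  obtain v where v: "v \<in> shell" "i = c v" using assms(2) by (auto simp: local_outer_def)
  have vV: "v \<in> V" using v outer_V by auto
  have inj: "inj_on c (Var E v)" by (rule inj_on_subset[OF c_inj_region Var_region[OF v(1)]])
  let ?g = "\<lambda>\<psi>. restrict (\<lambda>y. \<psi> (c y)) (Var E v)"
  have "inj_on ?g (local_compl x k i)"
  proof (rule inj_onI)
    fix \<psi> \<psi>' assume *: "\<psi> \<in> local_compl x k i" "\<psi>' \<in> local_compl x k i" "?g \<psi> = ?g \<psi>'"
    then have "\<psi> \<in> (c ` Var E v) \<rightarrow>\<^sub>E {..<b}" "\<psi>' \<in> (c ` Var E v) \<rightarrow>\<^sub>E {..<b}"
      unfolding v(2) local_compl_c[OF v(1)] by auto
    then show "\<psi> = \<psi>'"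
    proof (rule PiE_ext)
      fix z assume "z \<in> c ` Var E v"
      then obtain y where "y \<in> Var E v" "z = c y" by blast
      then show "\<psi> z = \<psi>' z" using fun_cong[OF *(3), of y] by simp
    qed
  qed
  moreover have "?g ` local_compl x k i \<subseteq> rule_compl b E R v"
    unfolding v(2) local_compl_c[OF v(1)] rule_compl_def by (auto simp: PiE_iff)
  moreover have "finite (rule_compl b E R v)"
    unfolding rule_compl_def by (intro finite_Diff finite_PiE finite_Var[OF vV]) auto
  ultimately have "card (local_compl x k i) \<le> card (rule_compl b E R v)" by (rule card_inj_on_le)
  moreover have "card (local_Var x k i) = card (Var E v)"
    unfolding v(2) local_Var_c[OF v(1)] by (rule card_image[OF inj])
  ultimately show ?thesis using assms(1)[OF vV] by simp
qed

text \<open>The record grows with the run, by one insertion whenever a rule of the shell is active.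
  A rule sharing a variable with a rule of the core lies within \<open>3 * k + 2\<close> of
  \<open>x\<close>, hence in the shell; so for these variables the record misses nothing and its
  stream positions are the true ones. Other variables of the shell may be resampled from outside,
  and nothing is claimed about them.\<close>

lemma activity_layers:
  assumes act: "\<And>v. v \<in> shell \<Longrightarrow> activity t v \<le> m"
  shows "\<exists>Ys\<in>layerings (local_outer x k) (local_Var x k) (n * m + 1) (local_outer x k).
     independent_layers (local_Var x k) Ys \<and>
     consistent (local_inner x k) (local_Var x k) (local_compl x k) \<omega> Ys \<and>
     (\<forall>v\<in>shell. card {l. l < n * m + 1 \<and> c v \<in> Ys ! l} = activity t v) \<and>
     (\<forall>v\<in>core. \<forall>y\<in>Var E v. touch (local_Var x k) Ys (n * m + 1) (c y) = resampled t y)"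
  using act
proof (induction t)
  let ?h = "n * m + 1" and ?I = "local_inner x k" and ?J = "local_outer x k"
  let ?W = "local_Var x k" and ?Q = "local_compl x k"
  case 0
  have "replicate ?h {} \<in> layerings ?J ?W ?h ?J"
    unfolding layerings_iff by (auto simp del: replicate_Suc)
  moreover have "independent_layers ?W (replicate ?h {})"
    by (auto simp: independent_layers_def simp del: replicate_Suc)
  moreover have "consistent ?I ?W ?Q \<omega> (replicate ?h {})"
    by (auto simp: consistent_def simp del: replicate_Suc)
  moreover have "{l. l < ?h \<and> u \<in> replicate ?h {} ! l} = {}" for u :: nat
    by (auto simp del: replicate_Suc)
  moreover have "touch ?W (replicate ?h {}) ?h y = 0" for y
    by (auto simp: touch_def simp del: replicate_Suc)
  ultimately show ?case by (intro bexI[of _ "replicate ?h {}"]) simp_all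
next
  let ?h = "n * m + 1" and ?I = "local_inner x k" and ?J = "local_outer x k"
  let ?W = "local_Var x k" and ?Q = "local_compl x k"
  case (Suc t)
  have act: "activity t v \<le> m" if "v \<in> shell" for v
    using Suc.prems[OF that] by (auto split: if_splits)
  from Suc.IH[OF act] obtain Ys where Ys: "Ys \<in> layerings ?J ?W ?h ?J" "independent_layers ?W Ys"
    "consistent ?I ?W ?Q \<omega> Ys" "\<And>v. v \<in> shell \<Longrightarrow> card {l. l < ?h \<and> c v \<in> Ys ! l} = activity t v"
    "\<And>v y. v \<in> core \<Longrightarrow> y \<in> Var E v \<Longrightarrow> touch ?W Ys ?h (c y) = resampled t y"
    by blast
  have touching: "u \<in> shell" if "v \<in> core" "y \<in> Var E v" "y \<in> Var E u" for u v y
  proof -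
    have "y \<in> nbhd E x (3 * k + 1)" by (rule nbhd_trans[OF that(1) Var_nbhd[OF that(2)]])
    then have "u \<in> nbhd E x (3 * k + 1 + 1)" by (rule nbhd_trans[OF _ nbhd_sym[OF Var_nbhd[OF that(3)]]])
    then show ?thesis using nbhd_mono[of "3 * k + 1 + 1" "3 * k + 3" E x] by auto
  qed
  have fin_outer: "finite shell" by (rule finite_nbhd[OF x]) (use k in simp)
  have fin_J: "finite ?J" unfolding local_outer_def using fin_outer by simp
  show ?case
  proof (cases "\<exists>v\<in>shell. active t (resampled t) v")
    case False
    have "activity (Suc t) v = activity t v" if "v \<in> shell" for v using False that by auto
    moreover have "resampled (Suc t) y = resampled t y" if "v \<in> core" "y \<in> Var E v" for v y
      using False touching[OF that] by auto
    ultimately show ?thesis using Ys by (intro bexI[OF _ Ys(1)]) simp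
  next
    case True
    then obtain v where v: "v \<in> shell" "active t (resampled t) v" by blast
    have vV: "v \<in> V" using v outer_V by auto
    have uniq: "u = v" if "u \<in> shell" "active t (resampled t) u" for u
      using inj_onD[OF c_inj_outer _ that(1) v(1)] that v by (simp add: active_def)
    have viol: "violated (resampled t) v" using v by (simp add: active_def)
    have Wv: "?W (c v) = c ` Var E v" by (rule local_Var_c[OF v(1)])
    have Ys_J: "Ys ! l \<subseteq> ?J" if "l < ?h" for l
      by (rule layerings_nth_subset[OF Ys(1) that])
    have total: "(\<Sum>l<?h. card (Ys ! l)) < ?h"
    proof -
      have "(\<Sum>l<?h. card (Ys ! l)) = (\<Sum>Y\<leftarrow>Ys. card (Y \<inter> UNIV))"
        using Ys(1) by (simp add: sum_list_sum_nth atLeast0LessThan layerings_iff)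
      also have "\<dots> = (\<Sum>i\<in>?J \<inter> UNIV. card {l. l < ?h \<and> i \<in> Ys ! l})"
        by (rule sum_card_layers[OF fin_J]) (use Ys(1) Ys_J in \<open>auto simp: layerings_iff\<close>)
      also have "\<dots> = (\<Sum>i\<in>c ` shell. card {l. l < ?h \<and> i \<in> Ys ! l})"
        by (simp add: local_outer_def)
      also have "\<dots> \<le> (\<Sum>i\<in>c ` shell. m)" by (rule sum_mono) (use Ys(4) act in auto)
      also have "\<dots> \<le> n * m"
        using card_mono[of "{..<n}" "c ` shell"] outer_V c_less by auto
      finally show ?thesis by simp
    qed
    have Q: "restrict (\<lambda>y. \<omega> (y, touch ?W Ys ?h y)) (?W (c v)) \<in> ?Q (c v)" if "c v \<in> ?I"
    proof -
      have "v \<in> core"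
        using that inj_onD[OF c_inj_outer _ v(1)] inner_outer by (auto simp: local_inner_def)
      have "restrict (\<lambda>y. restrict (\<lambda>y. \<omega> (y, touch ?W Ys ?h y)) (?W (c v)) (c y)) (Var E v)
          = restrict (\<lambda>y. \<omega> (c y, resampled t y)) (Var E v)"
        by (rule restrict_ext) (use Ys(5)[OF \<open>v \<in> core\<close>] in \<open>simp add: Wv\<close>)
      then show ?thesis
        using viol \<omega>_less unfolding local_compl_c[OF v(1)] by (auto simp: violated_def Wv)
    qed
    have cJ: "c v \<in> ?J" using v by (auto simp: local_outer_def)
    have W_ne: "?W (c v) \<noteq> {}" using violated_Var[OF viol] Wv by simp
    obtain Zs where Zs: "Zs \<in> layerings ?J ?W ?h ?J" "independent_layers ?W Zs"
      "consistent ?I ?W ?Q \<omega> Zs"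
      "\<And>u. card {l. l < ?h \<and> u \<in> Zs ! l} = card {l. l < ?h \<and> u \<in> Ys ! l} + (if u = c v then 1 else 0)"
      "\<And>y. touch ?W Zs ?h y = touch ?W Ys ?h y + (if y \<in> ?W (c v) then 1 else 0)"
      by (rule layer_insertion[OF fin_J Ys(1-3) cJ W_ne total Q]) (assumption, rule that)
    have "card {l. l < ?h \<and> c u \<in> Zs ! l} = activity (Suc t) u" if "u \<in> shell" for u
    proof -
      have "c u = c v \<longleftrightarrow> u = v" using inj_on_eq_iff[OF c_inj_outer that v(1)] .
      moreover have "active t (resampled t) u \<longleftrightarrow> u = v" using uniq[OF that] v by blast
      ultimately show ?thesis using Zs(4)[of "c u"] Ys(4)[OF that] by simp
    qed
    moreover have "touch ?W Zs ?h (c y) = resampled (Suc t) y" if u: "u \<in> core" "y \<in> Var E u" for u y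
    proof -
      have "y \<in> region" using Var_region[of u] u inner_outer by auto
      then have "c y \<in> ?W (c v) \<longleftrightarrow> y \<in> Var E v"
        unfolding Wv using inj_on_image_mem_iff[OF c_inj_region _ Var_region[OF v(1)]] by blast
      moreover have "(\<exists>w. active t (resampled t) w \<and> y \<in> Var E w) \<longleftrightarrow> y \<in> Var E v"
        using uniq touching[OF u] v by blast
      ultimately show ?thesis using Zs(5)[of "c y"] Ys(5)[OF u] by simp
    qed
    ultimately show ?thesis using Zs(1-3) by (intro bexI[OF _ Zs(1)]) simp
  qed
qed

end

lemma activity_bounded:
  fixes q \<epsilon> :: real
  assumes r: "r > 0" and m: "m > 0" and \<epsilon>: "\<epsilon> > 0"
    and growth: "\<And>x. x \<in> V \<Longrightarrow> real (card (nbhd E x (3 * r))) \<le> (1 + \<epsilon>) ^ r"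
    and Rel_degree: "\<And>v. v \<in> V \<Longrightarrow> finite {u \<in> V. Var E v \<inter> Var E u \<noteq> {}} \<and> card {u \<in> V. Var E v \<inter> Var E u \<noteq> {}} \<le> \<Delta>"
    and compl: "\<And>v. v \<in> V \<Longrightarrow> real (card (rule_compl b E R v)) \<le> q * real b ^ card (Var E v)"
    and good: "\<And>I J W Q. \<lbrakk>(I, J, W, Q) \<in> instances n b; \<forall>i\<in>J. card (adj J W {i}) \<le> \<Delta>;
       \<forall>i\<in>I. real (card (Q i)) \<le> q * real b ^ card (W i)\<rbrakk> \<Longrightarrow> \<omega> \<notin> bad_seeds I J W Q (n * m + 1) m \<epsilon>"
    and v: "v \<in> V"
  shows "activity t v < m"
proof (rule ccontr)
  assume "\<not> activity t v < m"
  then have ex: "\<exists>t. \<exists>v\<in>V. m \<le> activity t v" using v by (auto simp: not_less)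
  define T where "T = (LEAST t. \<exists>v\<in>V. m \<le> activity t v)"
  obtain x where x: "x \<in> V" "m \<le> activity T x" using LeastI_ex[OF ex] unfolding T_def by blast
  \<comment> \<open>One step before \<open>T\<close> all activities are below \<open>m\<close>, and
    a step adds at most 1, so at time \<open>T\<close> none exceeds \<open>m\<close>.\<close>
  obtain T' where T': "T = Suc T'" using x m by (cases T) auto
  have "activity T' u < m" if "u \<in> V" for u
    using not_less_Least[of T' "\<lambda>t. \<exists>v\<in>V. m \<le> activity t v"] that T' unfolding T_def by (auto simp: not_le)
  then have le_m: "activity T u \<le> m" if "u \<in> V" for u using that T' by (auto simp: Suc_le_eq less_imp_le)
  define A where "A k = (\<Sum>u\<in>nbhd E x (3 * k). activity T u)" for k
  \<comment> \<open>Otherwise \<open>A r\<close> would exceed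
    \<open>(1 + \<epsilon>) ^ r * m\<close>, although the ball of radius \<open>3 * r\<close> has at
    most \<open>(1 + \<epsilon>) ^ r\<close> vertices, each contributing at most \<open>m\<close>.
    The strict inequality comes from the last step, which exists as \<open>r > 0\<close>.\<close>
  have "\<exists>k<r. real (A (Suc k)) \<le> (1 + \<epsilon>) * real (A k)"
  proof (rule ccontr)
    assume "\<not> ?thesis"
    then have step: "(1 + \<epsilon>) * real (A k) < real (A (Suc k))" if "k < r" for k using that by (auto simp: not_le)
    have "(1 + \<epsilon>) ^ k * real m \<le> real (A k)" if "k \<le> r" for k
      using that
    proof (induction k)
      case 0
      then show ?case using x by (simp add: A_def)
    next
      case (Suc k)
      then have "(1 + \<epsilon>) * ((1 + \<epsilon>) ^ k * real m) \<le> (1 + \<epsilon>) * real (A k)"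
        using \<epsilon> by (intro mult_left_mono) auto
      then show ?case using step[of k] Suc.prems by simp
    qed
    from this[of "r - 1"] have "(1 + \<epsilon>) * ((1 + \<epsilon>) ^ (r - 1) * real m) \<le> (1 + \<epsilon>) * real (A (r - 1))"
      using \<epsilon> by (intro mult_left_mono) auto
    also have "\<dots> < real (A r)" using step[of "r - 1"] r by simp
    also have "\<dots> \<le> real (\<Sum>u\<in>nbhd E x (3 * r). m)"
      unfolding A_def of_nat_le_iff by (rule sum_mono) (use nbhd_V[OF x(1)] le_m in auto)
    also have "\<dots> \<le> (1 + \<epsilon>) ^ r * real m"
      using growth[OF x(1)] by (simp add: mult_right_mono)
    also have "\<dots> = (1 + \<epsilon>) * ((1 + \<epsilon>) ^ (r - 1) * real m)" using r by (cases r) auto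
    finally show False by simp
  qed
  then obtain k where k: "k < r" "real (A (Suc k)) \<le> (1 + \<epsilon>) * real (A k)" by blast
  let ?h = "n * m + 1" and ?I = "local_inner x k" and ?J = "local_outer x k"
  let ?W = "local_Var x k" and ?Q = "local_compl x k"
  let ?outer = "nbhd E x (3 * k + 3)"
  have "activity T u \<le> m" if "u \<in> ?outer" for u using that nbhd_V[OF x(1)] le_m by blast
  from activity_layers[OF x(1) k(1) this] obtain Ys where Ys: "Ys \<in> layerings ?J ?W ?h ?J" "independent_layers ?W Ys"
    "consistent ?I ?W ?Q \<omega> Ys" "\<And>v. v \<in> ?outer \<Longrightarrow> card {l. l < ?h \<and> c v \<in> Ys ! l} = activity T v"
    by blast
  have fin_outer: "finite ?outer" by (rule finite_nbhd[OF x(1)]) (use k in simp)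
  have fin_J: "finite ?J" unfolding local_outer_def using fin_outer by simp
  have len: "length Ys = ?h" using Ys(1) unfolding layerings_iff by (rule conjunct1)
  have Ys_J: "Ys ! l \<subseteq> ?J" if "l < ?h" for l
    by (rule layerings_nth_subset[OF Ys(1) that])
  have count: "(\<Sum>Y\<leftarrow>Ys. card (Y \<inter> c ` B)) = (\<Sum>u\<in>B. activity T u)" if "B \<subseteq> ?outer" for B
  proof -
    have "(\<Sum>Y\<leftarrow>Ys. card (Y \<inter> c ` B)) = (\<Sum>i\<in>?J \<inter> c ` B. card {l. l < ?h \<and> i \<in> Ys ! l})"
      by (rule sum_card_layers[OF fin_J len Ys_J])
    also have "?J \<inter> c ` B = c ` B" using that by (auto simp: local_outer_def)
    also have "(\<Sum>i\<in>c ` B. card {l. l < ?h \<and> i \<in> Ys ! l}) = (\<Sum>u\<in>B. card {l. l < ?h \<and> c u \<in> Ys ! l})"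
      by (rule sum.reindex_cong[OF _ refl refl]) (rule inj_on_subset[OF c_inj_outer[OF x(1) k(1)] that])
    also have "\<dots> = (\<Sum>u\<in>B. activity T u)" by (rule sum.cong) (use Ys(4) that in auto)
    finally show ?thesis .
  qed
  have inner: "(\<Sum>Y\<leftarrow>Ys. card (Y \<inter> ?I)) = A k"
    unfolding local_inner_def A_def by (rule count[OF inner_outer[OF x(1) k(1)]])
  have "(\<Sum>Y\<leftarrow>Ys. card Y) = (\<Sum>Y\<leftarrow>Ys. card (Y \<inter> ?J))"
    using Ys_J len by (intro arg_cong[of _ _ sum_list] map_cong refl)
      (auto simp: in_set_conv_nth Int_absorb2)
  also have "\<dots> = A (Suc k)"
    unfolding local_outer_def A_def by (subst count) (simp_all add: add.commute)
  finally have outer: "(\<Sum>Y\<leftarrow>Ys. card Y) = A (Suc k)" .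
  have "activity T x \<le> A k"
    unfolding A_def by (rule member_le_sum) (use finite_nbhd[OF x(1), of "3 * k"] k in auto)
  then have "\<omega> \<in> bad_seeds ?I ?J ?W ?Q ?h m \<epsilon>"
    unfolding bad_seeds_def using Ys inner outer k x by auto
  moreover have "\<omega> \<notin> bad_seeds ?I ?J ?W ?Q ?h m \<epsilon>"
  proof (rule good)
    show "(?I, ?J, ?W, ?Q) \<in> instances n b" by (rule local_instance[OF x(1) k(1)])
    show "\<forall>i\<in>?J. card (adj ?J ?W {i}) \<le> \<Delta>" using local_degree[OF x(1) k(1) Rel_degree] by blast
    show "\<forall>i\<in>?I. real (card (?Q i)) \<le> q * real b ^ card (?W i)"
      using local_compl_card[OF x(1) k(1) compl] inner_outer[OF x(1) k(1)]
      by (auto simp: local_inner_def local_outer_def)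
  qed
  ultimately show False by contradiction
qed

end

subsection \<open>The Borel local lemma\<close>

text \<open>If \<open>p > 0\<close> then \<open>p \<ge> b\<^sup>-\<^sup>d\<close>, so the hypothesis forces \<open>e \<Delta> < b\<^sup>d\<close>; hence the factor
  \<open>b\<close> to the power \<open>\<epsilon> d\<close> dominates \<open>e \<Delta>\<close> to the power \<open>\<epsilon>\<close>.\<close>

lemma local_lemma_slack:
  fixes \<epsilon> :: real
  assumes b: "b > 0" and \<Delta>: "\<Delta> > 0" and \<epsilon>: "\<epsilon> > 0" and l: "l \<le> d"
    and lt: "real b powr (\<epsilon> * real d) * real k / real b ^ l < 1 / (exp 1 * real \<Delta>)"
  shows "real k / real b ^ l * (exp 1 * real \<Delta>) powr (1 + \<epsilon>) < 1"
proof (cases "k = 0")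
  case False
  let ?D = "exp 1 * real \<Delta>" and ?q = "real k / real b ^ l" and ?B = "real b powr (\<epsilon> * real d)"
  have D: "?D > 0" using \<Delta> by simp
  have prod: "?B * ?q * ?D < 1" using lt D by (simp add: field_simps)
  have "1 \<le> ?B" using b \<epsilon> by (intro ge_one_powr_ge_zero) auto
  have "real b ^ l \<le> real b ^ d" using b l by (intro power_increasing) auto
  also have "\<dots> \<le> real k * real b ^ d" using False by (simp add: mult_le_cancel_right1)
  finally have "1 \<le> ?q * real b ^ d" using b by (simp add: field_simps)
  then have "1 * ?D \<le> ?q * real b ^ d * ?D" by (rule mult_right_mono) (use D in simp)
  also have "\<dots> = 1 * (?q * real b ^ d * ?D)" by (rule mult_1[symmetric])
  also have "\<dots> \<le> ?B * (?q * real b ^ d * ?D)"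
    by (rule mult_right_mono[OF \<open>1 \<le> ?B\<close>]) simp
  also have "\<dots> = (?B * ?q * ?D) * real b ^ d" by simp
  also have "\<dots> \<le> 1 * real b ^ d" using prod by (intro mult_right_mono) auto
  finally have "?D \<le> real b powr real d" using b by (simp add: powr_realpow)
  then have "?D powr \<epsilon> \<le> (real b powr real d) powr \<epsilon>" using D \<epsilon> by (intro powr_mono2) auto
  also have "\<dots> = ?B" by (simp add: powr_powr mult.commute)
  finally have "?D powr \<epsilon> \<le> ?B" .
  have "?q * ?D powr (1 + \<epsilon>) = ?q * ?D * ?D powr \<epsilon>" using D by (simp add: powr_add)
  also have "\<dots> \<le> ?q * ?D * ?B" using \<open>?D powr \<epsilon> \<le> ?B\<close> D by (intro mult_left_mono) auto
  also have "\<dots> < 1" using prod by (simp add: mult_ac)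
  finally show ?thesis .
qed simp

lemma degree_le_maxdeg:
  assumes "x \<in> V" "maxdeg V E \<le> enat d"
  shows "finite (Var E x \<union> Cl E x)" "card (Var E x \<union> Cl E x) \<le> d"
proof -
  have "degree E x \<le> enat d"
    using assms SUP_upper[of x V "degree E"] unfolding maxdeg_def by (meson order_trans)
  then show "finite (Var E x \<union> Cl E x)" "card (Var E x \<union> Cl E x) \<le> d"
    by (auto simp: degree_def split: if_splits)
qed

section \<open>Borel measurability of the run\<close>

lemma measurable_count_space_compose2:
  fixes f :: "'a \<Rightarrow> 'b :: countable" and g :: "'a \<Rightarrow> 'c :: countable"
  assumes "f \<in> M \<rightarrow>\<^sub>M count_space UNIV" "g \<in> M \<rightarrow>\<^sub>M count_space UNIV"
  shows "(\<lambda>x. h (f x) (g x)) \<in> M \<rightarrow>\<^sub>M count_space UNIV"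
proof (rule measurable_compose_countable[OF _ assms(1)])
  show "(\<lambda>x. h i (g x)) \<in> M \<rightarrow>\<^sub>M count_space UNIV" for i
    by (rule measurable_compose[OF assms(2)]) simp
qed

lemma measurable_part_of:
  assumes part: "fin_partition (space M) \<pi>" and sets: "\<pi> \<subseteq> sets M"
  shows "part_of \<pi> \<in> M \<rightarrow>\<^sub>M count_space UNIV"
proof -
  have "part_of \<pi> \<in> M \<rightarrow>\<^sub>M count_space \<pi>"
  proof (subst measurable_count_space_eq2)
    show "finite \<pi>" using part by (simp add: fin_partition_def)
    have "part_of \<pi> -` {Q} \<inter> space M = Q" if "Q \<in> \<pi>" for Q
    proof (intro equalityI subsetI)
      fix x assume "x \<in> part_of \<pi> -` {Q} \<inter> space M"
      then show "x \<in> Q" using part_of_in(2)[OF part, of x] by simp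
    next
      fix x assume x: "x \<in> Q"
      then have "x \<in> space M" using part that by (auto simp: fin_partition_def)
      then show "x \<in> part_of \<pi> -` {Q} \<inter> space M" using part_of_eq[OF part that x] by simp
    qed
    then show "part_of \<pi> \<in> space M \<rightarrow> \<pi> \<and> (\<forall>Q\<in>\<pi>. part_of \<pi> -` {Q} \<inter> space M \<in> sets M)"
      using part_of_in[OF part] sets by auto
  qed
  then show ?thesis by (rule measurable_compose[where g = "\<lambda>x. x"]) simp
qed

text \<open>Sparseness puts the variables of a rule into different parts, so every assignment to
  them factors through the partition. Satisfaction becomes a finite disjunction over \<psi> of
  conditions that are Borel in \<open>x\<close> when \<open>f\<close> is Borel; this is how the
  measurability of \<open>rule_code\<close> is exploited.\<close>

lemma rule_code_iff:
  assumes part: "fin_partition (space M) \<pi>" and sparse: "sparse (space M) E 2 \<pi>"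
    and E: "E \<subseteq> space M \<times> space M" and x: "x \<in> space M" and f: "\<And>y. f y < b"
  shows "restrict f (Var E x) \<in> R x \<longleftrightarrow>
    (\<exists>\<psi>\<in>colourings b \<pi>. \<psi> \<in> rule_code b E R \<pi> x \<and> (\<forall>y\<in>Var E x. f y = \<psi> (part_of \<pi> y)))"
proof
  assume "\<exists>\<psi>\<in>colourings b \<pi>. \<psi> \<in> rule_code b E R \<pi> x \<and> (\<forall>y\<in>Var E x. f y = \<psi> (part_of \<pi> y))"
  then obtain \<psi> where \<psi>: "\<psi> \<in> rule_code b E R \<pi> x" "\<forall>y\<in>Var E x. f y = \<psi> (part_of \<pi> y)" by blast
  then have "restrict f (Var E x) = restrict (\<psi> \<circ> part_of \<pi>) (Var E x)" by (intro restrict_ext) simp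
  then show "restrict f (Var E x) \<in> R x" using \<psi>(1) by (simp add: rule_code_def)
next
  assume R: "restrict f (Var E x) \<in> R x"
  have "Var E x \<subseteq> nbhd E x 1" unfolding nbhd_1 by (auto simp: Var_def)
  also have "\<dots> \<subseteq> nbhd E x 2" by (rule nbhd_mono) simp
  finally have inj: "inj_on (part_of \<pi>) (Var E x)"
    using sparse x unfolding sparse_def by (meson inj_on_subset)
  have "Var E x \<subseteq> space M" using E by (auto simp: Var_def)
  then have in_\<pi>: "part_of \<pi> y \<in> \<pi>" if "y \<in> Var E x" for y using part_of_in[OF part] that by auto
  define \<psi> where "\<psi> = restrict (\<lambda>Q. f (inv_into (Var E x) (part_of \<pi>) Q)) \<pi>"
  have \<psi>: "f y = \<psi> (part_of \<pi> y)" if "y \<in> Var E x" for y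
    using that in_\<pi>[OF that] inv_into_f_f[OF inj that] by (simp add: \<psi>_def)
  then have "restrict (\<psi> \<circ> part_of \<pi>) (Var E x) = restrict f (Var E x)" by (intro restrict_ext) simp
  moreover have "\<psi> \<in> colourings b \<pi>" using f by (auto simp: \<psi>_def)
  ultimately show "\<exists>\<psi>\<in>colourings b \<pi>. \<psi> \<in> rule_code b E R \<pi> x \<and> (\<forall>y\<in>Var E x. f y = \<psi> (part_of \<pi> y))"
    using R \<psi> by (intro bexI[of _ \<psi>]) (simp_all add: rule_code_def)
qed

lemma (in resampling) measurable_resampled:
  assumes V: "V = space M" and E: "E \<in> sets (M \<Otimes>\<^sub>M M)"
    and part: "fin_partition (space M) \<pi>" and sets: "\<pi> \<subseteq> sets M" and sparse: "sparse (space M) E 2 \<pi>"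
    and code: "rule_code b E R \<pi> \<in> M \<rightarrow>\<^sub>M count_space (Pow (colourings b \<pi>))"
    and F: "finite F" "F \<subseteq> M \<rightarrow>\<^sub>M M" "\<And>x. x \<in> space M \<Longrightarrow> (\<lambda>g. g x) ` F = nbhd E x 1"
    and c: "c \<in> M \<rightarrow>\<^sub>M count_space UNIV"
  shows "resampled t \<in> M \<rightarrow>\<^sub>M count_space UNIV"
proof (induction t)
  case (Suc t)
  have E_sub': "E \<subseteq> space M \<times> space M" using E_sub V by simp
  have edge: "Measurable.pred M (\<lambda>x. (g x, g' x) \<in> E)" if "g \<in> M \<rightarrow>\<^sub>M M" "g' \<in> M \<rightarrow>\<^sub>M M" for g g'
    using measurable_sets[OF measurable_Pair[OF that] E] by (simp add: pred_def vimage_def Int_def conj_commute)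
  \<comment> \<open>Quantifiers over neighbours become quantifiers over the finite set
    \<open>F\<close> of Borel maps, which preserve measurability.\<close>
  have Var_F: "(\<forall>y\<in>Var E x. P y) \<longleftrightarrow> (\<forall>g\<in>F. (x, g x) \<in> E \<longrightarrow> P (g x))" if "x \<in> space M" for x P
  proof -
    have "y \<in> (\<lambda>g. g x) ` F" if "y \<in> Var E x" for y
      unfolding F(3)[OF \<open>x \<in> space M\<close>] by (rule Var_nbhd[OF that])
    then show ?thesis by (auto simp: Var_def)
  qed
  define S where "S \<psi> x \<longleftrightarrow> \<psi> \<in> rule_code b E R \<pi> x \<and>
      (\<forall>g\<in>F. (x, g x) \<in> E \<longrightarrow> \<omega> (c (g x), resampled t (g x)) = \<psi> (part_of \<pi> (g x)))" for \<psi> x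
  have S: "Measurable.pred M (S \<psi>)" for \<psi>
    unfolding S_def
  proof (intro pred_intros_logic(3) pred_intros_finite(3) F(1))
    show "Measurable.pred M (\<lambda>x. \<psi> \<in> rule_code b E R \<pi> x)"
      by (rule measurable_compose[OF code]) simp
    fix g assume "g \<in> F"
    then have g: "g \<in> M \<rightarrow>\<^sub>M M" using F by auto
    have "(\<lambda>y. \<omega> (c y, resampled t y)) \<in> M \<rightarrow>\<^sub>M count_space UNIV"
      using measurable_count_space_compose2[OF c Suc, of "\<lambda>i j. \<omega> (i, j)"] .
    moreover have "(\<lambda>y. \<psi> (part_of \<pi> y)) \<in> M \<rightarrow>\<^sub>M count_space UNIV"
      by (rule measurable_compose[OF measurable_part_of[OF part sets]]) simp
    ultimately have "Measurable.pred M (\<lambda>x. \<omega> (c (g x), resampled t (g x)) = \<psi> (part_of \<pi> (g x)))"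
      by (intro pred_eq_countable measurable_compose[OF g])
    with edge[OF measurable_ident g]
    show "Measurable.pred M (\<lambda>x. (x, g x) \<in> E \<longrightarrow> \<omega> (c (g x), resampled t (g x)) = \<psi> (part_of \<pi> (g x)))"
      by (intro pred_intros_logic(4)) simp_all
  qed
  have fin: "finite (colourings b \<pi>)"
    using part by (intro finite_PiE) (auto simp: fin_partition_def)
  have viol: "violated (resampled t) x \<longleftrightarrow> \<not> (\<exists>\<psi>\<in>colourings b \<pi>. S \<psi> x)" if "x \<in> space M" for x
  proof -
    have "S \<psi> x \<longleftrightarrow> \<psi> \<in> rule_code b E R \<pi> x \<and>
        (\<forall>y\<in>Var E x. \<omega> (c y, resampled t y) = \<psi> (part_of \<pi> y))" for \<psi>
      unfolding S_def
      using Var_F[OF that, of "\<lambda>y. \<omega> (c y, resampled t y) = \<psi> (part_of \<pi> y)"] by simp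
    moreover have "x \<in> V" using that V by simp
    ultimately show ?thesis
      using rule_code_iff[OF part sparse E_sub' that, of "\<lambda>y. \<omega> (c y, resampled t y)" b R] \<omega>_less
      by (simp add: violated_def)
  qed
  have "Measurable.pred M (\<lambda>x. \<not> (\<exists>\<psi>\<in>colourings b \<pi>. S \<psi> x))"
    by (intro pred_intros_logic(2) pred_intros_finite(4) fin S)
  then have "Measurable.pred M (violated (resampled t))"
    by (subst measurable_cong[OF viol])
  moreover have "Measurable.pred M (\<lambda>x. c x = t mod n)" by (rule measurable_compose[OF c]) simp
  ultimately have act: "Measurable.pred M (active t (resampled t))"
    unfolding active_def by (rule pred_intros_logic(3))
  have upd: "(\<exists>x. active t (resampled t) x \<and> y \<in> Var E x) \<longleftrightarrow>
      (\<exists>g\<in>F. active t (resampled t) (g y) \<and> (g y, y) \<in> E)" if "y \<in> space M" for y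
  proof -
    have "x \<in> (\<lambda>g. g y) ` F" if "y \<in> Var E x" for x
      unfolding F(3)[OF \<open>y \<in> space M\<close>] by (rule nbhd_sym[OF Var_nbhd[OF that]])
    then show ?thesis by (auto simp: Var_def)
  qed
  have "Measurable.pred M (\<lambda>y. \<exists>g\<in>F. active t (resampled t) (g y) \<and> (g y, y) \<in> E)"
  proof (intro pred_intros_finite(4) pred_intros_logic(3) F(1))
    fix g assume "g \<in> F"
    then have g: "g \<in> M \<rightarrow>\<^sub>M M" using F by auto
    show "Measurable.pred M (\<lambda>y. active t (resampled t) (g y))" by (rule measurable_compose[OF g act])
    show "Measurable.pred M (\<lambda>y. (g y, y) \<in> E)" using edge[OF g measurable_ident] by simp
  qed
  moreover have "(\<lambda>y. Suc (resampled t y)) \<in> M \<rightarrow>\<^sub>M count_space UNIV"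
    by (rule measurable_compose[OF Suc]) simp
  ultimately have "(\<lambda>y. if \<exists>g\<in>F. active t (resampled t) (g y) \<and> (g y, y) \<in> E
      then Suc (resampled t y) else resampled t y) \<in> M \<rightarrow>\<^sub>M count_space UNIV"
    using Suc by (intro measurable_If) (simp_all add: pred_def)
  then show ?case
    by (subst measurable_cong[where g = "\<lambda>y. if \<exists>g\<in>F. active t (resampled t) (g y) \<and> (g y, y) \<in> E
      then Suc (resampled t y) else resampled t y"]) (simp_all add: upd)
qed simp

text \<open>An entry in layer \<open>l\<close> reads at positions at most \<open>l\<close>, so only
  the table below \<open>h\<close> matters. Thus the extensional seed may be extended to a total
  one.\<close>

lemma bad_seeds_cong:
  assumes W: "\<And>i. W i \<subseteq> C" and eq: "\<And>y l. y \<in> C \<Longrightarrow> l < h \<Longrightarrow> \<sigma> (y, l) = \<tau> (y, l)"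
  shows "\<sigma> \<in> bad_seeds I J W Q h m \<epsilon> \<longleftrightarrow> \<tau> \<in> bad_seeds I J W Q h m \<epsilon>"
proof -
  have "consistent I W Q \<sigma> Ys \<longleftrightarrow> consistent I W Q \<tau> Ys" if "length Ys = h" for Ys
  proof -
    have "restrict (\<lambda>y. \<sigma> (y, touch W Ys l y)) (W u) = restrict (\<lambda>y. \<tau> (y, touch W Ys l y)) (W u)"
      if "l < h" for l u
      using W that le_less_trans[OF touch_le] by (intro restrict_ext eq) auto
    then show ?thesis using that by (simp add: consistent_def)
  qed
  then show ?thesis by (auto simp: bad_seeds_def layerings_iff)
qed

theorem theorem4p5:
  fixes b r d \<Delta> :: nat and \<epsilon> :: real
    and M :: "'a measure" and E :: "('a \<times> 'a) set" and R :: "'a \<Rightarrow> ('a \<Rightarrow> nat) set"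
  assumes "b \<ge> 2" and "r > 0" and "d > 0" and "\<epsilon> > 0"
    and "borel_colouring_problem b M E R"
    and "maxdeg (space M) E \<le> enat d"
    and "\<forall>x\<in>space M. real (card (nbhd E x (3 * r))) \<le> (1 + \<epsilon>) ^ r"
    and "maxdeg (space M) (Rel (space M) E) = enat \<Delta>" and "\<Delta> > 0"
    and "\<forall>x\<in>space M. real b powr (\<epsilon> * real d) * real (card (rule_compl b E R x))
           / real b ^ card (Var E x) < 1 / (exp 1 * real \<Delta>)"
  shows "\<exists>f \<in> colourings b (space M).
           f \<in> measurable M (count_space {..<b}) \<and> satisfies (space M) E f R"
proof -
  let ?V = "space M"
  have M: "standard_borel_space M" and V_ne: "?V \<noteq> {}" and E_sub: "E \<subseteq> ?V \<times> ?V"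
    and E: "E \<in> sets (M \<Otimes>\<^sub>M M)" and rule: "local_rule b ?V E R"
    using assms(5)
    by (auto simp: borel_colouring_problem_def borel_digraph_def borel_local_rule_def digraph_def)
  obtain \<pi> where \<pi>: "fin_partition ?V \<pi>" "\<pi> \<subseteq> sets M" "sparse ?V E 2 \<pi>"
    "rule_code b E R \<pi> \<in> M \<rightarrow>\<^sub>M count_space (Pow (colourings b \<pi>))"
    using assms(5) by (auto simp: borel_colouring_problem_def borel_local_rule_def)
  obtain F where F: "finite F" "F \<subseteq> M \<rightarrow>\<^sub>M M" "\<And>x. x \<in> ?V \<Longrightarrow> (\<lambda>g. g x) ` F = nbhd E x 1"
    using borel_neighbour_maps[OF M E \<pi>(1-3)] by metis
  obtain c :: "'a \<Rightarrow> nat" and n where c: "c \<in> M \<rightarrow>\<^sub>M count_space UNIV" "\<And>x. x \<in> ?V \<Longrightarrow> c x < n"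
    "\<And>x. x \<in> ?V \<Longrightarrow> inj_on c (nbhd E x (3 * r + 1))"
    using borel_sparse_colouring[OF M V_ne E_sub F] by metis
  have fin_Var: "finite (Var E x)" and fin_Cl: "finite (Cl E x)" and card_Var: "card (Var E x) \<le> d"
    if "x \<in> ?V" for x
    using degree_le_maxdeg[OF that assms(6)] card_mono[of "Var E x \<union> Cl E x" "Var E x"] by auto
  have Rel: "finite {u \<in> ?V. Var E v \<inter> Var E u \<noteq> {}} \<and> card {u \<in> ?V. Var E v \<inter> Var E u \<noteq> {}} \<le> \<Delta>"
    if "v \<in> ?V" for v
  proof -
    let ?N = "Var (Rel ?V E) v \<union> Cl (Rel ?V E) v"
    have N: "finite ?N" "card ?N \<le> \<Delta>"
      using degree_le_maxdeg[OF that, of "Rel ?V E" \<Delta>] assms(8) by simp_all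
    have "{u \<in> ?V. Var E v \<inter> Var E u \<noteq> {}} \<subseteq> ?N" using that by (auto simp: Var_def Rel_def)
    then show ?thesis using N by (meson card_mono finite_subset order_trans)
  qed
  \<comment> \<open>The assumed bound is strict at each single vertex. Bounded degree leaves only
    finitely many values of \<open>p\<close>, so their maximum \<open>q\<close> is attained and
    inherits the strict bound.\<close>
  define p where "p x = real (card (rule_compl b E R x)) / real b ^ card (Var E x)" for x
  have "p ` ?V \<subseteq> (\<lambda>(k, l). real k / real b ^ l) ` ({..b ^ d} \<times> {..d})"
  proof
    fix t assume "t \<in> p ` ?V"
    then obtain x where x: "x \<in> ?V" "t = p x" by blast
    have "card (rule_compl b E R x) \<le> card (colourings b (Var E x))"
      unfolding rule_compl_def by (rule card_mono) (use fin_Var[OF x(1)] in \<open>auto intro: finite_PiE\<close>)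
    also have "\<dots> \<le> b ^ d"
      using fin_Var[OF x(1)] card_Var[OF x(1)] assms(1) by (simp add: card_PiE power_increasing)
    finally show "t \<in> (\<lambda>(k, l). real k / real b ^ l) ` ({..b ^ d} \<times> {..d})"
      using card_Var[OF x(1)] unfolding x(2) p_def by force
  qed
  then have fin_p: "finite (p ` ?V)" by (rule finite_subset) simp
  define q where "q = Max (p ` ?V)"
  obtain x0 where x0: "x0 \<in> ?V" "q = p x0"
    using Max_in[OF fin_p] V_ne unfolding q_def by auto
  have q: "q \<ge> 0" using x0 by (simp add: p_def)
  have \<rho>: "q * (exp 1 * real \<Delta>) powr (1 + \<epsilon>) < 1"
    unfolding x0(2) p_def by (rule local_lemma_slack[where d = d]) (use assms card_Var x0 in auto)
  have compl: "real (card (rule_compl b E R v)) \<le> q * real b ^ card (Var E v)" if "v \<in> ?V" for v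
  proof -
    have "p v \<le> q" unfolding q_def using fin_p that by (intro Max_ge) auto
    then show ?thesis using assms(1) by (simp add: p_def divide_le_eq)
  qed
  obtain m \<sigma> where m: "m > 0" and \<sigma>: "\<sigma> \<in> ({..<n} \<times> {..<n * m + 1}) \<rightarrow>\<^sub>E {..<b}"
    and good: "\<And>I J W Q. \<lbrakk>(I, J, W, Q) \<in> instances n b; \<forall>i\<in>J. card (adj J W {i}) \<le> \<Delta>;
       \<forall>i\<in>I. real (card (Q i)) \<le> q * real b ^ card (W i)\<rbrakk> \<Longrightarrow> \<sigma> \<notin> bad_seeds I J W Q (n * m + 1) m \<epsilon>"
    by (rule exists_good_seed[of b q \<Delta> \<epsilon> n]) (use assms q \<rho> in auto)
  define \<omega> where "\<omega> p = (if p \<in> {..<n} \<times> {..<n * m + 1} then \<sigma> p else 0)" for p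
  have \<omega>_less: "\<omega> p < b" for p using \<sigma> assms(1) by (auto simp: \<omega>_def PiE_iff)
  interpret resampling ?V E R c n r b \<omega>
    by standard (use E_sub fin_Var fin_Cl c rule \<omega>_less in auto)
  have good': "\<omega> \<notin> bad_seeds I J W Q (n * m + 1) m \<epsilon>"
    if "(I, J, W, Q) \<in> instances n b" "\<forall>i\<in>J. card (adj J W {i}) \<le> \<Delta>"
       "\<forall>i\<in>I. real (card (Q i)) \<le> q * real b ^ card (W i)" for I J W Q
  proof -
    have "\<And>i. W i \<subseteq> {..<n}" using that(1) by (simp add: instances_def)
    then show ?thesis using good[OF that] bad_seeds_cong[of W "{..<n}" "n * m + 1" \<omega> \<sigma>] by (simp add: \<omega>_def)
  qed
  have bounded: "activity t v < m" if "v \<in> ?V" for t v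
    by (rule activity_bounded[OF assms(2) m assms(4) _ Rel compl good' that]) (use assms(7) in auto)
  define f where "f = (\<lambda>y. \<omega> (c y, LEAST k. \<forall>t. resampled t y \<le> k))"
  have res: "resampled t \<in> M \<rightarrow>\<^sub>M count_space UNIV" for t
    by (rule measurable_resampled[OF refl E \<pi> F c(1)])
  have "(\<lambda>y. LEAST k. \<forall>t. resampled t y \<le> k) \<in> M \<rightarrow>\<^sub>M count_space UNIV"
    by (intro measurable_Least pred_intros_countable) (rule measurable_compose[OF res], simp)
  from measurable_count_space_compose2[OF c(1) this, of "\<lambda>i j. \<omega> (i, j)"]
  have f: "f \<in> M \<rightarrow>\<^sub>M count_space UNIV" by (simp add: f_def)
  have "satisfies ?V E f R" unfolding f_def by (rule limit_satisfies[OF bounded])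
  moreover have "restrict (restrict f ?V) (Var E x) = restrict f (Var E x)" for x
    by (rule restrict_ext) (use Var_V in auto)
  ultimately have "satisfies ?V E (restrict f ?V) R" by (simp add: satisfies_def)
  moreover have "restrict f ?V \<in> M \<rightarrow>\<^sub>M count_space {..<b}"
  proof (rule measurableI)
    fix A assume "A \<in> sets (count_space {..<b})"
    have "restrict f ?V -` A \<inter> ?V = f -` A \<inter> ?V" by auto
    then show "restrict f ?V -` A \<inter> ?V \<in> sets M" using measurable_sets[OF f, of A] by simp
  qed (use \<omega>_less in \<open>auto simp: f_def\<close>)
  moreover have "restrict f ?V \<in> colourings b ?V" using \<omega>_less by (auto simp: f_def)
  ultimately show ?thesis by blast
qed

end
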